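(* Every B-series method $\Psi$ can be written as the composition $$\Psi = \Psi^- \circ \Psi^+$$ of two B-series methods $\Psi^-$ and $\Psi^+$, where $\Psi^-$ is symmetric and $\Psi^+$ is antisymmetric. Moreover, $$\Psi^- \circ \Psi^- = \Psi \circ \Psi^*,$$ where $\Psi^*$ is the adjoint method of $\Psi$.
   Context: Trees and Hopf algebra. $\mathcal{T}$ is the set of (isomorphism classes of) finite unlabelled non-planar rooted trees, including the empty tree $\emptyset$; $|\tau|$ is the number of vertices, $\bullet$ the one-vertex tree, and $[\tau_1,\ldots,\tau_k]$ the tree obtained by joining the roots of $\tau_1,\ldots,\tau_k$ to a new root. $\mathcal{H}$ is the free commutative $\mathbb{R}$-algebra on the non-empty trees (linear basis: forests; product: juxtaposition; unit: $\emptyset$), graded by the total number $|\cdot|$ of vertices. It is the Butcher--Connes--Kreimer Hopf algebra: $\varepsilon(\emptyset)=1$, $\varepsilon(\tau)=0$ for non-empty $\tau$; $\Delta(\tau)=\tau\otimes\emptyset+\emptyset\otimes\tau+\sum_c P_c(\tau)\otimes R_c(\tau)$ for a non-empty tree $\tau$, the sum running over non-empty sets $c$ of edges such that each path from the root to a leaf meets at most one edge of $c$, where $R_c(\tau)$ is the component containing the root after deleting $c$ and $P_c(\tau)$ the forest of the other components; $\Delta$ is extended as an algebra morphism, and $S$ is the antipode. Characters. A character is a unital algebra homomorphism $\varphi:\mathcal{H}\to\mathbb{R}$; characters form a group under $\varphi_1\varphi_2=\mu_{\mathbb{R}}\circ(\varphi_1\otimes\varphi_2)\circ\Delta$, with unit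 $\varepsilon$ and inverse $\varphi^{-1}=\varphi\circ S$. B-series. For a smooth vector field $f:\mathbb{R}^N\to\mathbb{R}^N$ the elementary differentials are $F(\emptyset)(y)=y$, $F(\bullet)(y)=f(y)$, $F([\tau_1,\ldots,\tau_m])(y)=f^{(m)}(y)(F(\tau_1)(y),\ldots,F(\tau_m)(y))$. The symmetry coefficient is $\sigma(\emptyset)=\sigma(\bullet)=1$, $\sigma([\tau_1^{k_1},\ldots,\tau_m^{k_m}])=\prod_i k_i!\,\sigma(\tau_i)^{k_i}$ (the $\tau_i$ distinct). A B-series method $\Psi$ with character $\psi$ is the formal power series in $h$, $\Psi_h(y)=B_h(\psi,y)=\sum_{\tau\in\mathcal{T}}\frac{h^{|\tau|}}{\sigma(\tau)}\psi(\tau)F(\tau)(y)$, defined for every $f$. B-series methods are identified with their characters. Composition is at equal step size, $(\Psi\circ\Phi)_h=\Psi_h\circ\Phi_h$, and satisfies $B_h(\varphi_2,B_h(\varphi_1,y))=B_h(\varphi_1\varphi_2,y)$. The adjoint method is $\Psi^*_h:=\Psi_{-h}^{-1}$ (compositional inverse). $\Psi$ is symmetric if $\Psi=\Psi^*$. $\Psi$ is antisymmetric if its character is even, i.e. $(-1)^{|\tau|}\psi(\tau)=\psi(\tau)$ for all $\tau$ (equivalently $\Psi_h=\Psi_{-h}$). *)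

theory Defs
  imports
    "HOL-Analysis.Analysis"
    "HOL-Algebra.Group"
    "HOL-Library.Multiset"
    "HOL-Library.Poly_Mapping"
    "HOL-Library.Product_Plus"
    "HOL-Library.Sublist"
begin

section \<open>Rooted trees\<close>

text \<open>
  \<open>Node {#\<tau>\<^sub>1, \<dots>, \<tau>\<^sub>k#}\<close> is the tree obtained by joining the roots of
  \<open>\<tau>\<^sub>1, \<dots>, \<tau>\<^sub>k\<close> to a new root.  Since the branches form a multiset, the elements of this type
  are exactly the isomorphism classes of non-empty finite non-planar rooted trees.  The set of
  all trees, including the empty one (\<open>None\<close>), is the type \<open>rtree option\<close>.
\<close>

datatype rtree = Node "rtree multiset"

type_synonym forest = "rtree multiset"

primrec nverts :: "rtree \<Rightarrow> nat" where
  "nverts (Node M) = Suc (\<Sum>\<^sub># (image_mset nverts M))"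

definition forest_order :: "forest \<Rightarrow> nat" where
  "forest_order \<omega> = \<Sum>\<^sub># (image_mset nverts \<omega>)"

fun tree_order :: "rtree option \<Rightarrow> nat" where
  "tree_order None = 0"
| "tree_order (Some \<tau>) = nverts \<tau>"

fun as_forest :: "rtree option \<Rightarrow> forest" where
  "as_forest None = {#}"
| "as_forest (Some \<tau>) = {#\<tau>#}"

lemma nverts_branch: "\<tau> \<in># M \<Longrightarrow> nverts \<tau> < nverts (Node M)"
  by (auto dest!: multi_member_split)

function symmetry :: "rtree \<Rightarrow> nat" where
  "symmetry (Node M) = (\<Prod>\<tau>\<in>set_mset M. fact (count M \<tau>) * symmetry \<tau> ^ count M \<tau>)"
  by pat_completeness auto
termination
  by (relation "Wellfounded.measure nverts") (auto simp del: nverts.simps intro: nverts_branch)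

fun tree_symmetry :: "rtree option \<Rightarrow> nat" where
  "tree_symmetry None = 1"
| "tree_symmetry (Some \<tau>) = symmetry \<tau>"

section \<open>Cuts\<close>

text \<open>
  To speak about individual edges of a tree we choose a planar representative.  Its vertices are
  addressed by lists of branch numbers read from the root, the root being \<open>[]\<close>; an edge is
  identified with its endpoint away from the root, so that edges are the addresses other
  than \<open>[]\<close>.
\<close>

datatype ptree = PNode "ptree list"

primrec forget :: "ptree \<Rightarrow> rtree" where
  "forget (PNode ts) = Node (mset (map forget ts))"

definition planar :: "rtree \<Rightarrow> ptree" where
  "planar \<tau> = (SOME t. forget t = \<tau>)"

fun subtree_at :: "ptree \<Rightarrow> nat list \<Rightarrow> ptree option" where
  "subtree_at t [] = Some t"
| "subtree_at (PNode ts) (i # p) = (if i < length ts then subtree_at (ts ! i) p else None)"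

definition vertices :: "ptree \<Rightarrow> nat list set" where
  "vertices t = {p. subtree_at t p \<noteq> None}"

definition edges :: "ptree \<Rightarrow> nat list set" where
  "edges t = vertices t - {[]}"

definition leaves :: "ptree \<Rightarrow> nat list set" where
  "leaves t = {p. subtree_at t p = Some (PNode [])}"

text \<open>The edges on the path from the root to \<open>l\<close> are the non-empty prefixes of \<open>l\<close>.\<close>

definition admissible_cuts :: "ptree \<Rightarrow> nat list set set" where
  "admissible_cuts t =
     {c. c \<noteq> {} \<and> c \<subseteq> edges t \<and> (\<forall>l\<in>leaves t. card {p \<in> c. prefix p l} \<le> 1)}"

text \<open>\<open>root_component t c\<close> is the component of the root of \<open>t\<close> after deletion of the edges in \<open>c\<close>:
  a branch is kept, and treated recursively, iff the edge leading to it is not deleted.\<close>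

function root_component :: "ptree \<Rightarrow> nat list set \<Rightarrow> ptree" where
  "root_component (PNode ts) c =
     PNode (map (\<lambda>i. root_component (ts ! i) {p. i # p \<in> c})
                (filter (\<lambda>i. [i] \<notin> c) [0..<length ts]))"
  by pat_completeness auto
termination
proof (relation "Wellfounded.measure (\<lambda>(t, c). size t)", goal_cases)
  case (2 ts c i)
  then have "ts ! i \<in> set ts" by auto
  then have "size (ts ! i) \<le> size_list size ts"
    by (rule size_list_estimation') simp
  then show ?case by simp
qed simp

text \<open>\<open>cut_trunk\<close> and \<open>cut_branches\<close> are \<open>R\<^sub>c\<close> and \<open>P\<^sub>c\<close>; after deletion of \<open>c\<close>, the components
  other than that of the root are rooted at the outer endpoints of the edges in \<open>c\<close>.\<close>

definition cut_trunk :: "ptree \<Rightarrow> nat list set \<Rightarrow> rtree" where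
  "cut_trunk t c = forget (root_component t c)"

definition cut_branches :: "ptree \<Rightarrow> nat list set \<Rightarrow> forest" where
  "cut_branches t c =
     image_mset (\<lambda>p. forget (root_component (the (subtree_at t p)) {q. p @ q \<in> c})) (mset_set c)"

section \<open>The Butcher--Connes--Kreimer bialgebra and its characters\<close>

text \<open>
  Forests are the monomials in the non-empty trees, so the free commutative \<open>\<real>\<close>-algebra on
  the non-empty trees is the monoid algebra of \<open>forest\<close>, with the convolution product of
  \<open>Poly_Mapping\<close>; \<open>Poly_Mapping.single {#} r\<close> is the scalar \<open>r\<close>.  Likewise the tensor square
  is the monoid algebra of \<open>forest \<times> forest\<close>, the pair \<open>(\<alpha>, \<beta>)\<close> standing for \<open>\<alpha> \<otimes> \<beta>\<close>.
\<close>

type_synonym bck = "forest \<Rightarrow>\<^sub>0 real"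
type_synonym bck2 = "(forest \<times> forest) \<Rightarrow>\<^sub>0 real"

abbreviation (input) "lookup \<equiv> Poly_Mapping.lookup"
abbreviation (input) "keys \<equiv> Poly_Mapping.keys"

abbreviation basis :: "forest \<Rightarrow> bck" where
  "basis \<omega> \<equiv> Poly_Mapping.single \<omega> 1"

definition counit :: "bck \<Rightarrow> real" where
  "counit x = lookup x {#}"

definition coproduct_tree :: "rtree \<Rightarrow> bck2" where
  "coproduct_tree \<tau> =
     Poly_Mapping.single ({#\<tau>#}, {#}) 1 + Poly_Mapping.single ({#}, {#\<tau>#}) 1 +
     (\<Sum>c\<in>admissible_cuts (planar \<tau>).
        Poly_Mapping.single (cut_branches (planar \<tau>) c, {#cut_trunk (planar \<tau>) c#}) 1)"

definition coproduct :: "bck \<Rightarrow> bck2" where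
  "coproduct x =
     (\<Sum>\<omega>\<in>keys x.
        Poly_Mapping.single ({#}, {#}) (lookup x \<omega>) * \<Prod>\<^sub># (image_mset coproduct_tree \<omega>))"

definition character :: "(bck \<Rightarrow> real) \<Rightarrow> bool" where
  "character \<phi> \<longleftrightarrow>
     (\<forall>x y. \<phi> (x + y) = \<phi> x + \<phi> y) \<and>
     (\<forall>x y. \<phi> (x * y) = \<phi> x * \<phi> y) \<and>
     (\<forall>r. \<phi> (Poly_Mapping.single {#} r) = r)"

definition convolution :: "(bck \<Rightarrow> real) \<Rightarrow> (bck \<Rightarrow> real) \<Rightarrow> bck \<Rightarrow> real" where
  "convolution \<phi>\<^sub>1 \<phi>\<^sub>2 x =
     (\<Sum>(\<alpha>, \<beta>)\<in>keys (coproduct x).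
        lookup (coproduct x) (\<alpha>, \<beta>) * (\<phi>\<^sub>1 (basis \<alpha>) * \<phi>\<^sub>2 (basis \<beta>)))"

definition character_group :: "(bck \<Rightarrow> real) monoid" where
  "character_group = \<lparr>carrier = {\<phi>. character \<phi>}, mult = convolution, one = counit\<rparr>"

section \<open>B-series methods as characters\<close>

text \<open>
  A B-series method is identified with its character.  As
  \<open>B\<^sub>h(\<phi>\<^sub>2, B\<^sub>h(\<phi>\<^sub>1, y)) = B\<^sub>h(\<phi>\<^sub>1\<phi>\<^sub>2, y)\<close>, composition reverses the order of the factors.
  Replacing \<open>h\<close> by \<open>-h\<close> multiplies the value of the character on a forest \<open>\<omega>\<close> by
  \<open>(-1)\<^bsup>|\<omega>|\<^esup>\<close>.
\<close>

definition char_comp :: "(bck \<Rightarrow> real) \<Rightarrow> (bck \<Rightarrow> real) \<Rightarrow> bck \<Rightarrow> real" where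
  "char_comp \<psi> \<phi> = convolution \<phi> \<psi>"

definition char_reverse :: "(bck \<Rightarrow> real) \<Rightarrow> bck \<Rightarrow> real" where
  "char_reverse \<psi> x =
     (\<Sum>\<omega>\<in>keys x. lookup x \<omega> * ((- 1) ^ forest_order \<omega> * \<psi> (basis \<omega>)))"

definition char_adjoint :: "(bck \<Rightarrow> real) \<Rightarrow> bck \<Rightarrow> real" where
  "char_adjoint \<psi> = inv\<^bsub>character_group\<^esub> (char_reverse \<psi>)"

definition symmetric_char :: "(bck \<Rightarrow> real) \<Rightarrow> bool" where
  "symmetric_char \<psi> \<longleftrightarrow> \<psi> = char_adjoint \<psi>"

definition antisymmetric_char :: "(bck \<Rightarrow> real) \<Rightarrow> bool" where
  "antisymmetric_char \<psi> \<longleftrightarrow>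
     (\<forall>\<tau>. (- 1) ^ tree_order \<tau> * \<psi> (basis (as_forest \<tau>)) = \<psi> (basis (as_forest \<tau>)))"

section \<open>B-series as formal power series\<close>

text \<open>
  The operations on characters above mirror operations on the formal power series
  \<open>B\<^sub>h(\<psi>, y)\<close> themselves, which are defined here for a fixed vector field and without
  reference to the coproduct.  On a fixed \<open>\<real>\<^bsup>N\<^esup>\<close> the series do not determine the character;
  equalities of characters are equalities of methods for all dimensions at once.
\<close>

text \<open>\<open>iter_deriv f [v\<^sub>1, \<dots>, v\<^sub>m] y\<close> is \<open>f\<^bsup>(m)\<^esup>(y)(v\<^sub>1, \<dots>, v\<^sub>m)\<close>.\<close>

fun iter_deriv :: "('a::real_normed_vector \<Rightarrow> 'b::real_normed_vector) \<Rightarrow> 'a list \<Rightarrow> 'a \<Rightarrow> 'b" where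
  "iter_deriv f [] = f"
| "iter_deriv f (v # vs) = (\<lambda>y. frechet_derivative (iter_deriv f vs) (at y) v)"

text \<open>If all iterated directional derivatives are differentiable, then they are continuous, so
  that in finite dimension this is the usual notion of a \<open>C\<^bsup>\<infinity>\<^esup>\<close> map.\<close>

definition smooth :: "('a::real_normed_vector \<Rightarrow> 'b::real_normed_vector) \<Rightarrow> bool" where
  "smooth f \<longleftrightarrow> (\<forall>vs y. iter_deriv f vs differentiable (at y))"

text \<open>The derivatives of a smooth map are symmetric, so the order in which the vectors are listed
  is irrelevant.\<close>

primrec elem_diff_tree ::
    "('a::real_normed_vector \<Rightarrow> 'a) \<Rightarrow> rtree \<Rightarrow> 'a \<Rightarrow> 'a" where
  "elem_diff_tree f (Node M) =
     (\<lambda>y. iter_deriv f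
        (SOME vs. mset vs = image_mset (\<lambda>G. G y) (image_mset (elem_diff_tree f) M)) y)"

fun elem_diff :: "('a::real_normed_vector \<Rightarrow> 'a) \<Rightarrow> rtree option \<Rightarrow> 'a \<Rightarrow> 'a" where
  "elem_diff f None = (\<lambda>y. y)"
| "elem_diff f (Some \<tau>) = elem_diff_tree f \<tau>"

text \<open>A formal power series in \<open>h\<close> is given by its coefficients, \<open>X\<close> standing for
  \<open>X\<^sub>h(y) = \<Sum>n. h\<^bsup>n\<^esup> X n y\<close>.\<close>

type_synonym 'a fseries = "nat \<Rightarrow> 'a \<Rightarrow> 'a"

definition bseries :: "('a::real_normed_vector \<Rightarrow> 'a) \<Rightarrow> (bck \<Rightarrow> real) \<Rightarrow> 'a fseries" where
  "bseries f \<psi> n y =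
     (\<Sum>\<tau> | tree_order \<tau> = n.
        (1 / real (tree_symmetry \<tau>) * \<psi> (basis (as_forest \<tau>))) *\<^sub>R elem_diff f \<tau> y)"

definition taylor_coeff :: "nat \<Rightarrow> (real \<Rightarrow> 'a::real_normed_vector) \<Rightarrow> 'a" where
  "taylor_coeff n u = (1 / fact n) *\<^sub>R ((\<lambda>g t. vector_derivative g (at t)) ^^ n) u 0"

text \<open>The coefficient of \<open>h\<^bsup>n\<^esup>\<close> in \<open>X\<^sub>h(Y\<^sub>h(y))\<close> depends only on the terms of degree at most \<open>n\<close>
  of \<open>X\<close> and \<open>Y\<close>, so it can be read off from the truncations.\<close>

definition fs_comp :: "'a::real_normed_vector fseries \<Rightarrow> 'a fseries \<Rightarrow> 'a fseries" where
  "fs_comp X Y n y =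
     taylor_coeff n (\<lambda>h. \<Sum>k\<le>n. h ^ k *\<^sub>R X k (\<Sum>j\<le>n. h ^ j *\<^sub>R Y j y))"

definition fs_id :: "'a::real_normed_vector fseries" where
  "fs_id n y = (if n = 0 then y else 0)"

definition fs_reverse :: "'a::real_normed_vector fseries \<Rightarrow> 'a fseries" where
  "fs_reverse X n y = (- 1) ^ n *\<^sub>R X n y"

definition fs_inverse :: "'a::real_normed_vector fseries \<Rightarrow> 'a fseries" where
  "fs_inverse X = (THE Y. fs_comp Y X = fs_id \<and> fs_comp X Y = fs_id)"

definition fs_adjoint :: "'a::real_normed_vector fseries \<Rightarrow> 'a fseries" where
  "fs_adjoint X = fs_inverse (fs_reverse X)"

end

theory Submission
  imports Defs
begin

text \<open>
  A character is an arbitrary real function on the non-empty trees, and the group product is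
  triangular: \<open>(a \<cdot> b)(\<tau>) = a(\<tau>) + b(\<tau>)\<close> plus an expression in the values at smaller trees.
  Therefore equations in the character group can be solved tree by tree; in particular
  inverses exist and every element has a unique square root (\<open>tree_conv_square_root\<close>).  The sign
  change \<open>h \<mapsto> -h\<close> is an involutive automorphism \<open>\<theta>\<close> of the group.  A method is symmetric
  iff \<open>\<theta>(m) = m\<^sup>-\<^sup>1\<close> and antisymmetric iff \<open>\<theta>(p) = p\<close>, and its adjoint is \<open>\<theta>(a)\<^sup>-\<^sup>1\<close>.  So the
  claim is a polar decomposition \<open>a = p \<cdot> m\<close> in a group with involution: one has to take
  \<open>m\<^sup>2 = \<theta>(a)\<^sup>-\<^sup>1 \<cdot> a\<close>, and uniqueness of square roots makes \<open>m\<close> symmetric and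
  \<open>p = a \<cdot> m\<^sup>-\<^sup>1\<close> antisymmetric (\<open>tree_function_decomposition\<close>).

  Two facts connect this argument with the definitions.  The first is that characters form a
  group under the product given by admissible cuts.  For a character with values \<open>a\<close> let
  \<open>T\<^sub>a = (a \<otimes> id) \<circ> \<Delta>\<close>.  Sorting the cuts of a tree by branches yields the recursion
  \<open>T\<^sub>a(B\<^sub>+ \<omega>) = a(B\<^sub>+ \<omega>) 1 + B\<^sub>+(T\<^sub>a \<omega>)\<close> (\<open>cut_sum_eq_coact_tree\<close>), from which associativity, in the
  form \<open>T\<^bsub>a\<cdot>b\<^esub> = T\<^sub>b \<circ> T\<^sub>a\<close>, follows by induction (\<open>coact_tree_tree_conv\<close>).

  The second is the composition law \<open>B(b, B(a, y)) = B(a \<cdot> b, y)\<close> for the formal series of a smooth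
  vector field \<open>f\<close> (\<open>tree_bseries_composition\<close>).  It rests on a single expansion: if
  \<open>b(B\<^sub>+ \<omega>)\<close> is the product of \<open>x\<close> over the trees of \<open>\<omega>\<close>, then
  \<open>B(b, y) = y + h f(B(x, y))\<close> (\<open>vector_field_of_bseries\<close>).  For such \<open>b\<close> the law in degree \<open>n + 1\<close>
  follows from the law for \<open>x\<close> in degree \<open>n\<close>, and it extends to all \<open>b\<close> by linearity, since
  functions of this kind span (\<open>mult_span_interpolates\<close>).  Identities of power series are checked
  as \<open>O(h\<^bsup>n+1\<^esup>)\<close> estimates for smooth curves, whose Taylor coefficients they determine.
\<close>

section \<open>Linear and multiplicative extension from monomials\<close>

abbreviation forest_prod :: "(rtree \<Rightarrow> 'r::comm_monoid_mult) \<Rightarrow> forest \<Rightarrow> 'r" where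
  "forest_prod g \<omega> \<equiv> \<Prod>\<^sub># (image_mset g \<omega>)"

text \<open>The same extension from monomials is needed with values in \<open>\<real>\<close>, in \<open>\<H>\<close> and in
  \<open>\<H> \<otimes> \<H>\<close>, so the embedding \<open>\<iota>\<close> of the scalars is a parameter.\<close>

definition scalar_hom :: "(real \<Rightarrow> 'r::comm_ring_1) \<Rightarrow> bool" where
  "scalar_hom \<iota> \<longleftrightarrow> (\<forall>r s. \<iota> (r + s) = \<iota> r + \<iota> s) \<and> (\<forall>r s. \<iota> (r * s) = \<iota> r * \<iota> s) \<and> \<iota> 1 = 1"

definition lin_ext :: "(real \<Rightarrow> 'r::comm_ring_1) \<Rightarrow> ('k \<Rightarrow> 'r) \<Rightarrow> ('k \<Rightarrow>\<^sub>0 real) \<Rightarrow> 'r" where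
  "lin_ext \<iota> G x = (\<Sum>k\<in>keys x. \<iota> (lookup x k) * G k)"

lemma scalar_hom_id: "scalar_hom (\<lambda>r. r)"
  by (simp add: scalar_hom_def)

lemma scalar_hom_single: "scalar_hom (Poly_Mapping.single (0::'k::comm_monoid_add))"
  by (simp add: scalar_hom_def single_add mult_single)

lemma scalar_hom_0: "scalar_hom \<iota> \<Longrightarrow> \<iota> 0 = 0"
  unfolding scalar_hom_def by (metis add_cancel_right_right)

lemma poly_mapping_induct_single [case_names single add]:
  fixes x :: "'k \<Rightarrow>\<^sub>0 real"
  assumes "\<And>k r. P (Poly_Mapping.single k r)" and "\<And>x y. P x \<Longrightarrow> P y \<Longrightarrow> P (x + y)"
  shows "P x"
proof (induction x rule: Poly_Mapping.update_induct)
  case const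
  then show ?case using assms(1)[of _ 0] by simp
next
  case (update f a b)
  have "Poly_Mapping.update a b f = f + Poly_Mapping.single a b"
    using update by (intro poly_mapping_eqI) (auto simp: lookup_update lookup_add lookup_single when_def not_in_keys_iff_lookup_eq_zero)
  then show ?case using assms update by simp
qed

lemma lin_ext_superset:
  assumes "scalar_hom \<iota>" "finite A" "keys x \<subseteq> A"
  shows "lin_ext \<iota> G x = (\<Sum>k\<in>A. \<iota> (lookup x k) * G k)"
  unfolding lin_ext_def
  by (rule sum.mono_neutral_left) (use assms in \<open>auto simp: scalar_hom_0 in_keys_iff\<close>)

lemma lin_ext_single: "scalar_hom \<iota> \<Longrightarrow> lin_ext \<iota> G (Poly_Mapping.single k r) = \<iota> r * G k"
  by (subst lin_ext_superset[where A="{k}"]) (auto)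

lemma lin_ext_add:
  assumes "scalar_hom \<iota>"
  shows "lin_ext \<iota> G (x + y) = lin_ext \<iota> G x + lin_ext \<iota> G y"
proof -
  let ?A = "keys x \<union> keys y"
  have "keys (x + y) \<subseteq> ?A" by (rule keys_add)
  then show ?thesis
    using assms by (simp add: lin_ext_superset[where A="?A"] lookup_add scalar_hom_def distrib_right sum.distrib)
qed

lemma lin_ext_0: "lin_ext \<iota> G 0 = 0"
  by (simp add: lin_ext_def)

lemma lin_ext_sum: "scalar_hom \<iota> \<Longrightarrow> lin_ext \<iota> G (sum f A) = (\<Sum>i\<in>A. lin_ext \<iota> G (f i))"
  by (induction A rule: infinite_finite_induct) (auto simp: lin_ext_0 lin_ext_add)

lemma lin_ext_mult:
  fixes x y :: "'k::comm_monoid_add \<Rightarrow>\<^sub>0 real"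
  assumes "scalar_hom \<iota>" and G: "\<And>k l. G (k + l) = G k * G l"
  shows "lin_ext \<iota> G (x * y) = lin_ext \<iota> G x * lin_ext \<iota> G y"
proof (induction x rule: poly_mapping_induct_single)
  case (single k r)
  show ?case
    by (induction y rule: poly_mapping_induct_single)
       (use assms in \<open>auto simp: lin_ext_single mult_single lin_ext_add distrib_left scalar_hom_def\<close>)
qed (use assms in \<open>simp add: distrib_right lin_ext_add\<close>)

lemma lin_ext_scale:
  fixes x :: "'k::comm_monoid_add \<Rightarrow>\<^sub>0 real"
  assumes "scalar_hom \<iota>"
  shows "lin_ext \<iota> G (Poly_Mapping.single 0 r * x) = \<iota> r * lin_ext \<iota> G x"
  by (induction x rule: poly_mapping_induct_single)
     (use assms in \<open>auto simp: lin_ext_single mult_single lin_ext_add distrib_left scalar_hom_def mult.assoc\<close>)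

text \<open>\<open>\<H>\<close> is generated by the trees, so an algebra morphism composed with the multiplicative
  extension of \<open>g\<close> is the multiplicative extension of the composite.  It is used to evaluate
  functionals of the coproduct.\<close>

lemma hom_lin_ext:
  assumes \<iota>: "scalar_hom \<iota>" "scalar_hom \<iota>'"
    and add: "\<And>x y. H (x + y) = H x + H y" and mult: "\<And>x y. H (x * y) = H x * H y"
    and sc: "\<And>r. H (\<iota> r) = \<iota>' r"
  shows "H (lin_ext \<iota> (forest_prod g) x) = lin_ext \<iota>' (forest_prod (\<lambda>\<tau>. H (g \<tau>))) x"
proof -
  have H1: "H 1 = 1" using sc[of 1] \<iota> by (simp add: scalar_hom_def)
  have "H (forest_prod g \<omega>) = forest_prod (\<lambda>\<tau>. H (g \<tau>)) \<omega>" for \<omega>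
    by (induction \<omega>) (auto simp: H1 mult)
  then show ?thesis
    by (induction x rule: poly_mapping_induct_single)
      (use assms in \<open>auto simp: lin_ext_single lin_ext_add\<close>)
qed

section \<open>Characters as functions on trees\<close>

definition tree_char :: "(rtree \<Rightarrow> real) \<Rightarrow> bck \<Rightarrow> real" where
  "tree_char a = lin_ext (\<lambda>r. r) (forest_prod a)"

lemmas tree_char_add = lin_ext_add[OF scalar_hom_id, of "forest_prod a" for a, folded tree_char_def]
lemmas tree_char_single = lin_ext_single[OF scalar_hom_id, of "forest_prod a" for a, folded tree_char_def]
lemmas tree_char_scale = lin_ext_scale[OF scalar_hom_id, of "forest_prod a" for a, folded tree_char_def]

lemma tree_char_mult: "tree_char a (x * y) = tree_char a x * tree_char a y"
  unfolding tree_char_def by (rule lin_ext_mult[OF scalar_hom_id]) simp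

lemma character_tree_char: "character (tree_char a)"
  by (simp add: character_def tree_char_add tree_char_mult tree_char_single)

text \<open>Since \<open>\<H>\<close> is free on the non-empty trees, the values of a character on them are
  arbitrary and determine it: from here on a character is a function on trees.\<close>

lemma character_eq_tree_char:
  assumes "character \<phi>"
  shows "\<phi> = tree_char (\<lambda>\<tau>. \<phi> (basis {#\<tau>#}))"
proof
  fix x
  have add: "\<phi> (x + y) = \<phi> x + \<phi> y" and mult: "\<phi> (x * y) = \<phi> x * \<phi> y"
    and sc: "\<phi> (Poly_Mapping.single {#} r) = r" for x y r
    using assms by (auto simp: character_def)
  have *: "\<phi> (basis \<omega>) = forest_prod (\<lambda>\<tau>. \<phi> (basis {#\<tau>#})) \<omega>" for \<omega>
  proof (induction \<omega>)
    case (add \<tau> \<omega>)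
    have "basis (add_mset \<tau> \<omega>) = basis {#\<tau>#} * basis \<omega>" by (simp add: mult_single)
    then show ?case using add by (simp add: mult)
  qed (use sc[of 1] in simp)
  show "\<phi> x = tree_char (\<lambda>\<tau>. \<phi> (basis {#\<tau>#})) x"
  proof (induction x rule: poly_mapping_induct_single)
    case (single k r)
    have "Poly_Mapping.single k r = Poly_Mapping.single {#} r * basis k" by (simp add: mult_single)
    then have "\<phi> (Poly_Mapping.single k r) = r * \<phi> (basis k)" by (simp only: mult sc)
    also have "\<phi> (basis k) = forest_prod (\<lambda>\<tau>. \<phi> (basis {#\<tau>#})) k" by (rule *)
    finally show ?case by (simp add: tree_char_single)
  qed (simp add: add tree_char_add)
qed

lemma tree_char_cong:
  assumes "\<And>\<omega> \<tau>. \<omega> \<in> keys x \<Longrightarrow> \<tau> \<in># \<omega> \<Longrightarrow> a \<tau> = b \<tau>"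
  shows "tree_char a x = tree_char b x"
  unfolding tree_char_def lin_ext_def using assms
  by (intro sum.cong refl arg_cong2[of _ _ _ _ "(*)"] arg_cong[of _ _ "prod_mset"] image_mset_cong) auto

lemma counit_eq_tree_char: "counit = tree_char (\<lambda>_. 0)"
proof
  fix x
  show "counit x = tree_char (\<lambda>_. 0) x"
  proof (induction x rule: poly_mapping_induct_single)
    case (single k r)
    show ?case
      by (cases k) (auto simp: counit_def tree_char_single lookup_single)
  qed (simp add: counit_def lookup_add tree_char_add)
qed

section \<open>The coaction of a character\<close>

text \<open>The operator usually written \<open>B\<^sub>+\<close>, extended linearly.\<close>

definition graft :: "bck \<Rightarrow> bck" where
  "graft = lin_ext (Poly_Mapping.single {#}) (\<lambda>\<omega>. basis {#Node \<omega>#})"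

text \<open>\<open>coact_tree a \<tau>\<close> is \<open>(\<phi> \<otimes> id) \<Delta>(\<tau>)\<close> for the character \<open>\<phi>\<close> with values \<open>a\<close>.  The
  recursion is the cocycle identity
  \<open>\<Delta> \<circ> B\<^sub>+ = B\<^sub>+ \<otimes> 1 + (id \<otimes> B\<^sub>+) \<circ> \<Delta>\<close>
  after evaluation of the left factor; that it agrees with the sum over admissible cuts is
  \<open>cut_sum_eq_coact_tree\<close> below.  Evaluating one factor at once replaces coassociativity in
  \<open>\<H> \<otimes> \<H> \<otimes> \<H>\<close> by an identity between endomorphisms of \<open>\<H>\<close>.\<close>

primrec coact_tree :: "(rtree \<Rightarrow> real) \<Rightarrow> rtree \<Rightarrow> bck" where
  "coact_tree a (Node M) =
     Poly_Mapping.single {#} (a (Node M)) + graft (\<Prod>\<^sub># (image_mset (coact_tree a) M))"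

definition coact :: "(rtree \<Rightarrow> real) \<Rightarrow> bck \<Rightarrow> bck" where
  "coact a = lin_ext (Poly_Mapping.single {#}) (forest_prod (coact_tree a))"

text \<open>The product of the character group, read on trees.\<close>

definition tree_conv :: "(rtree \<Rightarrow> real) \<Rightarrow> (rtree \<Rightarrow> real) \<Rightarrow> rtree \<Rightarrow> real" where
  "tree_conv a b \<tau> = tree_char b (coact_tree a \<tau>)"

lemma scalar_hom_forest: "scalar_hom (Poly_Mapping.single ({#}::forest))"
  using scalar_hom_single[where 'k=forest] by simp

lemmas graft_add = lin_ext_add[OF scalar_hom_forest, of "\<lambda>\<omega>. basis {#Node \<omega>#}", folded graft_def]
lemmas graft_scale = lin_ext_scale[OF scalar_hom_forest, of "\<lambda>\<omega>. basis {#Node \<omega>#}", folded graft_def, simplified]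
lemma graft_single: "graft (Poly_Mapping.single \<omega> r) = Poly_Mapping.single {#Node \<omega>#} r"
  by (simp add: graft_def lin_ext_single[OF scalar_hom_forest] mult_single)
lemmas coact_add = lin_ext_add[OF scalar_hom_forest, of "forest_prod (coact_tree a)" for a, folded coact_def]
lemmas coact_single = lin_ext_single[OF scalar_hom_forest, of "forest_prod (coact_tree a)" for a, folded coact_def]
lemma coact_mult: "coact a (x * y) = coact a x * coact a y"
  unfolding coact_def by (rule lin_ext_mult[OF scalar_hom_forest]) simp

lemma forest_prod_hom:
  assumes "H 1 = 1" "\<And>x y. H (x * y) = H x * H y"
  shows "H (forest_prod g \<omega>) = forest_prod (\<lambda>\<tau>. H (g \<tau>)) \<omega>"
  by (induction \<omega>) (auto simp: assms)

lemma coact_one: "coact a 1 = 1"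
  using coact_single[of a 0 1] by simp

lemma tree_char_one: "tree_char a 1 = 1"
  using tree_char_single[of a 0 1] by simp

text \<open>Grafting is again the cocycle identity, now on all of \<open>\<H>\<close>.  The scalar can be written as
  \<open>tree_char a (graft z)\<close> because \<open>graft z\<close> is a linear combination of single trees.\<close>

lemma coact_graft:
  "coact a (graft z) = Poly_Mapping.single {#} (tree_char a (graft z)) + graft (coact a z)"
proof (induction z rule: poly_mapping_induct_single)
  case (single \<omega> r)
  show ?case
    by (simp add: graft_single coact_single tree_char_single distrib_left mult_single
        graft_scale[symmetric])
qed (simp add: graft_add coact_add tree_char_add single_add)

lemma tree_char_tree_conv: "tree_char (tree_conv a b) x = tree_char b (coact a x)"
proof -
  have "tree_char b (lin_ext (Poly_Mapping.single {#}) (forest_prod (coact_tree a)) x)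
      = lin_ext (\<lambda>r. r) (forest_prod (\<lambda>\<tau>. tree_char b (coact_tree a \<tau>))) x"
    by (rule hom_lin_ext[OF scalar_hom_forest scalar_hom_id])
       (auto simp: tree_char_add tree_char_mult tree_char_single)
  then show ?thesis by (simp add: coact_def tree_char_def tree_conv_def[abs_def])
qed

text \<open>Coassociativity.  In the induction step both sides are \<open>B\<^sub>+\<close> of the same forest product plus a
  scalar, and the scalars agree because that of the left-hand side is by definition the
  character \<open>b\<close> applied to \<open>coact_tree a (Node M)\<close>.\<close>

lemma coact_tree_tree_conv: "coact_tree (tree_conv a b) \<tau> = coact b (coact_tree a \<tau>)"
proof (induction \<tau>)
  case (Node M)
  let ?z = "forest_prod (coact_tree a) M"
  have "forest_prod (coact_tree (tree_conv a b)) M = forest_prod (\<lambda>\<tau>. coact b (coact_tree a \<tau>)) M"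
    using Node by (intro arg_cong[of _ _ prod_mset] image_mset_cong) auto
  also have "\<dots> = coact b ?z"
    by (rule forest_prod_hom[symmetric]) (auto simp: coact_one coact_mult)
  finally show ?case
    by (simp add: coact_graft coact_add coact_single tree_conv_def[of a b "Node M"] tree_char_add tree_char_single single_add
        add.assoc)
qed

lemma tree_conv_assoc: "tree_conv (tree_conv a b) c = tree_conv a (tree_conv b c)"
  by (rule ext) (simp add: tree_conv_def coact_tree_tree_conv tree_char_tree_conv)

lemma coact_tree_zero: "coact_tree (\<lambda>_. 0) \<tau> = basis {#\<tau>#}"
proof (induction \<tau>)
  case (Node M)
  have "forest_prod (coact_tree (\<lambda>_. 0)) M = forest_prod (\<lambda>\<tau>. basis {#\<tau>#}) M"
    using Node by (intro arg_cong[of _ _ prod_mset] image_mset_cong) auto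
  also have "\<dots> = basis M"
    by (induction M) (auto simp: mult_single single_one[where 'a=forest, simplified])
  finally show ?case by (simp add: graft_single)
qed

lemma tree_conv_zero_left: "tree_conv (\<lambda>_. 0) b = b"
  by (rule ext) (simp add: tree_conv_def coact_tree_zero tree_char_single)

lemma tree_conv_Node:
  "tree_conv a b (Node M) = a (Node M) + tree_char b (graft (forest_prod (coact_tree a) M))"
  by (simp add: tree_conv_def tree_char_add tree_char_single)

lemma tree_char_graft: "tree_char b (graft z) = lin_ext (\<lambda>r. r) (\<lambda>\<omega>. b (Node \<omega>)) z"
  by (induction z rule: poly_mapping_induct_single)
     (auto simp: graft_single tree_char_single graft_add tree_char_add lin_ext_add[OF scalar_hom_id]
       lin_ext_single[OF scalar_hom_id])

lemma tree_conv_zero_right: "tree_conv a (\<lambda>_. 0) = a"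
proof
  fix \<tau> show "tree_conv a (\<lambda>_. 0) \<tau> = a \<tau>"
    by (cases \<tau>) (simp add: tree_conv_Node tree_char_graft lin_ext_def)
qed

section \<open>Triangularity\<close>

text \<open>Forests are graded by their number of vertices; this says that \<open>x\<close> is \<open>M\<close> up to terms
  of smaller degree.\<close>

definition has_leading_forest :: "forest \<Rightarrow> bck \<Rightarrow> bool" where
  "has_leading_forest M x \<longleftrightarrow> (\<exists>r. x = basis M + r \<and> (\<forall>\<omega>\<in>keys r. forest_order \<omega> < forest_order M))"

lemma forest_order_union [simp]: "forest_order (M + N) = forest_order M + forest_order N"
  by (simp add: forest_order_def)
lemma forest_order_simps [simp]: "forest_order {#} = 0" "forest_order (add_mset \<tau> M) = nverts \<tau> + forest_order M"
  by (auto simp: forest_order_def)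
lemma nverts_Node: "nverts (Node M) = Suc (forest_order M)"
  by (simp add: forest_order_def)

lemma forest_order_member: "\<tau> \<in># M \<Longrightarrow> nverts \<tau> \<le> forest_order M"
  by (auto dest!: multi_member_split)

lemma has_leading_forest_mult:
  assumes "has_leading_forest M x" "has_leading_forest N y"
  shows "has_leading_forest (M + N) (x * y)"
proof -
  from assms obtain r s where r: "x = basis M + r" "\<forall>\<omega>\<in>keys r. forest_order \<omega> < forest_order M"
    and s: "y = basis N + s" "\<forall>\<omega>\<in>keys s. forest_order \<omega> < forest_order N"
    unfolding has_leading_forest_def by blast
  let ?t = "basis M * s + r * basis N + r * s"
  have "x * y = basis (M + N) + ?t"
    by (simp add: r s algebra_simps mult_single)
  moreover have "\<forall>\<omega>\<in>keys ?t. forest_order \<omega> < forest_order (M + N)"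
  proof
    fix \<omega> assume "\<omega> \<in> keys ?t"
    then have "\<omega> \<in> keys (basis M * s) \<or> \<omega> \<in> keys (r * basis N) \<or> \<omega> \<in> keys (r * s)"
      using keys_add[of "basis M * s + r * basis N" "r * s"] keys_add[of "basis M * s" "r * basis N"] by blast
    then obtain \<alpha> \<beta> where "\<omega> = \<alpha> + \<beta>"
      "\<alpha> = M \<and> \<beta> \<in> keys s \<or> \<alpha> \<in> keys r \<and> \<beta> = N \<or> \<alpha> \<in> keys r \<and> \<beta> \<in> keys s"
      using keys_mult[of "basis M" s] keys_mult[of r "basis N"] keys_mult[of r s]
      by (auto 4 3 split: if_splits)
    then show "forest_order \<omega> < forest_order (M + N)"
      using r(2) s(2) by (auto intro: add_strict_mono add_less_le_mono)
  qed
  ultimately show ?thesis unfolding has_leading_forest_def by blast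
qed

lemma keys_graft: "keys (graft z) \<subseteq> (\<lambda>\<omega>. {#Node \<omega>#}) ` keys z"
proof -
  have "graft z = (\<Sum>\<omega>\<in>keys z. Poly_Mapping.single {#Node \<omega>#} (lookup z \<omega>))"
    by (simp add: graft_def lin_ext_def mult_single)
  also have "keys \<dots> \<subseteq> (\<Union>\<omega>\<in>keys z. keys (Poly_Mapping.single {#Node \<omega>#} (lookup z \<omega>)))"
    by (rule keys_sum)
  also have "\<dots> \<subseteq> (\<lambda>\<omega>. {#Node \<omega>#}) ` keys z" by auto
  finally show ?thesis .
qed

lemma has_leading_forest_graft: "has_leading_forest M z \<Longrightarrow> has_leading_forest {#Node M#} (graft z)"
  unfolding has_leading_forest_def
proof (elim exE conjE)
  fix r assume r: "z = basis M + r" "\<forall>\<omega>\<in>keys r. forest_order \<omega> < forest_order M"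
  show "\<exists>r. graft z = basis {#Node M#} + r \<and> (\<forall>\<omega>\<in>keys r. forest_order \<omega> < forest_order {#Node M#})"
    by (rule exI[of _ "graft r"])
       (use r keys_graft[of r] in \<open>auto simp: graft_add graft_single nverts_Node simp del: nverts.simps\<close>)
qed

lemma has_leading_forest_prod:
  assumes "\<And>\<tau>. \<tau> \<in># M \<Longrightarrow> has_leading_forest {#\<tau>#} (g \<tau>)"
  shows "has_leading_forest M (forest_prod g M)"
  using assms
proof (induction M)
  case empty
  show ?case unfolding has_leading_forest_def by (rule exI[of _ 0]) (simp add: single_one[where 'a=forest, simplified])
next
  case (add \<tau> M)
  then show ?case using has_leading_forest_mult[of "{#\<tau>#}" "g \<tau>" M] by simp
qed

lemma has_leading_forest_coact_tree: "has_leading_forest {#\<tau>#} (coact_tree a \<tau>)"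
proof (induction \<tau>)
  case (Node M)
  from has_leading_forest_graft[OF has_leading_forest_prod[OF Node]]
  obtain r where r: "graft (forest_prod (coact_tree a) M) = basis {#Node M#} + r"
     "\<forall>\<omega>\<in>keys r. forest_order \<omega> < forest_order {#Node M#}" unfolding has_leading_forest_def by blast
  let ?s = "Poly_Mapping.single {#} (a (Node M))"
  have "keys (?s + r) \<subseteq> {{#}} \<union> keys r"
  proof -
    have "keys ?s \<subseteq> {{#}}" by simp
    then show ?thesis using keys_add[of ?s r] by blast
  qed
  then show ?case
    unfolding has_leading_forest_def by (intro exI[of _ "?s + r"])
      (use r in \<open>auto simp: nverts_Node simp del: nverts.simps\<close>)
qed

lemma has_leading_forest_coact: "has_leading_forest M (forest_prod (coact_tree a) M)"
  by (rule has_leading_forest_prod) (rule has_leading_forest_coact_tree)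

lemma coact_tree_cong:
  "(\<And>\<sigma>. nverts \<sigma> \<le> nverts \<tau> \<Longrightarrow> a \<sigma> = b \<sigma>) \<Longrightarrow> coact_tree a \<tau> = coact_tree b \<tau>"
proof (induction \<tau>)
  case (Node M)
  have "forest_prod (coact_tree a) M = forest_prod (coact_tree b) M"
  proof (intro arg_cong[of _ _ prod_mset] image_mset_cong)
    fix \<tau> assume t: "\<tau> \<in># M"
    show "coact_tree a \<tau> = coact_tree b \<tau>"
    proof (rule Node.IH[OF t])
      fix \<sigma> assume "nverts \<sigma> \<le> nverts \<tau>"
      then show "a \<sigma> = b \<sigma>" using nverts_branch[OF t] by (intro Node.prems) linarith
    qed
  qed
  then show ?case using Node.prems by simp
qed

text \<open>The group product is addition up to a correction that involves only smaller trees: the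
  empty and the full cut contribute \<open>b \<tau>\<close> and \<open>a \<tau>\<close>, every other cut leaves a smaller trunk
  and smaller branches.  All equations in the character group are solved degree by degree by
  means of this lemma.\<close>

lemma tree_conv_triangular:
  assumes a: "\<And>\<sigma>. nverts \<sigma> < nverts \<tau> \<Longrightarrow> a \<sigma> = a' \<sigma>"
    and b: "\<And>\<sigma>. nverts \<sigma> < nverts \<tau> \<Longrightarrow> b \<sigma> = b' \<sigma>"
  shows "tree_conv a b \<tau> - a \<tau> - b \<tau> = tree_conv a' b' \<tau> - a' \<tau> - b' \<tau>"
proof (cases \<tau>)
  case (Node M)
  have "forest_prod (coact_tree a) M = forest_prod (coact_tree a') M"
  proof (intro arg_cong[of _ _ prod_mset] image_mset_cong coact_tree_cong)
    fix \<sigma> \<rho> assume t: "\<sigma> \<in># M" "nverts \<rho> \<le> nverts \<sigma>"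
    then show "a \<rho> = a' \<rho>" using nverts_branch[OF t(1)] Node by (intro a) (simp del: nverts.simps)
  qed
  moreover obtain r where r: "graft (forest_prod (coact_tree a') M) = basis {#Node M#} + r"
     "\<forall>\<omega>\<in>keys r. forest_order \<omega> < forest_order {#Node M#}"
    using has_leading_forest_graft[OF has_leading_forest_coact, of M a'] unfolding has_leading_forest_def by blast
  moreover have "tree_char b r = tree_char b' r"
  proof (rule tree_char_cong)
    fix \<omega> \<sigma> assume "\<omega> \<in> keys r" "\<sigma> \<in># \<omega>"
    then have "nverts \<sigma> < nverts \<tau>"
      using r(2) forest_order_member[of \<sigma> \<omega>] Node by force
    then show "b \<sigma> = b' \<sigma>" by (rule b)
  qed
  ultimately show ?thesis by (simp add: Node tree_conv_Node tree_char_add tree_char_single)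
qed

text \<open>The values of \<open>\<Phi>\<^bsup>k\<^esup>\<close> at arguments of degree less than \<open>k\<close> do not depend on the starting
  point, so the iterates stabilise degreewise.\<close>

lemma triangular_fixpoint:
  fixes \<Phi> :: "('t \<Rightarrow> 'b) \<Rightarrow> 't \<Rightarrow> 'b" and d :: "'t \<Rightarrow> nat"
  assumes "\<And>a a' \<tau>. (\<And>\<sigma>. d \<sigma> < d \<tau> \<Longrightarrow> a \<sigma> = a' \<sigma>) \<Longrightarrow> \<Phi> a \<tau> = \<Phi> a' \<tau>"
  shows "\<exists>!a. \<Phi> a = a"
proof
  fix z :: "'t \<Rightarrow> 'b"
  (* By stability any starting point gives the same A; the value undefined is never seen. *)
  define A where "A \<tau> = (\<Phi> ^^ Suc (d \<tau>)) undefined \<tau>" for \<tau>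
  have stab: "d \<sigma> < k \<Longrightarrow> (\<Phi> ^^ k) u \<sigma> = (\<Phi> ^^ k) v \<sigma>" for \<sigma> k u v
  proof (induction k arbitrary: \<sigma> u v)
    case (Suc k)
    show ?case unfolding funpow.simps comp_def
      by (rule assms) (use Suc in auto)
  qed simp
  have A: "A \<sigma> = (\<Phi> ^^ k) undefined \<sigma>" if "d \<sigma> < k" for \<sigma> k
  proof -
    obtain j where "k = Suc (d \<sigma>) + j" using \<open>d \<sigma> < k\<close> by (metis Suc_leI le_iff_add)
    then have "(\<Phi> ^^ k) undefined \<sigma> = (\<Phi> ^^ Suc (d \<sigma>)) ((\<Phi> ^^ j) undefined) \<sigma>"
      by (simp only: funpow_add comp_def)
    also have "\<dots> = A \<sigma>" unfolding A_def by (rule stab) simp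
    finally show ?thesis ..
  qed
  show "\<Phi> A = A"
  proof
    fix \<tau>
    have "\<Phi> A \<tau> = \<Phi> ((\<Phi> ^^ d \<tau>) undefined) \<tau>" by (rule assms) (rule A)
    then show "\<Phi> A \<tau> = A \<tau>" by (simp add: A_def)
  qed
  fix B assume B: "\<Phi> B = B"
  have "\<forall>\<tau>. d \<tau> = n \<longrightarrow> B \<tau> = A \<tau>" for n
  proof (induction n rule: less_induct)
    case (less n)
    show ?case
    proof (intro allI impI)
      fix \<tau> assume "d \<tau> = n"
      then have "\<Phi> B \<tau> = \<Phi> A \<tau>" using less by (intro assms) auto
      then show "B \<tau> = A \<tau>" using B \<open>\<Phi> A = A\<close> by simp
    qed
  qed
  then show "B = A" by auto
qed

lemma tree_conv_left_inverse: "\<exists>b. tree_conv b a = (\<lambda>_. 0)"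
proof -
  have "\<exists>!b. (\<lambda>\<tau>. b \<tau> - tree_conv b a \<tau>) = b"
  proof (rule triangular_fixpoint[where d=nverts])
    fix b b' :: "rtree \<Rightarrow> real" and \<tau> assume "\<And>\<sigma>. nverts \<sigma> < nverts \<tau> \<Longrightarrow> b \<sigma> = b' \<sigma>"
    then have "tree_conv b a \<tau> - b \<tau> - a \<tau> = tree_conv b' a \<tau> - b' \<tau> - a \<tau>"
      by (intro tree_conv_triangular) auto
    then show "b \<tau> - tree_conv b a \<tau> = b' \<tau> - tree_conv b' a \<tau>" by simp
  qed
  then obtain b where b: "(\<lambda>\<tau>. b \<tau> - tree_conv b a \<tau>) = b" by blast
  have "tree_conv b a \<tau> = 0" for \<tau> using fun_cong[OF b, of \<tau>] by simp
  then show ?thesis by blast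
qed

text \<open>In \<open>m \<cdot> m = c\<close> the value \<open>m \<tau>\<close> occurs as \<open>2 m \<tau>\<close> plus terms in smaller trees, and \<open>2\<close> is
  invertible in \<open>\<real>\<close>.\<close>

lemma tree_conv_square_root: "\<exists>!m. tree_conv m m = c"
proof -
  (* A Newton step for m m = c: halving cancels the two occurrences of m at the top degree. *)
  have "\<exists>!m. (\<lambda>\<tau>. m \<tau> + (c \<tau> - tree_conv m m \<tau>) / 2) = m"
  proof (rule triangular_fixpoint[where d=nverts])
    fix b b' :: "rtree \<Rightarrow> real" and \<tau> assume "\<And>\<sigma>. nverts \<sigma> < nverts \<tau> \<Longrightarrow> b \<sigma> = b' \<sigma>"
    then have "tree_conv b b \<tau> - b \<tau> - b \<tau> = tree_conv b' b' \<tau> - b' \<tau> - b' \<tau>"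
      by (intro tree_conv_triangular) auto
    then show "b \<tau> + (c \<tau> - tree_conv b b \<tau>) / 2 = b' \<tau> + (c \<tau> - tree_conv b' b' \<tau>) / 2" by (simp add: field_simps)
  qed
  moreover have "(\<lambda>\<tau>. m \<tau> + (c \<tau> - tree_conv m m \<tau>) / 2) = m \<longleftrightarrow> tree_conv m m = c" for m
    by (auto simp: fun_eq_iff)
  ultimately show ?thesis by simp
qed

section \<open>Reversal of the step size\<close>

text \<open>The effect on the tree function of replacing \<open>h\<close> by \<open>-h\<close>.\<close>

definition tree_rev :: "(rtree \<Rightarrow> real) \<Rightarrow> rtree \<Rightarrow> real" where
  "tree_rev a \<tau> = (- 1) ^ nverts \<tau> * a \<tau>"

lemma forest_prod_tree_rev: "forest_prod (tree_rev a) \<omega> = (- 1) ^ forest_order \<omega> * forest_prod a \<omega>"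
  by (induction \<omega>) (auto simp: tree_rev_def power_add)

lemma char_reverse_tree_char: "char_reverse (tree_char a) = tree_char (tree_rev a)"
  unfolding char_reverse_def tree_char_single
  by (rule ext) (simp add: forest_prod_tree_rev tree_char_def lin_ext_def)

text \<open>The grading automorphism of \<open>\<H>\<close>.\<close>

definition sign_flip :: "bck \<Rightarrow> bck" where
  "sign_flip = lin_ext (Poly_Mapping.single {#}) (\<lambda>\<omega>. Poly_Mapping.single \<omega> ((- 1) ^ forest_order \<omega>))"

lemmas sign_flip_add = lin_ext_add[OF scalar_hom_forest, of "\<lambda>\<omega>. Poly_Mapping.single \<omega> ((- 1) ^ forest_order \<omega>)", folded sign_flip_def]
lemma sign_flip_single: "sign_flip (Poly_Mapping.single \<omega> r) = Poly_Mapping.single \<omega> (r * (- 1) ^ forest_order \<omega>)"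
  by (simp add: sign_flip_def lin_ext_single[OF scalar_hom_forest] mult_single)
lemma sign_flip_mult: "sign_flip (x * y) = sign_flip x * sign_flip y"
  unfolding sign_flip_def by (rule lin_ext_mult[OF scalar_hom_forest]) (simp add: mult_single power_add)
lemma sign_flip_one: "sign_flip 1 = 1"
  using sign_flip_single[of 0 1] by simp

lemma sign_flip_graft: "sign_flip (graft z) = - graft (sign_flip z)"
  by (induction z rule: poly_mapping_induct_single)
    (auto simp: graft_single sign_flip_single graft_add sign_flip_add nverts_Node single_uminus simp del: nverts.simps)

text \<open>The coproduct preserves the number of vertices: the sign of the left tensor factor is the
  sign of \<open>\<tau>\<close> times that of the right factor.\<close>

lemma coact_tree_tree_rev:
  "coact_tree (tree_rev a) \<tau> = Poly_Mapping.single {#} ((- 1) ^ nverts \<tau>) * sign_flip (coact_tree a \<tau>)"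
proof (induction \<tau>)
  case (Node M)
  let ?s = "\<lambda>n. Poly_Mapping.single ({#}::forest) ((- 1::real) ^ n)"
  have "forest_prod (coact_tree (tree_rev a)) M = forest_prod (\<lambda>\<tau>. ?s (nverts \<tau>) * sign_flip (coact_tree a \<tau>)) M"
    using Node by (intro arg_cong[of _ _ prod_mset] image_mset_cong) auto
  also have "\<dots> = ?s (forest_order M) * forest_prod (\<lambda>\<tau>. sign_flip (coact_tree a \<tau>)) M"
    by (induction M) (auto simp: power_add mult_single[of "{#}" _ "{#}", symmetric, simplified] ac_simps
       single_one[where 'a=forest, simplified])
  also have "forest_prod (\<lambda>\<tau>. sign_flip (coact_tree a \<tau>)) M = sign_flip (forest_prod (coact_tree a) M)"
    by (rule forest_prod_hom[symmetric]) (auto simp: sign_flip_mult sign_flip_one)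
  finally have "forest_prod (coact_tree (tree_rev a)) M = ?s (forest_order M) * sign_flip (forest_prod (coact_tree a) M)" .
  then show ?case
    by (simp add: graft_scale sign_flip_add sign_flip_single sign_flip_graft distrib_left right_diff_distrib mult_single tree_rev_def[of a "Node M"]
        forest_order_def[symmetric] single_uminus)
qed

lemma tree_char_tree_rev_sign_flip: "tree_char (tree_rev b) (sign_flip x) = tree_char b x"
  by (induction x rule: poly_mapping_induct_single)
     (auto simp: sign_flip_single tree_char_single sign_flip_add tree_char_add forest_prod_tree_rev
       simp flip: power_add mult_2)

lemma tree_rev_tree_conv: "tree_rev (tree_conv a b) = tree_conv (tree_rev a) (tree_rev b)"
  by (rule ext) (simp add: tree_conv_def coact_tree_tree_rev tree_char_scale[simplified] tree_char_tree_rev_sign_flip tree_rev_def)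

section \<open>The coproduct computes the coaction\<close>

text \<open>The admissible cuts together with two degenerate ones: the empty cut, and \<open>{[]}\<close>, which cuts
  an imaginary edge above the root.  They account for the terms \<open>\<emptyset> \<otimes> \<tau>\<close> and \<open>\<tau> \<otimes> \<emptyset>\<close> of the
  coproduct.  With them a cut of a tree that does not contain \<open>[]\<close> is the same as an independent
  choice of one such cut in every branch, \<open>{[]}\<close> in a branch meaning that the edge leading to
  it is cut.\<close>

definition root_cuts :: "ptree \<Rightarrow> nat list set set" where
  "root_cuts t = {c. c \<subseteq> vertices t \<and> (\<forall>l\<in>leaves t. card {p \<in> c. prefix p l} \<le> 1)}"

definition trunk_forest :: "ptree \<Rightarrow> nat list set \<Rightarrow> forest" where
  "trunk_forest t c = (if [] \<in> c then {#} else {#cut_trunk t c#})"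

lemma vertices_PNode: "vertices (PNode ts) = insert [] (\<Union>i<length ts. Cons i ` vertices (ts ! i))"
proof (rule Set.set_eqI)
  fix p show "p \<in> vertices (PNode ts) \<longleftrightarrow> p \<in> insert [] (\<Union>i<length ts. Cons i ` vertices (ts ! i))"
    by (cases p) (auto simp: vertices_def)
qed

lemma leaves_PNode:
  assumes "ts \<noteq> []"
  shows "leaves (PNode ts) = (\<Union>i<length ts. Cons i ` leaves (ts ! i))"
proof (rule Set.set_eqI)
  fix p show "p \<in> leaves (PNode ts) \<longleftrightarrow> p \<in> (\<Union>i<length ts. Cons i ` leaves (ts ! i))"
    using assms by (cases p) (auto simp: leaves_def)
qed

lemma Nil_vertex: "[] \<in> vertices t"
  by (cases t) (simp add: vertices_PNode)

lemma finite_vertices: "finite (vertices t)"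
  by (induction t) (auto simp: vertices_PNode)

lemma vertex_below_leaf: "p \<in> vertices t \<Longrightarrow> \<exists>l\<in>leaves t. prefix p l"
proof (induction t arbitrary: p)
  case (PNode ts)
  show ?case
  proof (cases "ts = []")
    case True
    then show ?thesis using PNode.prems by (auto simp: vertices_PNode leaves_def intro!: exI[of _ "[]"])
  next
    case False
    have "\<exists>i q. i < length ts \<and> q \<in> vertices (ts ! i) \<and> prefix p (i # q)"
    proof (cases p)
      case Nil
      then show ?thesis using False Nil_vertex[of "ts ! 0"] by auto
    next
      case (Cons i q)
      then show ?thesis using PNode.prems by (auto simp: vertices_PNode)
    qed
    then obtain i q where iq: "i < length ts" "q \<in> vertices (ts ! i)" "prefix p (i # q)" by blast
    then obtain l where "l \<in> leaves (ts ! i)" "prefix q l"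
      using PNode.IH[of "ts ! i" q] by auto
    then have "i # l \<in> leaves (PNode ts)" "prefix p (i # l)"
      using iq False prefix_order.trans[OF iq(3), of "i # l"] by (auto simp: leaves_PNode)
    then show ?thesis by blast
  qed
qed

text \<open>Every vertex lies below the root and above some leaf, so a cut through \<open>[]\<close> has no room for a
  second element.\<close>

lemma root_cuts_root:
  assumes "c \<in> root_cuts t" "[] \<in> c"
  shows "c = {[]}"
proof -
  have "p = []" if "p \<in> c" for p
  proof -
    from that assms obtain l where l: "l \<in> leaves t" "prefix p l"
      using vertex_below_leaf[of p t] by (auto simp: root_cuts_def)
    have "finite c" using assms finite_vertices by (auto simp: root_cuts_def intro: finite_subset)
    then have "finite {p \<in> c. prefix p l}" by simp
    moreover have "card {p \<in> c. prefix p l} \<le> 1" using assms l by (auto simp: root_cuts_def)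
    moreover have "{[], p} \<subseteq> {p \<in> c. prefix p l}" using assms that l by auto
    ultimately have "card {[], p} \<le> 1" by (meson card_mono le_trans)
    then show ?thesis by (cases "p = []") auto
  qed
  then show ?thesis using assms by auto
qed

lemma finite_root_cuts: "finite (root_cuts t)"
  by (rule finite_subset[of _ "Pow (vertices t)"]) (auto simp: root_cuts_def finite_vertices)

lemma root_cuts_eq: "root_cuts t = insert {} (insert {[]} (admissible_cuts t))"
proof (rule Set.set_eqI, rule iffI)
  fix c assume "c \<in> root_cuts t"
  then show "c \<in> insert {} (insert {[]} (admissible_cuts t))"
    using root_cuts_root[of c t] by (cases "[] \<in> c") (auto simp: root_cuts_def admissible_cuts_def edges_def)
next
  fix c assume "c \<in> insert {} (insert {[]} (admissible_cuts t))"
  moreover have "{p. p = [] \<and> prefix p l} = {[]}" for l :: "nat list" by auto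
  ultimately show "c \<in> root_cuts t"
    using Nil_vertex by (auto simp: root_cuts_def admissible_cuts_def edges_def)
qed

lemma root_component_empty: "root_component t {} = t"
  by (induction t) (simp, rule nth_equalityI, auto)

lemma root_component_root: "root_component t {[]} = t"
  by (cases t) (simp add: map_nth root_component_empty)

lemma cut_branches_simps: "cut_branches t {} = {#}" "cut_branches t {[]} = {#forget t#}"
proof -
  have "{q. q = []} = {[]::nat list}" by auto
  then show "cut_branches t {} = {#}" "cut_branches t {[]} = {#forget t#}"
    by (auto simp: cut_branches_def root_component_root)
qed

text \<open>Every rooted tree has a planar representative, so the choice in \<open>planar\<close> succeeds.\<close>

lemma forget_planar: "forget (planar \<tau>) = \<tau>"
proof -
  have "\<exists>t. forget t = \<sigma>" for \<sigma>
  proof (induction \<sigma>)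
    case (Node M)
    obtain rs where rs: "mset rs = M" using ex_mset by blast
    then have "\<forall>\<rho>\<in>set rs. \<exists>t. forget t = \<rho>" using Node by auto
    then obtain g where "\<forall>\<rho>\<in>set rs. forget (g \<rho>) = \<rho>" by metis
    then have "forget (PNode (map g rs)) = Node M" using rs by (simp add: map_idI)
    then show ?case ..
  qed
  then show ?thesis unfolding planar_def by (rule someI_ex)
qed

lemma coproduct_tree_root_cuts:
  "coproduct_tree \<tau> = (\<Sum>c\<in>root_cuts (planar \<tau>).
     Poly_Mapping.single (cut_branches (planar \<tau>) c, trunk_forest (planar \<tau>) c) 1)"
proof -
  have pl: "forget (planar \<tau>) = \<tau>" by (rule forget_planar)
  have fin: "finite (admissible_cuts (planar \<tau>))"
    using finite_root_cuts[of "planar \<tau>"] by (simp add: root_cuts_eq)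
  have "[] \<notin> c" "c \<noteq> {}" if "c \<in> admissible_cuts (planar \<tau>)" for c
    using that by (auto simp: admissible_cuts_def edges_def)
  then have "(\<Sum>c\<in>root_cuts (planar \<tau>).
     Poly_Mapping.single (cut_branches (planar \<tau>) c, trunk_forest (planar \<tau>) c) (1::real)) =
     Poly_Mapping.single ({#}, {#\<tau>#}) 1 + (Poly_Mapping.single ({#\<tau>#}, {#}) 1 +
     (\<Sum>c\<in>admissible_cuts (planar \<tau>).
        Poly_Mapping.single (cut_branches (planar \<tau>) c, {#cut_trunk (planar \<tau>) c#}) 1))"
    unfolding root_cuts_eq using fin
    by (subst sum.insert sum.insert, force, force)+
       (auto simp: cut_branches_simps trunk_forest_def cut_trunk_def root_component_empty pl intro!: sum.cong)
  then show ?thesis unfolding coproduct_tree_def by (simp add: ac_simps)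
qed

lemma mset_map_filter_upt:
  "mset (map f (filter P [0..<n])) = (\<Sum>i<n. if P i then {#f i#} else {#})"
  by (induction n) auto

lemma cut_trunk_PNode:
  "cut_trunk (PNode ts) c = Node (\<Sum>i<length ts. trunk_forest (ts ! i) {p. i # p \<in> c})"
proof -
  have "cut_trunk (PNode ts) c = Node (mset (map (\<lambda>i. cut_trunk (ts ! i) {p. i # p \<in> c}) (filter (\<lambda>i. [i] \<notin> c) [0..<length ts])))"
    by (simp add: cut_trunk_def image_mset.compositionality comp_def)
  also have "\<dots> = Node (\<Sum>i<length ts. trunk_forest (ts ! i) {p. i # p \<in> c})"
    unfolding mset_map_filter_upt by (auto simp: trunk_forest_def intro!: sum.cong)
  finally show ?thesis .
qed

lemma address_set_split:
  assumes "c \<subseteq> (\<Union>i<n. Cons i ` V i)"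
  shows "(\<Union>i<n. Cons i ` {p. i # p \<in> c}) = c"
proof (rule Set.set_eqI)
  fix p show "p \<in> (\<Union>i<n. Cons i ` {p. i # p \<in> c}) \<longleftrightarrow> p \<in> c"
    using assms by (cases p) (auto dest: subsetD)
qed

lemma forest_prod_cut_branches:
  "forest_prod a (cut_branches t c) =
     (\<Prod>p\<in>c. a (forget (root_component (the (subtree_at t p)) {q. p @ q \<in> c})))"
  by (simp add: cut_branches_def prod_unfold_prod_mset image_mset.compositionality comp_def)

lemma forest_prod_cut_branches_PNode:
  assumes "c \<subseteq> (\<Union>i<length ts. Cons i ` vertices (ts ! i))"
  shows "forest_prod a (cut_branches (PNode ts) c) =
     (\<Prod>i<length ts. forest_prod a (cut_branches (ts ! i) {p. i # p \<in> c}))"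
proof -
  let ?G = "\<lambda>p. a (forget (root_component (the (subtree_at (PNode ts) p)) {q. p @ q \<in> c}))"
  let ?c = "\<lambda>i. {p. i # p \<in> c}"
  have c: "c = (\<Union>i<length ts. Cons i ` ?c i)" by (rule address_set_split[OF assms, symmetric])
  have fin: "finite (?c i)" if "i < length ts" for i
    by (rule finite_subset[OF _ finite_vertices[of "ts ! i"]]) (use assms in auto)
  have "forest_prod a (cut_branches (PNode ts) c) = prod ?G (\<Union>i<length ts. Cons i ` ?c i)"
    by (simp only: forest_prod_cut_branches c[symmetric])
  also have "\<dots> = (\<Prod>i<length ts. prod ?G (Cons i ` ?c i))"
    using fin by (intro prod.UNION_disjoint) auto
  also have "\<dots> = (\<Prod>i<length ts. forest_prod a (cut_branches (ts ! i) (?c i)))"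
    by (intro prod.cong refl) (simp add: prod.reindex forest_prod_cut_branches)
  finally show ?thesis .
qed

lemma bij_root_cuts_PNode:
  "bij_betw (\<lambda>c. \<lambda>i\<in>{..<length ts}. {p. i # p \<in> c}) {c \<in> root_cuts (PNode ts). [] \<notin> c}
     (PiE {..<length ts} (\<lambda>i. root_cuts (ts ! i)))"
proof (rule bij_betw_byWitness[where f' = "\<lambda>g. \<Union>i<length ts. Cons i ` g i"], goal_cases)
  case 1
  have "(\<Union>i<length ts. (#) i ` {p. i # p \<in> c}) = c" if "c \<in> root_cuts (PNode ts)" "[] \<notin> c" for c
    by (rule address_set_split[where V = "\<lambda>i. vertices (ts ! i)"])
       (use that in \<open>auto simp: root_cuts_def vertices_PNode\<close>)
  then show ?case by simp
next
  case 2
  show ?case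
  proof (intro ballI ext)
    fix g i assume g: "g \<in> (\<Pi>\<^sub>E i\<in>{..<length ts}. root_cuts (ts ! i))"
    show "restrict (\<lambda>i. {p. i # p \<in> (\<Union>i<length ts. (#) i ` g i)}) {..<length ts} i = g i"
      using g by (cases "i < length ts") (auto simp: PiE_def extensional_def)
  qed
next
  case 3
  show ?case
  proof (intro image_subsetI restrict_PiE_iff[THEN iffD2] ballI)
    fix c i assume "c \<in> {c \<in> root_cuts (PNode ts). [] \<notin> c}" and "i \<in> {..<length ts}"
    then have c: "c \<in> root_cuts (PNode ts)" "[] \<notin> c" and i: "i < length ts" by auto
    have "card {p. i # p \<in> c \<and> prefix p l} \<le> 1" if l: "l \<in> leaves (ts ! i)" for l
    proof -
      have "i # l \<in> leaves (PNode ts)" using l i by (simp add: leaves_def)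
      then have "card {p \<in> c. prefix p (i # l)} \<le> 1" using c by (auto simp: root_cuts_def)
      also have "{p \<in> c. prefix p (i # l)} = Cons i ` {p. i # p \<in> c \<and> prefix p l}"
        using c(2) by (auto simp: prefix_Cons)
      finally show ?thesis by (simp add: card_image)
    qed
    moreover have "{p. i # p \<in> c} \<subseteq> vertices (ts ! i)"
      using c by (auto simp: root_cuts_def vertices_PNode)
    ultimately show "{p. i # p \<in> c} \<in> root_cuts (ts ! i)"
      by (auto simp: root_cuts_def)
  qed
next
  case 4
  show ?case
  proof (intro image_subsetI CollectI conjI)
    fix g assume g: "g \<in> (\<Pi>\<^sub>E i\<in>{..<length ts}. root_cuts (ts ! i))"
    let ?c = "\<Union>i<length ts. Cons i ` g i"
    show "[] \<notin> ?c" by auto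
    have "?c \<subseteq> vertices (PNode ts)" using g by (force simp: vertices_PNode root_cuts_def PiE_def)
    moreover have "card {p \<in> ?c. prefix p l} \<le> 1" if l: "l \<in> leaves (PNode ts)" for l
    proof (cases "ts = []")
      case False
      then obtain i l' where i: "i < length ts" "l = i # l'" "l' \<in> leaves (ts ! i)"
        using l by (auto simp: leaves_PNode)
      have "{p \<in> ?c. prefix p l} = Cons i ` {p \<in> g i. prefix p l'}"
        using i by (auto simp: prefix_Cons)
      moreover have "card {p \<in> g i. prefix p l'} \<le> 1"
        using g i by (auto simp: root_cuts_def PiE_def)
      ultimately show ?thesis by (simp add: card_image)
    qed simp
    ultimately show "?c \<in> root_cuts (PNode ts)" by (simp add: root_cuts_def)
  qed
qed

lemma prod_single:
  "(\<Prod>i\<in>A. Poly_Mapping.single (f i) (g i)) = Poly_Mapping.single (\<Sum>i\<in>A. f i :: forest) (\<Prod>i\<in>A. g i :: real)"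
  by (induction A rule: infinite_finite_induct) (auto simp: mult_single single_one[where 'a=forest, simplified])

lemma graft_sum: "graft (sum f A) = (\<Sum>i\<in>A. graft (f i))"
  unfolding graft_def by (rule lin_ext_sum[OF scalar_hom_forest])

text \<open>The sum over cuts satisfies the recursion of \<open>coact_tree\<close>: the cut \<open>{[]}\<close> gives the scalar, and
  by independence of the branches the other cuts give the expansion of a product of sums.
  In particular the result depends on the planar tree \<open>t\<close> only through \<open>forget t\<close>.\<close>

lemma cut_sum_eq_coact_tree:
  "(\<Sum>c\<in>root_cuts t. Poly_Mapping.single (trunk_forest t c) (forest_prod a (cut_branches t c)))
     = coact_tree a (forget t)"
proof (induction t)
  case (PNode ts)
  let ?n = "length ts" and ?t = "PNode ts"
  let ?s = "\<lambda>t c. Poly_Mapping.single (trunk_forest t c) (forest_prod a (cut_branches t c))"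
  let ?f = "\<lambda>c. \<lambda>i\<in>{..<?n}. {p. i # p \<in> c}"
  let ?D = "{c \<in> root_cuts ?t. [] \<notin> c}"
  let ?h = "\<lambda>g. Poly_Mapping.single {#Node (\<Sum>i<?n. trunk_forest (ts ! i) (g i))#}
     (\<Prod>i<?n. forest_prod a (cut_branches (ts ! i) (g i)))"
  have split: "root_cuts ?t = insert {[]} ?D"
    using root_cuts_root[of _ ?t] by (auto simp: root_cuts_eq)
  have "(\<Prod>i<?n. coact_tree a (forget (ts ! i))) = (\<Prod>i<?n. \<Sum>c\<in>root_cuts (ts ! i). ?s (ts ! i) c)"
    using PNode by (intro prod.cong) auto
  also have "\<dots> = (\<Sum>g\<in>PiE {..<?n} (\<lambda>i. root_cuts (ts ! i)). \<Prod>i<?n. ?s (ts ! i) (g i))"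
    by (rule prod_sum_PiE) (auto simp: finite_root_cuts)
  finally have "graft (\<Prod>i<?n. coact_tree a (forget (ts ! i))) = (\<Sum>g\<in>PiE {..<?n} (\<lambda>i. root_cuts (ts ! i)). ?h g)"
    by (simp add: prod_single graft_sum graft_single)
  also have "\<dots> = (\<Sum>c\<in>?D. ?h (?f c))"
    by (rule sum.reindex_bij_betw[OF bij_root_cuts_PNode, symmetric])
  also have "\<dots> = (\<Sum>c\<in>?D. ?s ?t c)"
  proof (rule sum.cong[OF refl])
    fix c assume c: "c \<in> ?D"
    then have "c \<subseteq> (\<Union>i<?n. Cons i ` vertices (ts ! i))" by (auto simp: root_cuts_def vertices_PNode)
    then show "?h (?f c) = ?s ?t c"
      using c by (simp add: trunk_forest_def[of ?t] cut_trunk_PNode forest_prod_cut_branches_PNode)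
  qed
  finally have "(\<Sum>c\<in>?D. ?s ?t c) = graft (\<Prod>i<?n. coact_tree a (forget (ts ! i)))" ..
  moreover have "(\<Prod>i<?n. coact_tree a (forget (ts ! i))) = forest_prod (coact_tree a) (mset (map forget ts))"
    by (simp flip: mset_map add: prod_mset_prod_list prod.list_conv_set_nth atLeast0LessThan)
  moreover have "sum (?s ?t) (root_cuts ?t) = ?s ?t {[]} + sum (?s ?t) ?D"
    using finite_root_cuts[of ?t] by (subst split, subst sum.insert) auto
  ultimately show ?case
    by (simp add: trunk_forest_def cut_branches_simps)
qed

definition eval_left :: "(rtree \<Rightarrow> real) \<Rightarrow> bck2 \<Rightarrow> bck" where
  "eval_left a = lin_ext (Poly_Mapping.single {#}) (\<lambda>(\<alpha>, \<beta>). Poly_Mapping.single \<beta> (forest_prod a \<alpha>))"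

lemma eval_left_coproduct_tree: "eval_left a (coproduct_tree \<tau>) = coact_tree a \<tau>"
  using cut_sum_eq_coact_tree[of "planar \<tau>" a]
  by (simp add: eval_left_def coproduct_tree_root_cuts lin_ext_sum[OF scalar_hom_forest]
      lin_ext_single[OF scalar_hom_forest] mult_single forget_planar)

text \<open>The functional \<open>\<phi>\<^sub>1 \<otimes> \<phi>\<^sub>2\<close> factors through the evaluation of the left tensor factor and
  is multiplicative, so it suffices to know it on the coproduct of a tree.\<close>

lemma convolution_tree_char: "convolution (tree_char a) (tree_char b) = tree_char (tree_conv a b)"
proof
  fix x
  let ?P = "\<lambda>z. tree_char b (eval_left a z)"
  have sc2: "scalar_hom (Poly_Mapping.single (({#}, {#}) :: forest \<times> forest))"
    using scalar_hom_single[where 'k="forest \<times> forest"] by (simp add: zero_prod_def)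
  have add: "?P (y + z) = ?P y + ?P z" for y z
    by (simp add: eval_left_def lin_ext_add[OF scalar_hom_forest] tree_char_add)
  have mult: "?P (y * z) = ?P y * ?P z" for y z
  proof -
    have "eval_left a (y * z) = eval_left a y * eval_left a z"
      unfolding eval_left_def
      by (rule lin_ext_mult[OF scalar_hom_forest]) (auto simp: mult_single plus_prod_def)
    then show ?thesis by (simp add: tree_char_mult)
  qed
  have P_single: "?P (Poly_Mapping.single (\<alpha>, \<beta>) r) = r * (forest_prod a \<alpha> * forest_prod b \<beta>)" for \<alpha> \<beta> r
    by (simp add: eval_left_def lin_ext_single[OF scalar_hom_forest] mult_single tree_char_single)
  have conv: "lin_ext (\<lambda>r. r) (\<lambda>(\<alpha>, \<beta>). tree_char a (basis \<alpha>) * tree_char b (basis \<beta>)) z = ?P z" for z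
  proof (induction z rule: poly_mapping_induct_single)
    case (single k r)
    then show ?case by (cases k) (simp only: lin_ext_single[OF scalar_hom_id] P_single case_prod_conv, simp add: tree_char_single)
  qed (simp add: add lin_ext_add[OF scalar_hom_id])
  have "convolution (tree_char a) (tree_char b) x = ?P (coproduct x)"
    unfolding conv[symmetric] by (simp add: convolution_def lin_ext_def case_prod_unfold)
  also have "coproduct x = lin_ext (Poly_Mapping.single ({#}, {#})) (forest_prod coproduct_tree) x"
    by (simp add: coproduct_def lin_ext_def)
  also have "?P \<dots> = lin_ext (\<lambda>r. r) (forest_prod (\<lambda>\<tau>. ?P (coproduct_tree \<tau>))) x"
    by (rule hom_lin_ext[OF sc2 scalar_hom_id]) (auto simp: add mult P_single)
  also have "\<dots> = tree_char (tree_conv a b) x"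
    by (simp add: eval_left_coproduct_tree tree_char_def tree_conv_def[abs_def])
  finally show "convolution (tree_char a) (tree_char b) x = tree_char (tree_conv a b) x" .
qed

section \<open>The group of characters\<close>

lemma tree_char_inject: "tree_char a = tree_char b \<longleftrightarrow> a = b"
proof
  assume "tree_char a = tree_char b"
  then have "tree_char a (basis {#\<tau>#}) = tree_char b (basis {#\<tau>#})" for \<tau> by simp
  then show "a = b" by (auto simp: tree_char_single)
qed simp

lemma character_iff: "character \<phi> \<longleftrightarrow> (\<exists>a. \<phi> = tree_char a)"
  using character_tree_char character_eq_tree_char by metis

lemma group_character_group: "group character_group"
proof (rule groupI)
  fix x y z assume "x \<in> carrier character_group" "y \<in> carrier character_group" "z \<in> carrier character_group"
  then show "x \<otimes>\<^bsub>character_group\<^esub> y \<otimes>\<^bsub>character_group\<^esub> z = x \<otimes>\<^bsub>character_group\<^esub> (y \<otimes>\<^bsub>character_group\<^esub> z)"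
    by (auto simp: character_group_def character_iff convolution_tree_char tree_conv_assoc)
next
  fix x assume "x \<in> carrier character_group"
  then obtain a where a: "x = tree_char a" by (auto simp: character_group_def character_iff)
  obtain b where "tree_conv b a = (\<lambda>_. 0)" using tree_conv_left_inverse by blast
  then show "\<exists>y\<in>carrier character_group. y \<otimes>\<^bsub>character_group\<^esub> x = \<one>\<^bsub>character_group\<^esub>"
    by (intro bexI[of _ "tree_char b"]) (auto simp: a character_group_def convolution_tree_char counit_eq_tree_char character_tree_char)
qed (auto simp: character_group_def character_iff convolution_tree_char tree_conv_zero_left counit_eq_tree_char tree_char_inject)

section \<open>The decomposition of tree functions\<close>

definition tree_inv :: "(rtree \<Rightarrow> real) \<Rightarrow> rtree \<Rightarrow> real" where
  "tree_inv a = (SOME b. tree_conv b a = (\<lambda>_. 0))"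

lemma tree_conv_tree_inv_left: "tree_conv (tree_inv a) a = (\<lambda>_. 0)"
  unfolding tree_inv_def by (rule someI_ex[OF tree_conv_left_inverse])

lemma tree_conv_tree_inv_left': "tree_conv (tree_inv a) (tree_conv a b) = b"
  by (simp add: tree_conv_assoc[symmetric] tree_conv_tree_inv_left tree_conv_zero_left)

lemma tree_conv_tree_inv_right: "tree_conv a (tree_inv a) = (\<lambda>_. 0)"
proof -
  have "tree_conv a (tree_inv a) = tree_conv (tree_inv (tree_inv a)) (tree_conv (tree_inv a) (tree_conv a (tree_inv a)))"
    by (rule tree_conv_tree_inv_left'[symmetric])
  also have "\<dots> = (\<lambda>_. 0)" by (simp only: tree_conv_tree_inv_left' tree_conv_tree_inv_left)
  finally show ?thesis .
qed

lemma tree_conv_tree_inv_right': "tree_conv a (tree_conv (tree_inv a) b) = b"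
  by (simp add: tree_conv_assoc[symmetric] tree_conv_tree_inv_right tree_conv_zero_left)

lemma tree_inv_unique: "tree_conv a b = (\<lambda>_. 0) \<Longrightarrow> b = tree_inv a"
  using tree_conv_tree_inv_left'[of a b] by (simp add: tree_conv_zero_right)

lemma tree_rev_tree_rev: "tree_rev (tree_rev a) = a"
  by (simp add: tree_rev_def[abs_def] mult.assoc[symmetric] power_add[symmetric] mult_2[symmetric])

lemma tree_rev_zero: "tree_rev (\<lambda>_. 0) = (\<lambda>_. 0)"
  by (simp add: tree_rev_def[abs_def])

lemma tree_rev_tree_inv: "tree_rev (tree_inv a) = tree_inv (tree_rev a)"
  by (rule tree_inv_unique) (simp add: tree_rev_tree_conv[symmetric] tree_conv_tree_inv_right tree_rev_zero)

text \<open>Write \<open>\<theta>\<close> for \<open>tree_rev\<close>.  From \<open>a = p m\<close> with \<open>\<theta> p = p\<close> and \<open>\<theta> m = m\<^sup>-\<^sup>1\<close> one gets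
  \<open>\<theta>(a)\<^sup>-\<^sup>1 a = m p\<^sup>-\<^sup>1 p m = m\<^sup>2\<close>, which forces \<open>m\<close> to be the square root of
  \<open>c = \<theta>(a)\<^sup>-\<^sup>1 a\<close>.  Conversely \<open>\<theta> c = c\<^sup>-\<^sup>1\<close>, so \<open>\<theta> m\<close> and \<open>m\<^sup>-\<^sup>1\<close> are both square roots
  of \<open>c\<^sup>-\<^sup>1\<close> and hence equal, and \<open>p = a m\<^sup>-\<^sup>1\<close> is then invariant under \<open>\<theta>\<close>.\<close>

lemma tree_function_decomposition:
  obtains m p where "tree_conv p m = a" "tree_rev p = p" "m = tree_inv (tree_rev m)"
    "tree_conv m m = tree_conv (tree_inv (tree_rev a)) a"
proof -
  define c where "c = tree_conv (tree_inv (tree_rev a)) a"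
  obtain m where m: "tree_conv m m = c" using tree_conv_square_root by blast
  define p where "p = tree_conv a (tree_inv m)"
  have c_inv: "tree_conv c (tree_rev c) = (\<lambda>_. 0)"
    by (simp add: c_def tree_rev_tree_conv tree_rev_tree_inv tree_rev_tree_rev tree_conv_assoc tree_conv_tree_inv_left tree_conv_tree_inv_right')
  have "tree_conv (tree_rev m) (tree_rev m) = tree_rev c" by (simp add: m tree_rev_tree_conv[symmetric])
  moreover have "tree_conv (tree_inv m) (tree_inv m) = tree_rev c"
  proof -
    have "tree_conv c (tree_conv (tree_inv m) (tree_inv m)) = (\<lambda>_. 0)"
      by (simp add: m[symmetric] tree_conv_assoc tree_conv_tree_inv_right tree_conv_tree_inv_right')
    then show ?thesis using tree_inv_unique[OF c_inv] tree_inv_unique by metis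
  qed
  ultimately have tree_rev_m: "tree_rev m = tree_inv m" using tree_conv_square_root[of "tree_rev c"] by blast
  have "tree_conv (tree_rev a) (tree_conv m m) = a"
    by (simp add: m c_def tree_conv_tree_inv_right')
  then have "tree_conv (tree_conv (tree_rev a) (tree_conv m m)) (tree_inv m) = p" by (simp add: p_def)
  then have p': "p = tree_conv (tree_rev a) m"
    by (simp add: tree_conv_assoc tree_conv_tree_inv_right tree_conv_zero_right)
  have tree_inv_tree_inv: "tree_inv (tree_inv m) = m"
    by (rule tree_inv_unique[symmetric]) (rule tree_conv_tree_inv_left)
  have "tree_rev p = p"
    by (subst (2) p') (simp add: p_def tree_rev_tree_conv tree_rev_tree_inv tree_rev_m tree_inv_tree_inv)
  moreover have "tree_conv p m = a"
    by (simp add: p_def tree_conv_assoc tree_conv_tree_inv_left tree_conv_zero_right)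
  moreover have "m = tree_inv (tree_rev m)" by (simp add: tree_rev_m tree_inv_tree_inv)
  ultimately show thesis using that m unfolding c_def by blast
qed

lemma char_adjoint_tree_char: "char_adjoint (tree_char a) = tree_char (tree_inv (tree_rev a))"
proof -
  have "inv\<^bsub>character_group\<^esub> (tree_char b) = tree_char (tree_inv b)" for b
    by (rule group.inv_equality[OF group_character_group])
       (simp_all add: character_group_def convolution_tree_char tree_conv_tree_inv_left counit_eq_tree_char character_tree_char)
  then show ?thesis by (simp add: char_adjoint_def char_reverse_tree_char)
qed

section \<open>Calculus of smooth maps\<close>

abbreviation dir_deriv :: "('a::real_normed_vector \<Rightarrow> 'b::real_normed_vector) \<Rightarrow> 'a \<Rightarrow> 'a \<Rightarrow> 'b" where
  "dir_deriv f v \<equiv> \<lambda>y. frechet_derivative f (at y) v"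

text \<open>\<open>C\<^sup>k\<close>, with partial derivatives in arbitrary directions; in finite dimension this is
  the usual notion.  Unlike \<open>smooth\<close> itself it supports induction on \<open>k\<close>, which is how the closure
  properties of smooth maps are obtained.\<close>

primrec C_class :: "nat \<Rightarrow> ('a::euclidean_space \<Rightarrow> 'b::real_normed_vector) \<Rightarrow> bool" where
  "C_class 0 = (\<lambda>f. continuous_on UNIV f)"
| "C_class (Suc k) = (\<lambda>f. (\<forall>x. f differentiable at x) \<and> (\<forall>v. C_class k (dir_deriv f v)))"

lemma C_class_SucI:
  assumes "\<And>x. (f has_derivative f' x) (at x)" "\<And>v. C_class k (\<lambda>x. f' x v)"
  shows "C_class (Suc k) f"
proof -
  have "f' x = frechet_derivative f (at x)" for x by (rule frechet_derivative_at[OF assms(1)])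
  then show ?thesis using assms by (auto simp: differentiable_def)
qed

lemma differentiable_frechet: "f differentiable at x \<Longrightarrow> (f has_derivative frechet_derivative f (at x)) (at x)"
  by (simp add: frechet_derivative_works)

lemma C_class_const: "C_class k (\<lambda>_. c)"
proof (induction k arbitrary: c)
  case (Suc k)
  show ?case by (rule C_class_SucI[where f' = "\<lambda>_ _. 0"]) (use Suc in auto)
qed simp

lemma C_class_bounded_linear: "bounded_linear f \<Longrightarrow> C_class k f"
proof (cases k)
  case (Suc j)
  assume "bounded_linear f"
  then show ?thesis unfolding Suc
    by (intro C_class_SucI[where f' = "\<lambda>_. f"] bounded_linear_imp_has_derivative C_class_const)
qed (simp add: linear_continuous_on)

lemma C_class_SucD: "C_class (Suc k) f \<Longrightarrow> C_class k f"
proof (induction k arbitrary: f)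
  case 0
  then show ?case by (auto intro!: differentiable_imp_continuous_on simp: differentiable_on_def)
qed auto

lemma C_class_add: "C_class k f \<Longrightarrow> C_class k g \<Longrightarrow> C_class k (\<lambda>x. f x + g x)"
proof (induction k arbitrary: f g)
  case 0
  then show ?case by (auto intro: continuous_intros)
next
  case (Suc k)
  show ?case
    by (rule C_class_SucI[where f' = "\<lambda>x v. dir_deriv f v x + dir_deriv g v x"])
       (use Suc in \<open>auto intro!: has_derivative_add differentiable_frechet\<close>)
qed

lemma C_class_scaleR: "C_class k a \<Longrightarrow> C_class k f \<Longrightarrow> C_class k (\<lambda>x. a x *\<^sub>R f x)"
proof (induction k arbitrary: a f)
  case 0
  then show ?case by (auto intro: continuous_intros)
next
  case (Suc k)
  then have "C_class k a" "C_class k f" by (auto intro: C_class_SucD)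
  with Suc show ?case
    by (intro C_class_SucI[where f' = "\<lambda>x v. a x *\<^sub>R dir_deriv f v x + dir_deriv a v x *\<^sub>R f x"]
          C_class_add has_derivative_scaleR differentiable_frechet Suc.IH) auto
qed

lemma C_class_sum: "(\<And>i. i \<in> I \<Longrightarrow> C_class k (f i)) \<Longrightarrow> C_class k (\<lambda>x. \<Sum>i\<in>I. f i x)"
  by (induction I rule: infinite_finite_induct) (auto simp: C_class_const intro: C_class_add)

lemma C_class_linear_compose: "bounded_linear L \<Longrightarrow> C_class k g \<Longrightarrow> C_class k (\<lambda>x. L (g x))"
proof (induction k arbitrary: g)
  case 0
  then show ?case by (auto intro: continuous_on_compose2 linear_continuous_on)
next
  case (Suc k)
  show ?case
  proof (rule C_class_SucI[where f' = "\<lambda>x v. L (dir_deriv g v x)"])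
    fix x
    have "g differentiable at x" using Suc.prems by simp
    then show "((\<lambda>x. L (g x)) has_derivative (\<lambda>v. L (dir_deriv g v x))) (at x)"
      by (rule bounded_linear.has_derivative[OF Suc.prems(1) differentiable_frechet])
    show "C_class k (\<lambda>x. L (dir_deriv g v x))" for v
      by (rule Suc.IH[OF Suc.prems(1)]) (use Suc.prems in simp)
  qed
qed

lemma linear_expand:
  fixes f :: "'a::euclidean_space \<Rightarrow> 'b::real_vector"
  assumes "linear f"
  shows "f u = (\<Sum>b\<in>Basis. (u \<bullet> b) *\<^sub>R f b)"
proof -
  have "f u = f (\<Sum>b\<in>Basis. (u \<bullet> b) *\<^sub>R b)" by (simp add: euclidean_representation)
  then show ?thesis by (simp add: linear_sum[OF assms] linear_scale[OF assms])
qed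

text \<open>By the chain rule the derivative is a sum of products of compositions, which are of class
  \<open>C\<^sup>k\<close> by the induction hypothesis.\<close>

lemma C_class_compose: 
  fixes g :: "'a::euclidean_space \<Rightarrow> 'b::euclidean_space"
  shows "C_class k f \<Longrightarrow> C_class k g \<Longrightarrow> C_class k (\<lambda>x. f (g x))"
proof (induction k arbitrary: f g)
  case 0
  then show ?case by (auto intro: continuous_on_compose2)
next
  case (Suc k)
  have df: "(f has_derivative frechet_derivative f (at y)) (at y)" for y
    using Suc by (auto intro: differentiable_frechet)
  have dg: "(g has_derivative frechet_derivative g (at x)) (at x)" for x
    using Suc by (auto intro: differentiable_frechet)
  have "C_class k g" using Suc.prems by (blast intro: C_class_SucD)
  show ?case
  proof (rule C_class_SucI[where f' = "\<lambda>x v. \<Sum>b\<in>Basis. (dir_deriv g v x \<bullet> b) *\<^sub>R dir_deriv f b (g x)"])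
    fix x
    have "((\<lambda>x. f (g x)) has_derivative (\<lambda>v. frechet_derivative f (at (g x)) (frechet_derivative g (at x) v))) (at x)"
      using diff_chain_at[OF dg df] by (simp add: comp_def)
    moreover have "(\<lambda>v. frechet_derivative f (at (g x)) (frechet_derivative g (at x) v)) =
        (\<lambda>v. \<Sum>b\<in>Basis. (dir_deriv g v x \<bullet> b) *\<^sub>R dir_deriv f b (g x))"
      by (rule ext, rule linear_expand) (use df has_derivative_linear in blast)
    ultimately show "((\<lambda>x. f (g x)) has_derivative
        (\<lambda>v. \<Sum>b\<in>Basis. (dir_deriv g v x \<bullet> b) *\<^sub>R dir_deriv f b (g x))) (at x)" by (simp only:)
  next
    fix v
    have "C_class k (\<lambda>x. dir_deriv g v x \<bullet> b)" for b
      by (rule C_class_linear_compose[OF bounded_linear_inner_left]) (use Suc.prems in simp)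
    moreover have "C_class k (\<lambda>x. dir_deriv f b (g x))" for b
      by (rule Suc.IH[where f = "dir_deriv f b"]) (use Suc.prems \<open>C_class k g\<close> in auto)
    ultimately show "C_class k (\<lambda>x. \<Sum>b\<in>Basis. (dir_deriv g v x \<bullet> b) *\<^sub>R dir_deriv f b (g x))"
      by (intro C_class_sum C_class_scaleR)
  qed
qed

lemma iter_deriv_append: "iter_deriv f (us @ vs) = iter_deriv (iter_deriv f vs) us"
  by (induction us) auto

lemma smooth_iter_deriv: "smooth f \<Longrightarrow> smooth (iter_deriv f vs)"
  by (auto simp: smooth_def simp flip: iter_deriv_append)

lemma smooth_dir_deriv: "smooth f \<Longrightarrow> smooth (dir_deriv f v)"
  using smooth_iter_deriv[of f "[v]"] by simp

lemma smooth_differentiable: "smooth f \<Longrightarrow> f differentiable at x"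
  unfolding smooth_def by (metis iter_deriv.simps(1))

lemma smooth_iff_C_class: "smooth f \<longleftrightarrow> (\<forall>k. C_class k f)"
proof safe
  fix k assume "smooth f"
  then show "C_class k f"
  proof (induction k arbitrary: f)
    case 0
    then show ?case by (auto intro!: differentiable_imp_continuous_on simp: differentiable_on_def smooth_differentiable)
  qed (auto intro: smooth_dir_deriv smooth_differentiable)
next
  assume f: "\<forall>k. C_class k f"
  have "\<forall>k. C_class k (iter_deriv f vs)" for vs
  proof (induction vs)
    case (Cons v vs)
    show ?case
    proof
      fix k
      from Cons have "C_class (Suc k) (iter_deriv f vs)" ..
      then show "C_class k (iter_deriv f (v # vs))" by simp
    qed
  qed (use f in simp)
  then have "C_class (Suc 0) (iter_deriv f vs)" for vs by blast
  then show "smooth f" by (simp add: smooth_def)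
qed

context
  fixes f g :: "'a::euclidean_space \<Rightarrow> 'b::real_normed_vector"
begin

lemma smooth_const: "smooth (\<lambda>_::'a. c :: 'b)"
  by (simp add: smooth_iff_C_class C_class_const)
lemma smooth_linear: "bounded_linear f \<Longrightarrow> smooth f"
  by (simp add: smooth_iff_C_class C_class_bounded_linear)
lemma smooth_add: "smooth f \<Longrightarrow> smooth g \<Longrightarrow> smooth (\<lambda>x. f x + g x)"
  by (simp add: smooth_iff_C_class C_class_add)
lemma smooth_scaleR: "smooth a \<Longrightarrow> smooth f \<Longrightarrow> smooth (\<lambda>x. a x *\<^sub>R f x)"
  by (simp add: smooth_iff_C_class C_class_scaleR)
lemma smooth_sum: "(\<And>i. i \<in> I \<Longrightarrow> smooth (F i)) \<Longrightarrow> smooth (\<lambda>x. \<Sum>i\<in>I. F i x)"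
  for F :: "'i \<Rightarrow> 'a \<Rightarrow> 'b"
  by (simp add: smooth_iff_C_class C_class_sum)

end

lemma smooth_compose: "smooth f \<Longrightarrow> smooth g \<Longrightarrow> smooth (\<lambda>x. f (g x))"
  for g :: "'a::euclidean_space \<Rightarrow> 'b::euclidean_space"
  by (simp add: smooth_iff_C_class C_class_compose)
lemma smooth_diff: "smooth f \<Longrightarrow> smooth g \<Longrightarrow> smooth (\<lambda>x. f x - g x)"
  for f :: "'a::euclidean_space \<Rightarrow> 'b::real_normed_vector"
  using smooth_add[of f "\<lambda>x. (- 1) *\<^sub>R g x"] smooth_scaleR[OF smooth_const, of g "-1"] by simp
lemma smooth_power: "smooth f \<Longrightarrow> smooth (\<lambda>x. f x ^ k)" for f :: "'a::euclidean_space \<Rightarrow> real"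
  by (induction k) (auto simp: smooth_const dest: smooth_scaleR)
lemma smooth_continuous: "smooth f \<Longrightarrow> continuous_on S f"
  unfolding smooth_def differentiable_def
  by (metis continuous_at_imp_continuous_on has_derivative_continuous iter_deriv.simps(1))
lemma smooth_has_derivative: "smooth f \<Longrightarrow> (f has_derivative frechet_derivative f (at x)) (at x)"
  by (intro differentiable_frechet smooth_differentiable)

lemma smooth_line:
  assumes "smooth f"
  shows "((\<lambda>t. f (p + t *\<^sub>R w)) has_vector_derivative dir_deriv f w (p + t *\<^sub>R w)) (at t)"
proof -
  let ?D = "frechet_derivative f (at (p + t *\<^sub>R w))"
  have "((\<lambda>t. p + t *\<^sub>R w) has_derivative (\<lambda>s. s *\<^sub>R w)) (at t)"
    by (auto intro!: derivative_eq_intros)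
  from diff_chain_at[OF this smooth_has_derivative[OF assms]]
  have "((\<lambda>t. f (p + t *\<^sub>R w)) has_derivative (\<lambda>s. ?D (s *\<^sub>R w))) (at t)" by (simp add: comp_def)
  moreover have "?D (s *\<^sub>R w) = s *\<^sub>R ?D w" for s
    by (rule linear_scale[OF has_derivative_linear[OF smooth_has_derivative[OF assms]]])
  ultimately show ?thesis by (simp add: has_vector_derivative_def)
qed

section \<open>Symmetry of iterated derivatives\<close>

text \<open>The mean value inequality for \<open>\<lambda>x. u x - x *\<^sub>R c\<close>.\<close>

lemma norm_increment_le:
  fixes u :: "real \<Rightarrow> 'b::real_normed_vector"
  assumes "\<And>x. \<bar>x\<bar> \<le> \<bar>t\<bar> \<Longrightarrow> (u has_vector_derivative u' x) (at x)"
    and "\<And>x. \<bar>x\<bar> \<le> \<bar>t\<bar> \<Longrightarrow> norm (u' x - c) \<le> B"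
  shows "norm (u t - u 0 - t *\<^sub>R c) \<le> B * \<bar>t\<bar>"
proof -
  let ?v = "\<lambda>x. u x - x *\<^sub>R c"
  have "norm (?v t - ?v 0) \<le> B * norm (t - 0)"
  proof (rule differentiable_bound[where S = "{-\<bar>t\<bar>..\<bar>t\<bar>}" and f' = "\<lambda>x s. s *\<^sub>R (u' x - c)"])
    fix x assume "x \<in> {-\<bar>t\<bar>..\<bar>t\<bar>}"
    then have x: "\<bar>x\<bar> \<le> \<bar>t\<bar>" by auto
    have "(?v has_derivative (\<lambda>s. s *\<^sub>R u' x - s *\<^sub>R c)) (at x)"
      using assms(1)[OF x] unfolding has_vector_derivative_def
      by (intro has_derivative_diff) (auto intro!: derivative_eq_intros)
    then show "(?v has_derivative (\<lambda>s. s *\<^sub>R (u' x - c))) (at x within {-\<bar>t\<bar>..\<bar>t\<bar>})"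
      by (auto simp: scaleR_diff_right intro: has_derivative_at_withinI)
    show "onorm (\<lambda>s. s *\<^sub>R (u' x - c)) \<le> B"
      by (rule onorm_le) (use assms(2)[OF x] in \<open>auto simp: mult.commute[of B] intro: mult_left_mono\<close>)
  qed auto
  then show ?thesis by (simp add: algebra_simps)
qed

text \<open>The second difference, regarded as the increment of \<open>\<lambda>s. g (y + s v + t w) - g (y + s v)\<close>, is
  \<open>t\<close> times an increment of the derivative along \<open>v\<close>, which in turn is \<open>t\<close> times the mixed
  derivative near \<open>y\<close>.\<close>

lemma second_difference:
  assumes g: "smooth g" and e: "e > 0"
  shows "\<exists>d>0. \<forall>t. 0 < t \<and> t < d \<longrightarrow>
    norm (g (y + t *\<^sub>R v + t *\<^sub>R w) - g (y + t *\<^sub>R v) - g (y + t *\<^sub>R w) + g y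
       - t\<^sup>2 *\<^sub>R dir_deriv (dir_deriv g v) w y) \<le> e * t\<^sup>2"
proof -
  let ?A = "dir_deriv (dir_deriv g v) w"
  have "isCont ?A y"
    using smooth_continuous[OF smooth_dir_deriv[OF smooth_dir_deriv[OF g]], of UNIV]
    by (simp add: continuous_on_eq_continuous_at)
  then obtain d where d: "d > 0" "\<And>z. dist z y < d \<Longrightarrow> dist (?A z) (?A y) < e"
    using e unfolding continuous_at_eps_delta by blast
  (* The summand 1 keeps K positive when v = w = 0. *)
  define K where "K = norm v + norm w + 1"
  have K: "K > 0" by (simp add: K_def add_nonneg_pos)
  show ?thesis
  proof (intro exI[of _ "d / K"] conjI allI impI)
    show "d / K > 0" using d K by simp
    fix t assume t: "0 < t \<and> t < d / K"
    have near: "norm (?A (y + s *\<^sub>R v + r *\<^sub>R w) - ?A y) \<le> e" if "\<bar>s\<bar> \<le> t" "\<bar>r\<bar> \<le> t" for s r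
    proof -
      have "norm (s *\<^sub>R v + r *\<^sub>R w) \<le> \<bar>s\<bar> * norm v + \<bar>r\<bar> * norm w"
        by (rule norm_triangle_le) simp
      also have "\<dots> \<le> t * norm v + t * norm w"
        using that by (intro add_mono mult_right_mono) auto
      also have "\<dots> < t * K" using t by (simp add: K_def algebra_simps)
      also have "\<dots> < d" using t K by (simp add: field_simps)
      finally show ?thesis using d(2)[of "y + s *\<^sub>R v + r *\<^sub>R w"] by (simp add: dist_norm add.assoc less_imp_le)
    qed
    have step: "norm (dir_deriv g v (y + s *\<^sub>R v + t *\<^sub>R w) - dir_deriv g v (y + s *\<^sub>R v) - t *\<^sub>R ?A y) \<le> e * \<bar>t\<bar>"
      if s: "\<bar>s\<bar> \<le> t" for s
      using norm_increment_le[where u = "\<lambda>r. dir_deriv g v (y + s *\<^sub>R v + r *\<^sub>R w)" and t = t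
          and u' = "\<lambda>r. ?A (y + s *\<^sub>R v + r *\<^sub>R w)" and c = "?A y" and B = e]
        smooth_line[OF smooth_dir_deriv[OF g]] near[OF s] t by simp
    define \<phi> where "\<phi> s = g (y + s *\<^sub>R v + t *\<^sub>R w) - g (y + s *\<^sub>R v)" for s
    have "(\<phi> has_vector_derivative dir_deriv g v (y + s *\<^sub>R v + t *\<^sub>R w) - dir_deriv g v (y + s *\<^sub>R v)) (at s)" for s
      using has_vector_derivative_diff[OF smooth_line[OF g, of "y + t *\<^sub>R w" v s] smooth_line[OF g, of y v s]]
      unfolding \<phi>_def by (simp add: ac_simps)
    then have "norm (\<phi> t - \<phi> 0 - t *\<^sub>R (t *\<^sub>R ?A y)) \<le> (e * \<bar>t\<bar>) * \<bar>t\<bar>"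
      using t step by (intro norm_increment_le[where u' = "\<lambda>s. dir_deriv g v (y + s *\<^sub>R v + t *\<^sub>R w) - dir_deriv g v (y + s *\<^sub>R v)"]) auto
    then show "norm (g (y + t *\<^sub>R v + t *\<^sub>R w) - g (y + t *\<^sub>R v) - g (y + t *\<^sub>R w) + g y
       - t\<^sup>2 *\<^sub>R ?A y) \<le> e * t\<^sup>2"
      using t by (simp add: \<phi>_def power2_eq_square algebra_simps)
  qed
qed

text \<open>The second difference is symmetric in \<open>v\<close> and \<open>w\<close>, so both mixed derivatives are its limit
  after division by \<open>t\<^sup>2\<close>.\<close>

lemma dir_deriv_commute:
  assumes g: "smooth g"
  shows "dir_deriv (dir_deriv g v) w = dir_deriv (dir_deriv g w) v"
proof
  fix y
  let ?A = "dir_deriv (dir_deriv g v) w y" and ?B = "dir_deriv (dir_deriv g w) v y"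
  have le: "norm (?A - ?B) \<le> e" if e: "e > 0" for e :: real
  proof -
    define D where "D t = g (y + t *\<^sub>R v + t *\<^sub>R w) - g (y + t *\<^sub>R v) - g (y + t *\<^sub>R w) + g y" for t
    obtain d1 where d1: "d1 > 0" "\<And>t. 0 < t \<and> t < d1 \<Longrightarrow> norm (D t - t\<^sup>2 *\<^sub>R ?A) \<le> e/2 * t\<^sup>2"
      using second_difference[OF g, of "e/2" y v w] e unfolding D_def by auto
    obtain d2 where d2: "d2 > 0" "\<And>t. 0 < t \<and> t < d2 \<Longrightarrow> norm (D t - t\<^sup>2 *\<^sub>R ?B) \<le> e/2 * t\<^sup>2"
      using second_difference[OF g, of "e/2" y w v] e unfolding D_def by (auto simp: algebra_simps)
    define t where "t = min d1 d2 / 2"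
    have t: "0 < t" "t < d1" "t < d2" using d1 d2 by (auto simp: t_def)
    have "t\<^sup>2 *\<^sub>R (?A - ?B) = (D t - t\<^sup>2 *\<^sub>R ?B) - (D t - t\<^sup>2 *\<^sub>R ?A)" by (simp add: algebra_simps)
    then have "norm (t\<^sup>2 *\<^sub>R (?A - ?B)) \<le> e/2 * t\<^sup>2 + e/2 * t\<^sup>2"
      using d1(2)[of t] d2(2)[of t] t norm_triangle_ineq4[of "D t - t\<^sup>2 *\<^sub>R ?B" "D t - t\<^sup>2 *\<^sub>R ?A"] by simp
    then have "t\<^sup>2 * norm (?A - ?B) \<le> t\<^sup>2 * e" by (simp add: mult.commute)
    then show ?thesis using t by simp
  qed
  have "norm (?A - ?B) \<le> 0"
    by (rule field_le_epsilon) (unfold add_0, rule le)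
  then show "?A = ?B" by (simp only: norm_le_zero_iff right_minus_eq)
qed

lemma iter_deriv_move: "smooth f \<Longrightarrow> iter_deriv f (us @ v # vs) = iter_deriv f (v # us @ vs)"
proof (induction us)
  case (Cons a us)
  then show ?case using dir_deriv_commute[OF smooth_iter_deriv[OF Cons.prems, of "us @ vs"], of v a] by simp
qed simp

lemma iter_deriv_perm: "smooth f \<Longrightarrow> mset us = mset vs \<Longrightarrow> iter_deriv f us = iter_deriv f vs"
proof (induction us arbitrary: vs)
  case (Cons u us)
  then have "u \<in> set vs" by (metis list.set_intros(1) set_mset_mset)
  then obtain p q where vs: "vs = p @ u # q" by (meson split_list)
  then have "iter_deriv f us = iter_deriv f (p @ q)" using Cons by (intro Cons.IH) auto
  then show ?case by (simp add: vs iter_deriv_move[OF Cons.prems(1)])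
qed simp

text \<open>The derivative \<open>f\<^bsup>(m)\<^esup>\<close> with its arguments given as a multiset, as they occur in the elementary
  differentials; for smooth \<open>f\<close> the choice of a list is immaterial by \<open>iter_deriv_perm\<close>.\<close>

definition mset_deriv :: "('a::real_normed_vector \<Rightarrow> 'b::real_normed_vector) \<Rightarrow> 'a multiset \<Rightarrow> 'a \<Rightarrow> 'b" where
  "mset_deriv f M = iter_deriv f (SOME vs. mset vs = M)"

lemma mset_deriv: "smooth f \<Longrightarrow> mset_deriv f (mset vs) = iter_deriv f vs"
  unfolding mset_deriv_def by (rule iter_deriv_perm) (auto intro: someI)

lemma smooth_mset_deriv: "smooth f \<Longrightarrow> smooth (mset_deriv f M)"
  unfolding mset_deriv_def by (rule smooth_iter_deriv)

lemma mset_deriv_union: "smooth f \<Longrightarrow> mset_deriv f (M + N) = mset_deriv (mset_deriv f N) M"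
proof -
  assume f: "smooth f"
  obtain us vs where "mset us = M" "mset vs = N" by (metis ex_mset)
  then show ?thesis using f by (auto simp: mset_deriv iter_deriv_append smooth_iter_deriv simp flip: mset_append)
qed

lemma mset_deriv_single: "smooth f \<Longrightarrow> mset_deriv f {#v#} = dir_deriv f v"
  using mset_deriv[of f "[v]"] by simp
lemma mset_deriv_empty: "smooth f \<Longrightarrow> mset_deriv f {#} = f"
  using mset_deriv[of f "[]"] by simp

text \<open>A direction that varies with \<open>y\<close> is resolved into its coordinates.  By symmetry it may be
  taken first or last: first to use linearity, last so that it is absorbed into the function
  and the induction continues with the other directions.\<close>

lemma smooth_mset_deriv_along:
  fixes f :: "'a::euclidean_space \<Rightarrow> 'b::real_normed_vector" and G :: "'s \<Rightarrow> 'c::euclidean_space \<Rightarrow> 'a"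
  assumes "smooth f" "smooth u" "\<And>s. s \<in># M \<Longrightarrow> smooth (G s)"
  shows "smooth (\<lambda>y. mset_deriv f (image_mset (\<lambda>s. G s y) M) (u y))"
  using assms
proof (induction M arbitrary: f)
  case empty
  then show ?case by (simp add: mset_deriv_empty smooth_compose)
next
  case (add s M)
  let ?I = "\<lambda>y. image_mset (\<lambda>s. G s y) M"
  have "mset_deriv f (image_mset (\<lambda>s. G s y) (add_mset s M)) (u y)
      = (\<Sum>b\<in>Basis. (G s y \<bullet> b) *\<^sub>R mset_deriv (dir_deriv f b) (?I y) (u y))" for y
  proof -
    let ?g = "mset_deriv f (?I y)"
    have g: "smooth ?g" using add.prems by (simp add: smooth_mset_deriv)
    have 1: "mset_deriv f (image_mset (\<lambda>s. G s y) (add_mset s M)) = dir_deriv ?g (G s y)"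
      using mset_deriv_union[OF add.prems(1), of "{#G s y#}" "?I y"] mset_deriv_single[OF g] by simp
    have 2: "dir_deriv ?g b = mset_deriv (dir_deriv f b) (?I y)" for b
      using mset_deriv_union[OF add.prems(1), of "{#b#}" "?I y"] mset_deriv_union[OF add.prems(1), of "?I y" "{#b#}"]
      by (simp add: mset_deriv_single g add.prems(1))
    have 3: "frechet_derivative ?g (at (u y)) (G s y) = (\<Sum>b\<in>Basis. (G s y \<bullet> b) *\<^sub>R dir_deriv ?g b (u y))"
      by (rule linear_expand[OF has_derivative_linear[OF smooth_has_derivative[OF g]]])
    show ?thesis unfolding 1 3 using fun_cong[OF 2, of "u y"] by (simp only:)
  qed
  then have eq: "(\<lambda>y. mset_deriv f (image_mset (\<lambda>s. G s y) (add_mset s M)) (u y))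
      = (\<lambda>y. \<Sum>b\<in>Basis. (G s y \<bullet> b) *\<^sub>R mset_deriv (dir_deriv f b) (?I y) (u y))" by blast
  have inner: "smooth (\<lambda>y. G s y \<bullet> b)" for b
    by (rule smooth_compose[where f = "\<lambda>z. z \<bullet> b"]) (simp_all add: smooth_linear bounded_linear_inner_left add.prems)
  show ?case unfolding eq
    by (rule smooth_sum, rule smooth_scaleR[OF inner], rule add.IH) (simp_all add: add.prems smooth_dir_deriv)
qed

section \<open>Order of vanishing\<close>

text \<open>\<open>u h = O(h\<^sup>n)\<close> as \<open>h \<rightarrow> 0\<close>.  The coefficients of formal power series in \<open>h\<close> are compared
  below by means of this relation, which avoids any explicit formula for higher derivatives
  of a composition.\<close>

definition vanish :: "nat \<Rightarrow> (real \<Rightarrow> 'b::real_normed_vector) \<Rightarrow> bool" where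
  "vanish n u \<longleftrightarrow> (\<exists>C. \<forall>\<^sub>F h in at 0. norm (u h) \<le> C * \<bar>h\<bar> ^ n)"

lemma vanishE:
  assumes "vanish n u"
  obtains C where "C \<ge> 0" "\<forall>\<^sub>F h in at 0. norm (u h) \<le> C * \<bar>h\<bar> ^ n"
proof -
  from assms obtain C where C: "\<forall>\<^sub>F h in at 0. norm (u h) \<le> C * \<bar>h\<bar> ^ n" by (auto simp: vanish_def)
  have "\<forall>\<^sub>F h in at 0. norm (u h) \<le> \<bar>C\<bar> * \<bar>h\<bar> ^ n"
    using C by eventually_elim (meson abs_ge_self abs_ge_zero mult_right_mono order_trans zero_le_power)
  then show thesis using that[of "\<bar>C\<bar>"] by simp
qed

lemma vanish_zero: "vanish n (\<lambda>_. 0)"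
  unfolding vanish_def by (rule exI[of _ 0]) simp

lemma vanish_add:
  assumes "vanish n u" "vanish n v"
  shows "vanish n (\<lambda>h. u h + v h)"
proof -
  obtain C where C: "\<forall>\<^sub>F h in at 0. norm (u h) \<le> C * \<bar>h\<bar> ^ n" using assms by (auto simp: vanish_def)
  obtain D where D: "\<forall>\<^sub>F h in at 0. norm (v h) \<le> D * \<bar>h\<bar> ^ n" using assms by (auto simp: vanish_def)
  from C D have "\<forall>\<^sub>F h in at 0. norm (u h + v h) \<le> (C + D) * \<bar>h\<bar> ^ n"
    by eventually_elim (auto simp: distrib_right intro: norm_triangle_le)
  then show ?thesis by (auto simp: vanish_def)
qed

lemma vanish_sum: "(\<And>i. i \<in> I \<Longrightarrow> vanish n (u i)) \<Longrightarrow> vanish n (\<lambda>h. \<Sum>i\<in>I. u i h)"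
  by (induction I rule: infinite_finite_induct) (auto simp: vanish_zero vanish_add)

lemma vanish_scaleR:
  assumes "vanish m a" "vanish n u"
  shows "vanish (m + n) (\<lambda>h. a h *\<^sub>R u h)"
proof -
  obtain C where C: "C \<ge> 0" "\<forall>\<^sub>F h in at 0. norm (a h) \<le> C * \<bar>h\<bar> ^ m" using assms(1) by (rule vanishE)
  obtain D where D: "D \<ge> 0" "\<forall>\<^sub>F h in at 0. norm (u h) \<le> D * \<bar>h\<bar> ^ n" using assms(2) by (rule vanishE)
  from C(2) D(2) have "\<forall>\<^sub>F h in at 0. norm (a h *\<^sub>R u h) \<le> (C * D) * \<bar>h\<bar> ^ (m + n)"
  proof eventually_elim
    case (elim h)
    have "norm (a h *\<^sub>R u h) \<le> (C * \<bar>h\<bar> ^ m) * (D * \<bar>h\<bar> ^ n)"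
      unfolding norm_scaleR using elim C(1) by (intro mult_mono) auto
    then show ?case by (simp add: power_add ac_simps)
  qed
  then show ?thesis by (auto simp: vanish_def)
qed

lemma vanish_power: "vanish k (\<lambda>h. h ^ k)"
  unfolding vanish_def by (rule exI[of _ 1]) (simp add: power_abs)

lemma vanish_mono:
  assumes "vanish n u" "m \<le> n"
  shows "vanish m u"
proof -
  obtain C where C: "C \<ge> 0" "\<forall>\<^sub>F h in at 0. norm (u h) \<le> C * \<bar>h\<bar> ^ n" using assms(1) by (rule vanishE)
  have "\<forall>\<^sub>F h::real in at 0. \<bar>h\<bar> < 1" 
    unfolding eventually_at by (rule exI[of _ 1]) (simp add: dist_norm)
  with C(2) have "\<forall>\<^sub>F h in at 0. norm (u h) \<le> C * \<bar>h\<bar> ^ m"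
  proof eventually_elim
    case (elim h)
    have "\<bar>h\<bar> ^ n \<le> \<bar>h\<bar> ^ m" using elim assms(2) by (intro power_decreasing) auto
    then show ?case using elim C(1) by (meson mult_left_mono order_trans)
  qed
  then show ?thesis by (auto simp: vanish_def)
qed

lemma vanish_continuous:
  assumes "isCont u 0" shows "vanish 0 u"
proof -
  have "(u \<longlongrightarrow> u 0) (at 0)" using assms by (simp add: isCont_def)
  then have "\<forall>\<^sub>F h in at 0. dist (u h) (u 0) < 1" by (rule tendstoD) simp
  then have "\<forall>\<^sub>F h in at 0. norm (u h) \<le> (norm (u 0) + 1) * \<bar>h\<bar> ^ 0"
    by eventually_elim (simp add: dist_norm, smt (verit) norm_triangle_ineq2)
  then show ?thesis by (auto simp: vanish_def)
qed

lemma vanish_smooth: "smooth u \<Longrightarrow> vanish 0 u"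
  using smooth_continuous[of u UNIV] by (intro vanish_continuous) (simp add: continuous_on_eq_continuous_at)

lemma vanish_const: "vanish 0 (\<lambda>_. c)"
  by (rule vanish_continuous) simp

lemma vanish_power_scaleR: "vanish n u \<Longrightarrow> vanish (k + n) (\<lambda>h. h ^ k *\<^sub>R u h)"
  by (rule vanish_scaleR[OF vanish_power])

lemma vanish_const_scaleR: "vanish n u \<Longrightarrow> vanish n (\<lambda>h. c *\<^sub>R u h)" for c :: real
  using vanish_scaleR[OF vanish_const, of n u c] by simp

lemma vanish_minus: "vanish n u \<Longrightarrow> vanish n (\<lambda>h. - u h)"
  by (simp add: vanish_def)

lemma vanish_diff: "vanish n u \<Longrightarrow> vanish n v \<Longrightarrow> vanish n (\<lambda>h. u h - v h)"
  using vanish_add[OF _ vanish_minus, of n u v] by simp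

lemma vanish_trans: "vanish n (\<lambda>h. u h - v h) \<Longrightarrow> vanish n (\<lambda>h. v h - w h) \<Longrightarrow> vanish n (\<lambda>h. u h - w h)"
  using vanish_add[of n "\<lambda>h. u h - v h" "\<lambda>h. v h - w h"] by simp

text \<open>The polynomial is continuous with value \<open>p 0\<close> at \<open>0\<close>, and the bound forces its limit to vanish.\<close>

lemma vanish_polynomial_0:
  fixes p :: "nat \<Rightarrow> 'b::real_normed_vector"
  assumes "vanish (Suc n) (\<lambda>h. \<Sum>k\<le>m. h ^ k *\<^sub>R p k)"
  shows "p 0 = 0"
proof -
  let ?P = "\<lambda>h. \<Sum>k\<le>m. h ^ k *\<^sub>R p k"
  obtain C where C: "\<forall>\<^sub>F h in at 0. norm (?P h) \<le> C * \<bar>h\<bar> ^ Suc n"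
    using assms by (auto simp: vanish_def)
  have "isCont ?P 0" by (intro continuous_intros)
  then have "(?P \<longlongrightarrow> ?P 0) (at 0)" by (simp only: isCont_def)
  moreover have "((\<lambda>h::real. C * \<bar>h\<bar> ^ Suc n) \<longlongrightarrow> C * \<bar>0\<bar> ^ Suc n) (at 0)"
    by (intro tendsto_intros)
  then have "((\<lambda>h::real. C * \<bar>h\<bar> ^ Suc n) \<longlongrightarrow> 0) (at 0)" by simp
  with C have "(?P \<longlongrightarrow> 0) (at 0)" by (rule Lim_null_comparison)
  ultimately have "?P 0 = 0" by (rule tendsto_unique[rotated]) simp
  also have "?P 0 = (\<Sum>k\<le>m. if k = 0 then p k else 0)" by (intro sum.cong) auto
  also have "\<dots> = p 0" by simp
  finally show ?thesis .
qed

lemma vanish_polynomial: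
  fixes p :: "nat \<Rightarrow> 'b::real_normed_vector"
  assumes "vanish (Suc n) (\<lambda>h. \<Sum>k\<le>n. h ^ k *\<^sub>R p k)" "k \<le> n"
  shows "p k = 0"
  using assms
proof (induction n arbitrary: p k)
  case 0
  have "p 0 = 0" by (rule vanish_polynomial_0[OF 0(1)])
  then show ?case using 0(2) by simp
next
  case (Suc n)
  have p0: "p 0 = 0" by (rule vanish_polynomial_0[OF Suc.prems(1)])
  have split: "(\<Sum>k\<le>Suc n. h ^ k *\<^sub>R p k) = h *\<^sub>R (\<Sum>k\<le>n. h ^ k *\<^sub>R p (Suc k))" for h
    by (simp add: sum.atMost_Suc_shift p0 scaleR_sum_right del: sum.atMost_Suc)
  obtain C where C: "\<forall>\<^sub>F h in at 0. norm (\<Sum>k\<le>Suc n. h ^ k *\<^sub>R p k) \<le> C * \<bar>h\<bar> ^ Suc (Suc n)"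
    using Suc.prems(1) by (auto simp: vanish_def)
  have "\<forall>\<^sub>F h::real in at 0. h \<noteq> 0" by (simp add: eventually_at_filter)
  with C have "\<forall>\<^sub>F h in at 0. norm (\<Sum>k\<le>n. h ^ k *\<^sub>R p (Suc k)) \<le> C * \<bar>h\<bar> ^ Suc n"
  proof eventually_elim
    case (elim h)
    then have "\<bar>h\<bar> * norm (\<Sum>k\<le>n. h ^ k *\<^sub>R p (Suc k)) \<le> \<bar>h\<bar> * (C * \<bar>h\<bar> ^ Suc n)"
      unfolding split by (simp add: ac_simps)
    then show ?case using elim by (simp del: power_Suc)
  qed
  then have "vanish (Suc n) (\<lambda>h. \<Sum>k\<le>n. h ^ k *\<^sub>R p (Suc k))" by (auto simp: vanish_def)
  from Suc.IH[OF this] show ?case using p0 Suc.prems(2) by (cases k) auto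
qed

section \<open>Taylor expansion\<close>

text \<open>Induction on \<open>n\<close>: the derivative of the remainder is the remainder of order \<open>n - 1\<close> of the
  derivative, and it is integrated by the mean value inequality.\<close>

lemma taylor_bound:
  fixes D :: "nat \<Rightarrow> real \<Rightarrow> 'b::real_normed_vector"
  assumes "\<And>i t. (D i has_vector_derivative D (Suc i) t) (at t)"
    and "\<And>t. \<bar>t\<bar> \<le> r \<Longrightarrow> norm (D n t) \<le> C" and "\<bar>t\<bar> \<le> r"
  shows "norm (D 0 t - (\<Sum>i<n. (t ^ i / fact i) *\<^sub>R D i 0)) \<le> C * \<bar>t\<bar> ^ n"
  using assms
proof (induction n arbitrary: D t)
  case (Suc n)
  define G where "G s = D 0 s - (\<Sum>i<Suc n. (s ^ i / fact i) *\<^sub>R D i 0)" for s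
  define G' where "G' s = D (Suc 0) s - (\<Sum>i<n. (s ^ i / fact i) *\<^sub>R D (Suc i) 0)" for s
  have G0: "G 0 = 0"
  proof -
    have "(\<Sum>i<Suc n. (0 ^ i / fact i) *\<^sub>R D i 0) = D 0 0"
      by (simp add: sum.lessThan_Suc_shift del: sum.lessThan_Suc)
    then show ?thesis unfolding G_def by simp
  qed
  have "(G has_vector_derivative G' s) (at s)" for s
  proof -
    have "((\<lambda>s. s ^ Suc i / fact (Suc i)) has_real_derivative s ^ i / fact i) (at s)" for i
    proof -
      have "((\<lambda>s. s ^ Suc i / fact (Suc i)) has_real_derivative real (Suc i) * s ^ i / fact (Suc i)) (at s)"
        by (auto intro!: derivative_eq_intros simp del: power_Suc fact_Suc)
      moreover have "real (Suc i) * s ^ i / fact (Suc i) = s ^ i / fact i"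
        unfolding fact_Suc of_nat_mult by (simp del: of_nat_Suc)
      ultimately show ?thesis by simp
    qed
    then have "((\<lambda>s. \<Sum>i<n. (s ^ Suc i / fact (Suc i)) *\<^sub>R D (Suc i) 0) has_vector_derivative
        (\<Sum>i<n. (s ^ i / fact i) *\<^sub>R D (Suc i) 0)) (at s)"
      by (intro has_vector_derivative_sum)
         (auto simp del: power_Suc fact_Suc intro!: has_vector_derivative_scaleR[where g' = 0, simplified])
    then have "((\<lambda>s. D 0 s - D 0 0 - (\<Sum>i<n. (s ^ Suc i / fact (Suc i)) *\<^sub>R D (Suc i) 0)) has_vector_derivative
       (D (Suc 0) s - 0 - (\<Sum>i<n. (s ^ i / fact i) *\<^sub>R D (Suc i) 0))) (at s)"
      by (intro has_vector_derivative_diff Suc.prems(1) has_vector_derivative_const)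
    moreover have "G = (\<lambda>s. D 0 s - D 0 0 - (\<Sum>i<n. (s ^ Suc i / fact (Suc i)) *\<^sub>R D (Suc i) 0))"
      by (rule ext) (simp add: G_def sum.lessThan_Suc_shift del: sum.lessThan_Suc power_Suc fact_Suc)
    ultimately show ?thesis unfolding G'_def by simp
  qed
  moreover have "norm (G' s - 0) \<le> C * \<bar>t\<bar> ^ n" if s: "\<bar>s\<bar> \<le> \<bar>t\<bar>" for s
  proof -
    have sr: "\<bar>s\<bar> \<le> r" using s Suc.prems(3) by simp
    have "0 \<le> C" using Suc.prems(2)[OF sr] norm_ge_zero order_trans by blast
    have "norm (G' s) \<le> C * \<bar>s\<bar> ^ n"
      unfolding G'_def by (rule Suc.IH[where D = "\<lambda>i. D (Suc i)"]) (use Suc.prems sr in auto)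
    also have "\<dots> \<le> C * \<bar>t\<bar> ^ n" using s \<open>0 \<le> C\<close> by (intro mult_left_mono power_mono) auto
    finally show ?thesis by simp
  qed
  ultimately have "norm (G t - G 0 - t *\<^sub>R 0) \<le> (C * \<bar>t\<bar> ^ n) * \<bar>t\<bar>"
    by (intro norm_increment_le[where u' = G']) auto
  then show ?case unfolding G0 by (simp add: G_def ac_simps)
qed simp

lemma smooth_bounded_on_ball:
  fixes f :: "'a::euclidean_space \<Rightarrow> 'b::real_normed_vector"
  assumes "smooth f"
  obtains C where "\<And>x. norm x \<le> R \<Longrightarrow> norm (f x) \<le> C"
proof -
  have "bounded (f ` cball 0 R)"
    by (intro compact_imp_bounded compact_continuous_image smooth_continuous assms compact_cball)
  then obtain C where "\<forall>x\<in>cball 0 R. norm (f x) \<le> C" by (auto simp: bounded_iff)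
  then show thesis using that[of C] by simp
qed

text \<open>The bound is uniform in the base point, which is needed because base points will move with the
  step size.\<close>

lemma taylor_line:
  fixes f :: "'a::euclidean_space \<Rightarrow> 'b::real_normed_vector"
  assumes "smooth f"
  shows "\<exists>C. \<forall>p t. norm p \<le> R \<and> \<bar>t\<bar> \<le> 1 \<longrightarrow>
    norm (f (p + t *\<^sub>R w) - (\<Sum>i<n. (t ^ i / fact i) *\<^sub>R iter_deriv f (replicate i w) p)) \<le> C * \<bar>t\<bar> ^ n"
proof -
  obtain C where C: "\<And>x. norm x \<le> R + norm w \<Longrightarrow> norm (iter_deriv f (replicate n w) x) \<le> C"
    using smooth_bounded_on_ball[OF smooth_iter_deriv[OF assms]] by metis
  show ?thesis
  proof (intro exI[of _ C] allI impI)
    fix p :: 'a and t :: real assume pt: "norm p \<le> R \<and> \<bar>t\<bar> \<le> 1"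
    show "norm (f (p + t *\<^sub>R w) - (\<Sum>i<n. (t ^ i / fact i) *\<^sub>R iter_deriv f (replicate i w) p)) \<le> C * \<bar>t\<bar> ^ n"
    proof (rule taylor_bound[where D = "\<lambda>i t. iter_deriv f (replicate i w) (p + t *\<^sub>R w)" and r = 1, simplified])
      fix i t
      show "((\<lambda>t. iter_deriv f (replicate i w) (p + t *\<^sub>R w)) has_vector_derivative
           dir_deriv (iter_deriv f (replicate i w)) w (p + t *\<^sub>R w)) (at t)"
        by (rule smooth_line[OF smooth_iter_deriv[OF assms]])
    next
      fix t :: real assume t: "\<bar>t\<bar> \<le> 1"
      have "norm (p + t *\<^sub>R w) \<le> norm p + \<bar>t\<bar> * norm w" by (rule norm_triangle_le) simp
      also have "\<dots> \<le> R + 1 * norm w" using pt t by (intro add_mono mult_right_mono) auto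
      finally show "norm (iter_deriv f (replicate n w) (p + t *\<^sub>R w)) \<le> C" by (intro C) simp
    qed (use pt in auto)
  qed
qed

lemma eventually_abs_le_at_0: "r > 0 \<Longrightarrow> \<forall>\<^sub>F h::real in at 0. \<bar>h\<bar> \<le> r"
  unfolding eventually_at by (rule exI[of _ r]) (auto simp: dist_norm)

lemma vanish_0_bounded: "vanish 0 u \<Longrightarrow> \<exists>R. \<forall>\<^sub>F h in at 0. norm (u h) \<le> R"
  by (simp add: vanish_def)

lemma taylor_curve:
  fixes u :: "real \<Rightarrow> 'b::real_normed_vector"
  assumes "smooth u"
  shows "vanish (Suc n) (\<lambda>h. u h - (\<Sum>k\<le>n. h ^ k *\<^sub>R taylor_coeff k u))"
proof -
  have *: "((\<lambda>g t. vector_derivative g (at t)) ^^ k) u = iter_deriv u (replicate k 1)" for k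
  proof (induction k)
    case (Suc k)
    have "(iter_deriv u (replicate k 1) has_vector_derivative dir_deriv (iter_deriv u (replicate k 1)) 1 t) (at t)" for t
      using smooth_line[OF smooth_iter_deriv[OF assms], of "replicate k 1" 0 1 t] by simp
    then have "vector_derivative (iter_deriv u (replicate k 1)) (at t) = dir_deriv (iter_deriv u (replicate k 1)) 1 t" for t
      by (rule vector_derivative_at)
    then show ?case using Suc by simp
  qed simp
  obtain C where C: "\<And>t. \<bar>t\<bar> \<le> 1 \<Longrightarrow>
      norm (u (0 + t *\<^sub>R 1) - (\<Sum>i<Suc n. (t ^ i / fact i) *\<^sub>R iter_deriv u (replicate i 1) 0)) \<le> C * \<bar>t\<bar> ^ Suc n"
    using taylor_line[OF assms, of 0 1 "Suc n"] by auto
  have "\<forall>\<^sub>F h in at 0. norm (u h - (\<Sum>k\<le>n. h ^ k *\<^sub>R taylor_coeff k u)) \<le> C * \<bar>h\<bar> ^ Suc n"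
    using eventually_abs_le_at_0[of 1]
  proof (rule eventually_mono)
    fix h :: real assume "\<bar>h\<bar> \<le> 1"
    from C[OF this] show "norm (u h - (\<Sum>k\<le>n. h ^ k *\<^sub>R taylor_coeff k u)) \<le> C * \<bar>h\<bar> ^ Suc n"
      by (simp add: taylor_coeff_def * lessThan_Suc_atMost divide_inverse)
  qed simp
  then show ?thesis by (auto simp: vanish_def)
qed

text \<open>The Taylor polynomial is the only polynomial of degree \<open>n\<close> that approximates a smooth curve to
  order \<open>n + 1\<close>.\<close>

lemma taylor_coeff_eqI:
  fixes u :: "real \<Rightarrow> 'b::real_normed_vector"
  assumes "smooth u" "vanish (Suc n) (\<lambda>h. u h - (\<Sum>k\<le>n. h ^ k *\<^sub>R p k))" "k \<le> n"
  shows "taylor_coeff k u = p k"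
proof -
  have "vanish (Suc n) (\<lambda>h. \<Sum>k\<le>n. h ^ k *\<^sub>R (taylor_coeff k u - p k))"
    using vanish_diff[OF assms(2) taylor_curve[OF assms(1), of n]]
    by (simp add: scaleR_diff_right sum_subtractf)
  from vanish_polynomial[OF this assms(3)] show ?thesis by simp
qed

text \<open>A smooth map is Lipschitz on balls.\<close>

lemma vanish_smooth_compose:
  fixes f :: "'a::euclidean_space \<Rightarrow> 'b::real_normed_vector"
  assumes f: "smooth f" and uv: "vanish n (\<lambda>h. u h - v h)" and bd: "vanish 0 u" "vanish 0 v"
  shows "vanish n (\<lambda>h. f (u h) - f (v h))"
proof -
  obtain R S where R: "\<forall>\<^sub>F h in at 0. norm (u h) \<le> R" and S: "\<forall>\<^sub>F h in at 0. norm (v h) \<le> S"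
    using bd vanish_0_bounded by metis
  define T where "T = max R S"
  have "\<exists>B. \<forall>x. norm x \<le> T \<longrightarrow> norm (dir_deriv f b x) \<le> B" for b
    using smooth_bounded_on_ball[OF smooth_dir_deriv[OF f]] by metis
  then obtain B where B: "\<And>b x. norm x \<le> T \<Longrightarrow> norm (dir_deriv f b x) \<le> B b" by metis
  define L where "L = (\<Sum>b\<in>Basis. B b)"
  have lip: "norm (f x - f y) \<le> L * norm (x - y)" if "norm x \<le> T" "norm y \<le> T" for x y
  proof (rule differentiable_bound[where S = "cball 0 T" and f' = "\<lambda>x. frechet_derivative f (at x)"])
    fix x assume x: "x \<in> cball (0::'a) T"
    show "(f has_derivative frechet_derivative f (at x)) (at x within cball 0 T)"
      by (rule has_derivative_at_withinI[OF smooth_has_derivative[OF f]])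
    show "onorm (frechet_derivative f (at x)) \<le> L"
    proof (rule onorm_le)
      fix w
      have "norm (frechet_derivative f (at x) w) = norm (\<Sum>b\<in>Basis. (w \<bullet> b) *\<^sub>R dir_deriv f b x)"
        by (rule arg_cong[of _ _ norm], rule linear_expand) (rule has_derivative_linear[OF smooth_has_derivative[OF f]])
      also have "\<dots> \<le> (\<Sum>b\<in>Basis. norm w * B b)"
      proof (rule sum_norm_le)
        fix b :: 'a assume b: "b \<in> Basis"
        have "norm ((w \<bullet> b) *\<^sub>R dir_deriv f b x) = \<bar>w \<bullet> b\<bar> * norm (dir_deriv f b x)" by simp
        also have "\<dots> \<le> norm w * B b"
          using x b B by (intro mult_mono Basis_le_norm) auto
        finally show "norm ((w \<bullet> b) *\<^sub>R dir_deriv f b x) \<le> norm w * B b" .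
      qed
      finally show "norm (frechet_derivative f (at x) w) \<le> L * norm w"
        by (simp add: L_def sum_distrib_left mult.commute)
    qed
  qed (use that in auto)
  obtain C where C: "\<forall>\<^sub>F h in at 0. norm (u h - v h) \<le> C * \<bar>h\<bar> ^ n" using uv by (auto simp: vanish_def)
  have "\<forall>\<^sub>F h in at 0. norm (f (u h) - f (v h)) \<le> (\<bar>L\<bar> * C) * \<bar>h\<bar> ^ n"
    using C R S
  proof eventually_elim
    case (elim h)
    have "norm (f (u h) - f (v h)) \<le> L * norm (u h - v h)" using elim by (intro lip) (auto simp: T_def)
    also have "\<dots> \<le> \<bar>L\<bar> * norm (u h - v h)" by (intro mult_right_mono) auto
    also have "\<dots> \<le> \<bar>L\<bar> * (C * \<bar>h\<bar> ^ n)" using elim by (intro mult_left_mono) auto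
    finally show ?case by (simp add: ac_simps)
  qed
  then show ?thesis by (auto simp: vanish_def)
qed

text \<open>Vanishing to some order for every fixed \<open>y\<close> means that the corresponding Taylor coefficients in
  \<open>h\<close> are identically zero in \<open>y\<close>; as the remainder is uniform on bounded sets, \<open>y\<close> may then be
  replaced by a curve.\<close>

lemma vanish_uniform:
  fixes R :: "real \<times> 'a::euclidean_space \<Rightarrow> 'b::real_normed_vector"
  assumes R: "smooth R" and v: "\<And>y. vanish (Suc n) (\<lambda>h. R (h, y))" and Y: "vanish 0 Y"
  shows "vanish (Suc n) (\<lambda>h. R (h, Y h))"
proof -
  obtain K where K: "\<forall>\<^sub>F h in at 0. norm (Y h) \<le> K" using Y vanish_0_bounded by metis
  let ?D = "\<lambda>i. iter_deriv R (replicate i (1, 0))"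
  have ex: "\<exists>C. \<forall>y t. norm y \<le> S \<and> \<bar>t\<bar> \<le> 1 \<longrightarrow>
     norm (R (t, y) - (\<Sum>i\<le>n. t ^ i *\<^sub>R ((1 / fact i) *\<^sub>R ?D i (0, y)))) \<le> C * \<bar>t\<bar> ^ Suc n" for S
  proof -
    obtain C where C: "\<And>p t. norm p \<le> S \<and> \<bar>t\<bar> \<le> 1 \<Longrightarrow>
      norm (R (p + t *\<^sub>R (1, 0)) - (\<Sum>i<Suc n. (t ^ i / fact i) *\<^sub>R ?D i p)) \<le> C * \<bar>t\<bar> ^ Suc n"
      using taylor_line[OF R, of S "(1, 0)" "Suc n"] by blast
    show ?thesis
    proof (intro exI[of _ C] allI impI)
      fix y :: 'a and t :: real assume "norm y \<le> S \<and> \<bar>t\<bar> \<le> 1"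
      then show "norm (R (t, y) - (\<Sum>i\<le>n. t ^ i *\<^sub>R ((1 / fact i) *\<^sub>R ?D i (0, y)))) \<le> C * \<bar>t\<bar> ^ Suc n"
        using C[of "(0, y)" t] by (simp add: norm_Pair lessThan_Suc_atMost del: sum.atMost_Suc sum.lessThan_Suc)
    qed
  qed
  obtain C where "\<forall>S y t. norm y \<le> S \<and> \<bar>t\<bar> \<le> 1 \<longrightarrow>
     norm (R (t, y) - (\<Sum>i\<le>n. t ^ i *\<^sub>R ((1 / fact i) *\<^sub>R ?D i (0, y)))) \<le> C S * \<bar>t\<bar> ^ Suc n"
    using choice[OF allI[of "\<lambda>S. \<exists>C. \<forall>y t. norm y \<le> S \<and> \<bar>t\<bar> \<le> 1 \<longrightarrow>
     norm (R (t, y) - (\<Sum>i\<le>n. t ^ i *\<^sub>R ((1 / fact i) *\<^sub>R ?D i (0, y)))) \<le> C * \<bar>t\<bar> ^ Suc n", OF ex]] by blast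
  then have C: "\<And>S y t. norm y \<le> S \<and> \<bar>t\<bar> \<le> 1 \<Longrightarrow>
     norm (R (t, y) - (\<Sum>i\<le>n. t ^ i *\<^sub>R ((1 / fact i) *\<^sub>R ?D i (0, y)))) \<le> C S * \<bar>t\<bar> ^ Suc n" by blast
  have zero: "(1 / fact i) *\<^sub>R ?D i (0, y) = 0" if "i \<le> n" for i y
  proof -
    have "vanish (Suc n) (\<lambda>h. R (h, y) - (\<Sum>i\<le>n. h ^ i *\<^sub>R ((1 / fact i) *\<^sub>R ?D i (0, y))))"
      unfolding vanish_def
      by (intro exI[of _ "C (norm y)"] eventually_mono[OF eventually_abs_le_at_0[of 1]] C) auto
    from vanish_diff[OF v[of y] this]
    have "vanish (Suc n) (\<lambda>h. \<Sum>i\<le>n. h ^ i *\<^sub>R ((1 / fact i) *\<^sub>R ?D i (0, y)))" by simp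
    from vanish_polynomial[OF this that] show ?thesis .
  qed
  have "\<forall>\<^sub>F h in at 0. norm (R (h, Y h)) \<le> C K * \<bar>h\<bar> ^ Suc n"
    using K eventually_abs_le_at_0[of 1, simplified]
  proof eventually_elim
    case (elim h)
    have "(\<Sum>i\<le>n. h ^ i *\<^sub>R ((1 / fact i) *\<^sub>R ?D i (0, Y h))) = 0"
      by (rule sum.neutral) (use zero[of _ "Y h"] in auto)
    then show ?case using C[of "Y h" K h] elim by (simp del: sum.atMost_Suc)
  qed
  then show ?thesis by (auto simp: vanish_def)
qed

section \<open>Taylor expansion in finitely many directions\<close>

definition bounded_msets :: "'s set \<Rightarrow> ('s \<Rightarrow> nat) \<Rightarrow> nat \<Rightarrow> 's multiset set" where
  "bounded_msets S d n = {\<omega>. set_mset \<omega> \<subseteq> S \<and> \<Sum>\<^sub># (image_mset d \<omega>) \<le> n}"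

text \<open>The coefficient, in Taylor's formula, of the derivative in the directions \<open>\<omega>\<close> when the increment
  has components \<open>c s\<close>.\<close>

definition mset_coeff :: "('s \<Rightarrow> real) \<Rightarrow> 's set \<Rightarrow> 's multiset \<Rightarrow> real" where
  "mset_coeff c S \<omega> = (\<Prod>s\<in>S. c s ^ count \<omega> s / fact (count \<omega> s))"

lemma bij_bounded_msets_insert:
  assumes "s \<notin> S"
  shows "bij_betw (\<lambda>(m, \<omega>). \<omega> + replicate_mset m s)
     (SIGMA m:{m. m * d s \<le> n}. bounded_msets S d (n - m * d s)) (bounded_msets (insert s S) d n)"
proof (rule bij_betw_byWitness[where f' = "\<lambda>\<omega>. (count \<omega> s, filter_mset (\<lambda>x. x \<noteq> s) \<omega>)"], goal_cases)
  case 1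
  have "count \<omega> s = 0" "filter_mset (\<lambda>x. x \<noteq> s) \<omega> = \<omega>" if "set_mset \<omega> \<subseteq> S" for \<omega>
    using that assms by (auto simp: not_in_iff[symmetric] filter_mset_eq_conv)
  moreover have "filter_mset (\<lambda>x. x \<noteq> s) (replicate_mset m s) = {#}" for m
    by (induction m) auto
  ultimately show ?case by (auto simp: bounded_msets_def)
next
  case 2
  show ?case by (auto simp: multiset_eq_iff)
next
  case 3
  show ?case by (auto simp: bounded_msets_def split: if_splits)
next
  case 4
  show ?case
  proof
    fix x assume "x \<in> (\<lambda>\<omega>. (count \<omega> s, filter_mset (\<lambda>x. x \<noteq> s) \<omega>)) ` bounded_msets (insert s S) d n"
    then obtain \<omega> where \<omega>: "\<omega> \<in> bounded_msets (insert s S) d n" and x: "x = (count \<omega> s, filter_mset (\<lambda>x. x \<noteq> s) \<omega>)"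
      by blast
    have "\<omega> = filter_mset (\<lambda>x. x \<noteq> s) \<omega> + replicate_mset (count \<omega> s) s" by (auto simp: multiset_eq_iff)
    then have "\<Sum>\<^sub># (image_mset d \<omega>) = \<Sum>\<^sub># (image_mset d (filter_mset (\<lambda>x. x \<noteq> s) \<omega>)) + count \<omega> s * d s"
      by (metis image_mset_union sum_mset.union image_replicate_mset sum_mset_replicate_mset of_nat_id)
    then show "x \<in> (SIGMA m:{m. m * d s \<le> n}. bounded_msets S d (n - m * d s))"
      using \<omega> by (auto simp: x bounded_msets_def)
  qed
qed

lemma finite_multiples: "1 \<le> k \<Longrightarrow> finite {m::nat. m * k \<le> n}"
  by (rule finite_subset[of _ "{..n}"]) (auto elim: order_trans[rotated])

lemma finite_bounded_msets:
  assumes "finite S" "\<And>s. s \<in> S \<Longrightarrow> 1 \<le> d s"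
  shows "finite (bounded_msets S d n)"
  using assms
proof (induction S arbitrary: n)
  case empty
  then show ?case by (simp add: bounded_msets_def)
next
  case (insert s S)
  then have "finite (SIGMA m:{m. m * d s \<le> n}. bounded_msets S d (n - m * d s))"
    by (intro finite_SigmaI finite_multiples) auto
  then show ?case using bij_betw_finite[OF bij_bounded_msets_insert[OF insert.hyps(2)]] by blast
qed

text \<open>Taylor's formula in the directions \<open>w s\<close>, the direction \<open>w s\<close> carrying weight \<open>d s\<close>.  The
  directions are treated one at a time by the one-dimensional formula, so that the multinomial
  coefficients appear as products of the \<open>1 / m!\<close> of each direction, in place of an expansion of
  \<open>f\<^bsup>(m)\<^esup>\<close> by multilinearity.\<close>

lemma multi_taylor:
  fixes f :: "'a::euclidean_space \<Rightarrow> 'b::real_normed_vector"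
  assumes "finite S" "\<And>s. s \<in> S \<Longrightarrow> 1 \<le> d s" "smooth f"
  shows "vanish (Suc n) (\<lambda>h. f (y + (\<Sum>s\<in>S. (c s * h ^ d s) *\<^sub>R w s)) -
     (\<Sum>\<omega>\<in>bounded_msets S d n. (h ^ \<Sum>\<^sub># (image_mset d \<omega>) * mset_coeff c S \<omega>) *\<^sub>R mset_deriv f (image_mset w \<omega>) y))"
  using assms
proof (induction S arbitrary: f n)
  case empty
  have "bounded_msets {} d n = {{#}}" by (auto simp: bounded_msets_def)
  then show ?case using empty by (simp add: mset_coeff_def mset_deriv_empty vanish_zero)
next
  case (insert s S)
  (* The direction w s is expanded first, at the base point p h that contains the others. *)
  define p where "p h = y + (\<Sum>s\<in>S. (c s * h ^ d s) *\<^sub>R w s)" for h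
  define t where "t h = c s * h ^ d s" for h
  define g where "g m = iter_deriv f (replicate m (w s))" for m
  define T where "T m h \<omega> = (h ^ \<Sum>\<^sub># (image_mset d \<omega>) * mset_coeff c S \<omega>) *\<^sub>R mset_deriv (g m) (image_mset w \<omega>) y" for m h \<omega>
  let ?I = "\<lambda>m. bounded_msets S d (n - m * d s)"
  let ?M = "{m. m * d s \<le> n}"
  have ds: "1 \<le> d s" and d: "\<And>s. s \<in> S \<Longrightarrow> 1 \<le> d s" using insert.prems by auto
  have f: "smooth f" by (rule insert.prems)
  have g: "smooth (g m)" for m unfolding g_def by (rule smooth_iter_deriv[OF f])
  have p: "isCont p 0" unfolding p_def by (intro continuous_intros)
  have gp: "vanish 0 (\<lambda>h. g m (p h))" for m
  proof -
    have "isCont (g m) (p 0)" using smooth_continuous[OF g, of UNIV] by (simp add: continuous_on_eq_continuous_at)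
    from isCont_o2[OF p this] show ?thesis by (rule vanish_continuous)
  qed
  have t_pow: "vanish (m * d s) (\<lambda>h. t h ^ m / fact m)" for m
    unfolding vanish_def
    by (rule exI[of _ "\<bar>c s\<bar> ^ m / fact m"]) (simp add: t_def power_mult_distrib abs_mult power_abs power_mult[symmetric] mult.commute[of m])
  obtain R where R: "\<forall>\<^sub>F h in at 0. norm (p h) \<le> R" using vanish_0_bounded[OF vanish_continuous[OF p]] by blast
  have t1: "\<forall>\<^sub>F h in at 0. \<bar>t h\<bar> \<le> 1"
  proof -
    have "(t \<longlongrightarrow> c s * 0 ^ d s) (at 0)" unfolding t_def by (intro tendsto_intros)
    then have "(t \<longlongrightarrow> 0) (at 0)" using ds by (simp add: power_0_left)
    from tendstoD[OF this, of 1] show ?thesis by (auto elim: eventually_mono)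
  qed
  obtain C where C: "\<And>p t. norm p \<le> R \<and> \<bar>t\<bar> \<le> 1 \<Longrightarrow>
    norm (f (p + t *\<^sub>R w s) - (\<Sum>i<Suc n. (t ^ i / fact i) *\<^sub>R g i p)) \<le> C * \<bar>t\<bar> ^ Suc n"
    using taylor_line[OF f, of R "w s" "Suc n"] unfolding g_def by blast
  have A: "vanish (Suc n) (\<lambda>h. f (p h + t h *\<^sub>R w s) - (\<Sum>i<Suc n. (t h ^ i / fact i) *\<^sub>R g i (p h)))"
  proof -
    have "\<forall>\<^sub>F h in at 0. norm (f (p h + t h *\<^sub>R w s) - (\<Sum>i<Suc n. (t h ^ i / fact i) *\<^sub>R g i (p h)))
        \<le> (C * \<bar>c s\<bar> ^ Suc n) * \<bar>h\<bar> ^ (d s * Suc n)"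
      using R t1
    proof eventually_elim
      case (elim h)
      then have "norm (f (p h + t h *\<^sub>R w s) - (\<Sum>i<Suc n. (t h ^ i / fact i) *\<^sub>R g i (p h))) \<le> C * \<bar>t h\<bar> ^ Suc n"
        by (intro C) simp
      also have "\<bar>t h\<bar> ^ Suc n = \<bar>c s\<bar> ^ Suc n * \<bar>h\<bar> ^ (d s * Suc n)"
        by (simp only: t_def abs_mult power_abs power_mult_distrib power_mult)
      finally show ?case by (simp only: mult.assoc)
    qed
    then have v: "vanish (d s * Suc n) (\<lambda>h. f (p h + t h *\<^sub>R w s) - (\<Sum>i<Suc n. (t h ^ i / fact i) *\<^sub>R g i (p h)))"
      unfolding vanish_def by blast
    have "Suc n \<le> d s * Suc n" using mult_le_mono1[OF ds, of "Suc n"] by (simp only: mult_1)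
    with v show ?thesis by (rule vanish_mono)
  qed
  have B: "vanish (Suc n) (\<lambda>h. (t h ^ m / fact m) *\<^sub>R g m (p h)
       - (if m * d s \<le> n then (t h ^ m / fact m) *\<^sub>R (\<Sum>\<omega>\<in>?I m. T m h \<omega>) else 0))" for m
  proof (cases "m * d s \<le> n")
    case True
    have "vanish (Suc (n - m * d s)) (\<lambda>h. g m (p h) - (\<Sum>\<omega>\<in>?I m. T m h \<omega>))"
      unfolding p_def T_def by (rule insert.IH[OF d g])
    from vanish_scaleR[OF t_pow this]
    have "vanish (m * d s + Suc (n - m * d s)) (\<lambda>h. (t h ^ m / fact m) *\<^sub>R (g m (p h) - (\<Sum>\<omega>\<in>?I m. T m h \<omega>)))" .
    moreover have "m * d s + Suc (n - m * d s) = Suc n" using True by simp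
    ultimately show ?thesis using True by (simp only: scaleR_diff_right if_True)
  next
    case False
    have "vanish (m * d s + 0) (\<lambda>h. (t h ^ m / fact m) *\<^sub>R g m (p h))" by (rule vanish_scaleR[OF t_pow gp])
    then have "vanish (Suc n) (\<lambda>h. (t h ^ m / fact m) *\<^sub>R g m (p h))" by (rule vanish_mono) (use False in simp)
    then show ?thesis using False by simp
  qed
  have M: "?M \<subseteq> {..<Suc n}"
  proof
    fix m assume m: "m \<in> ?M"
    have "m * 1 \<le> m * d s" by (rule mult_le_mono2[OF ds])
    also have "\<dots> \<le> n" using m by simp
    finally show "m \<in> {..<Suc n}" by simp
  qed
  have sum_eq: "(\<Sum>i<Suc n. if i * d s \<le> n then (t h ^ i / fact i) *\<^sub>R (\<Sum>\<omega>\<in>?I i. T i h \<omega>) else 0) =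
     (\<Sum>\<omega>\<in>bounded_msets (insert s S) d n. (h ^ \<Sum>\<^sub># (image_mset d \<omega>) * mset_coeff c (insert s S) \<omega>) *\<^sub>R mset_deriv f (image_mset w \<omega>) y)"
    (is "_ = sum ?G _") for h
  proof -
    have summand: "?G (\<omega> + replicate_mset m s) = (t h ^ m / fact m) *\<^sub>R T m h \<omega>" if "\<omega> \<in> ?I m" for m \<omega>
    proof -
      have "count \<omega> s = 0" using that insert.hyps by (auto simp: bounded_msets_def not_in_iff[symmetric])
      moreover have "mset_coeff c S (\<omega> + replicate_mset m s) = mset_coeff c S \<omega>"
        unfolding mset_coeff_def using insert.hyps by (intro prod.cong) auto
      ultimately have co: "mset_coeff c (insert s S) (\<omega> + replicate_mset m s) = c s ^ m / fact m * mset_coeff c S \<omega>"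
        using insert.hyps by (simp add: mset_coeff_def)
      have "mset_deriv f (image_mset w (\<omega> + replicate_mset m s)) = mset_deriv (g m) (image_mset w \<omega>)"
        using mset_deriv_union[OF f, of "image_mset w \<omega>" "replicate_mset m (w s)"] mset_deriv[OF f, of "replicate m (w s)"]
        by (simp add: g_def)
      then show ?thesis
        by (simp add: co T_def t_def power_add power_mult_distrib power_mult[symmetric] ac_simps)
    qed
    have "(\<Sum>i<Suc n. if i * d s \<le> n then (t h ^ i / fact i) *\<^sub>R (\<Sum>\<omega>\<in>?I i. T i h \<omega>) else 0)
      = (\<Sum>i\<in>{i \<in> {..<Suc n}. i * d s \<le> n}. (t h ^ i / fact i) *\<^sub>R (\<Sum>\<omega>\<in>?I i. T i h \<omega>))"
      by (rule sum.inter_filter[symmetric]) simp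
    also have "{i \<in> {..<Suc n}. i * d s \<le> n} = ?M" using M by blast
    also have "(\<Sum>i\<in>?M. (t h ^ i / fact i) *\<^sub>R (\<Sum>\<omega>\<in>?I i. T i h \<omega>)) = (\<Sum>i\<in>?M. \<Sum>\<omega>\<in>?I i. ?G (\<omega> + replicate_mset i s))"
      unfolding scaleR_sum_right by (intro sum.cong refl summand[symmetric])
    also have "\<dots> = (\<Sum>(m, \<omega>)\<in>(SIGMA m:?M. ?I m). ?G (\<omega> + replicate_mset m s))"
      using finite_multiples[OF ds] finite_bounded_msets[OF insert.hyps(1) d] by (intro sum.Sigma) auto
    also have "\<dots> = sum ?G (bounded_msets (insert s S) d n)"
      using sum.reindex_bij_betw[OF bij_bounded_msets_insert[OF insert.hyps(2)], of ?G] by (simp add: case_prod_unfold)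
    finally show ?thesis .
  qed
  have pt: "y + (\<Sum>s\<in>insert s S. (c s * h ^ d s) *\<^sub>R w s) = p h + t h *\<^sub>R w s" for h
    using insert.hyps by (simp add: p_def t_def)
  have "vanish (Suc n) (\<lambda>h. (\<Sum>i<Suc n. (t h ^ i / fact i) *\<^sub>R g i (p h))
      - (\<Sum>i<Suc n. if i * d s \<le> n then (t h ^ i / fact i) *\<^sub>R (\<Sum>\<omega>\<in>?I i. T i h \<omega>) else 0))"
    unfolding sum_subtractf[symmetric] by (rule vanish_sum) (rule B)
  from vanish_trans[OF A this] show ?case unfolding sum_eq pt .
qed

section \<open>Multiplicative functions span all functions on a finite set of forests\<close>

text \<open>The linear span of the characters, regarded as functions on monomials.\<close>

inductive mult_span :: "(forest \<Rightarrow> real) \<Rightarrow> bool" where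
  generator: "mult_span (forest_prod x)"
| add: "mult_span u \<Longrightarrow> mult_span v \<Longrightarrow> mult_span (\<lambda>\<omega>. u \<omega> + v \<omega>)"
| scale: "mult_span u \<Longrightarrow> mult_span (\<lambda>\<omega>. r * u \<omega>)"

lemma mult_span_mult: "mult_span u \<Longrightarrow> mult_span v \<Longrightarrow> mult_span (\<lambda>\<omega>. u \<omega> * v \<omega>)"
proof (induction rule: mult_span.induct)
  case (generator x)
  from generator show ?case
  proof (induction rule: mult_span.induct)
    case (generator z)
    show ?case using mult_span.generator[of "\<lambda>\<tau>. x \<tau> * z \<tau>"] by (simp add: prod_mset.distrib)
  qed (auto simp: distrib_left mult.left_commute intro: mult_span.intros)
qed (auto simp: distrib_right mult.assoc intro: mult_span.intros)

lemma mult_span_const: "mult_span (\<lambda>_. r)"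
  using mult_span.scale[OF mult_span.generator[of "\<lambda>_. 1"], of r] by simp

lemma mult_span_prod: "(\<And>i. i \<in> I \<Longrightarrow> mult_span (u i)) \<Longrightarrow> mult_span (\<lambda>\<omega>. \<Prod>i\<in>I. u i \<omega>)"
  by (induction I rule: infinite_finite_induct) (auto simp: mult_span_const intro: mult_span_mult)

lemma mult_span_sum: "(\<And>i. i \<in> I \<Longrightarrow> mult_span (u i)) \<Longrightarrow> mult_span (\<lambda>\<omega>. \<Sum>i\<in>I. u i \<omega>)"
  by (induction I rule: infinite_finite_induct) (auto simp: mult_span_const intro: mult_span.add)

lemma mult_span_separates:
  assumes "\<alpha> \<noteq> \<omega>"
  shows "\<exists>g. mult_span g \<and> g \<alpha> = 1 \<and> g \<omega> = 0"
proof -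
  obtain \<tau> where \<tau>: "count \<alpha> \<tau> \<noteq> count \<omega> \<tau>" using assms by (auto simp: multiset_eq_iff)
  (* The powers of 2 tell multiplicities of the tree \<tau> apart. *)
  let ?x = "\<lambda>\<sigma>. if \<sigma> = \<tau> then 2 else (1::real)"
  let ?g = "forest_prod ?x"
  have g: "?g \<rho> = 2 ^ count \<rho> \<tau>" for \<rho> by (induction \<rho>) auto
  have ne: "?g \<alpha> - ?g \<omega> \<noteq> 0" using \<tau> by (simp add: g)
  let ?u = "\<lambda>\<rho>. (1 / (?g \<alpha> - ?g \<omega>)) * (?g \<rho> + - ?g \<omega>)"
  have "mult_span ?u" by (intro mult_span.intros mult_span_const)
  moreover have "?u \<alpha> = 1" "?u \<omega> = 0" using ne by auto
  ultimately show ?thesis by (intro exI[of _ ?u]) auto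
qed

text \<open>The span is a unital algebra that separates forests, so it contains an indicator function for
  each point of a finite set.\<close>

lemma mult_span_interpolates:
  assumes "finite \<Omega>"
  shows "\<exists>\<gamma>. mult_span \<gamma> \<and> (\<forall>\<omega>\<in>\<Omega>. \<gamma> \<omega> = \<beta> \<omega>)"
proof -
  have "\<exists>g. \<forall>\<alpha> \<omega>. \<alpha> \<noteq> \<omega> \<longrightarrow> mult_span (g \<alpha> \<omega>) \<and> g \<alpha> \<omega> \<alpha> = 1 \<and> g \<alpha> \<omega> \<omega> = 0"
    using mult_span_separates by metis
  then obtain g where g: "\<And>\<alpha> \<omega>. \<alpha> \<noteq> \<omega> \<Longrightarrow> mult_span (g \<alpha> \<omega>) \<and> g \<alpha> \<omega> \<alpha> = 1 \<and> g \<alpha> \<omega> \<omega> = 0" by blast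
  define e where "e \<alpha> \<rho> = (\<Prod>\<omega>\<in>\<Omega> - {\<alpha>}. g \<alpha> \<omega> \<rho>)" for \<alpha> \<rho>
  have e: "mult_span (e \<alpha>)" for \<alpha> unfolding e_def using g by (intro mult_span_prod) auto
  have e_eq: "e \<alpha> \<rho> = (if \<rho> = \<alpha> then 1 else 0)" if "\<rho> \<in> \<Omega>" for \<alpha> \<rho>
  proof (cases "\<rho> = \<alpha>")
    case True
    have "g \<alpha> \<omega> \<alpha> = 1" if "\<omega> \<in> \<Omega> - {\<alpha>}" for \<omega>
      using g[of \<alpha> \<omega>] that by blast
    then show ?thesis unfolding e_def using True by (simp add: prod.neutral)
  next
    case False
    then have "\<rho> \<in> \<Omega> - {\<alpha>}" "g \<alpha> \<rho> \<rho> = 0" using that g by auto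
    then show ?thesis unfolding e_def using assms False by (auto intro!: prod_zero)
  qed
  let ?\<gamma> = "\<lambda>\<rho>. \<Sum>\<alpha>\<in>\<Omega>. \<beta> \<alpha> * e \<alpha> \<rho>"
  have "mult_span ?\<gamma>" by (intro mult_span_sum mult_span.scale e)
  moreover have "?\<gamma> \<rho> = \<beta> \<rho>" if "\<rho> \<in> \<Omega>" for \<rho>
    using that assms by (simp add: e_eq if_distrib[of "\<lambda>z. _ * z"] cong: if_cong)
  ultimately show ?thesis by blast
qed

section \<open>B-series of a tree function\<close>

definition trees_upto :: "nat \<Rightarrow> rtree set" where "trees_upto n = {\<tau>. nverts \<tau> \<le> n}"

definition forests_upto :: "nat \<Rightarrow> forest set" where "forests_upto n = {\<omega>. forest_order \<omega> \<le> n}"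

lemma nverts_pos: "1 \<le> nverts \<tau>"
  by (cases \<tau>) simp

lemma forests_upto_eq: "forests_upto n = bounded_msets (trees_upto n) nverts n"
  unfolding forests_upto_def bounded_msets_def trees_upto_def
  using forest_order_member by (fastforce simp: forest_order_def)

lemma trees_upto_Suc: "trees_upto (Suc n) = Node ` forests_upto n"
proof (rule Set.set_eqI)
  fix \<tau> show "\<tau> \<in> trees_upto (Suc n) \<longleftrightarrow> \<tau> \<in> Node ` forests_upto n"
    by (cases \<tau>) (auto simp: trees_upto_def forests_upto_def nverts_Node simp del: nverts.simps)
qed

lemma trees_upto_0: "trees_upto 0 = {}"
proof -
  have "nverts \<tau> \<noteq> 0" for \<tau> using nverts_pos[of \<tau>] by linarith
  then show ?thesis by (simp add: trees_upto_def)
qed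

text \<open>This makes the sums in \<open>bseries\<close> genuine, as a sum over an infinite set would be \<open>0\<close>.\<close>

lemma finite_trees_upto: "finite (trees_upto n)"
proof (induction n)
  case 0
  show ?case by (simp add: trees_upto_0)
next
  case (Suc n)
  then show ?case
    unfolding trees_upto_Suc forests_upto_eq by (intro finite_imageI finite_bounded_msets nverts_pos)
qed

lemma finite_forests_upto: "finite (forests_upto n)"
  unfolding forests_upto_eq by (intro finite_bounded_msets finite_trees_upto nverts_pos)

lemma elem_diff_tree_Node:
  "elem_diff_tree f (Node M) y = mset_deriv f (image_mset (\<lambda>\<tau>. elem_diff_tree f \<tau> y) M) y"
  by (simp add: mset_deriv_def image_mset.compositionality comp_def)

lemma smooth_elem_diff_tree:
  fixes f :: "'a::euclidean_space \<Rightarrow> 'a"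
  assumes "smooth f"
  shows "smooth (elem_diff_tree f \<tau>)"
proof (induction \<tau>)
  case (Node M)
  have "smooth (\<lambda>y. mset_deriv f (image_mset (\<lambda>\<tau>. elem_diff_tree f \<tau> y) M) y)"
    by (rule smooth_mset_deriv_along[OF assms smooth_linear[OF bounded_linear_ident]]) (rule Node)
  then show ?case by (simp only: elem_diff_tree_Node[symmetric])
qed

text \<open>The terms of positive degree at most \<open>n\<close>; the term of degree \<open>0\<close> is \<open>y\<close>.  Without it the
  expression is linear in the tree function.\<close>

definition trunc_series :: "('a::real_normed_vector \<Rightarrow> 'a) \<Rightarrow> (rtree \<Rightarrow> real) \<Rightarrow> nat \<Rightarrow> real \<Rightarrow> 'a \<Rightarrow> 'a" where
  "trunc_series f a n h y = (\<Sum>\<tau>\<in>trees_upto n. (a \<tau> / symmetry \<tau> * h ^ nverts \<tau>) *\<^sub>R elem_diff_tree f \<tau> y)"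

definition tree_bseries :: "('a::real_normed_vector \<Rightarrow> 'a) \<Rightarrow> (rtree \<Rightarrow> real) \<Rightarrow> 'a fseries" where
  "tree_bseries f a = bseries f (tree_char a)"

lemma tree_bseries_0: "tree_bseries f a 0 y = y"
proof -
  have "{\<tau>. tree_order \<tau> = 0} = {None}"
  proof (rule Set.set_eqI)
    fix t show "t \<in> {\<tau>. tree_order \<tau> = 0} \<longleftrightarrow> t \<in> {None}"
      using nverts_pos[of "the t"] by (cases t) auto
  qed
  then show ?thesis using tree_char_single[of a "{#}" 1] by (simp add: tree_bseries_def bseries_def)
qed

lemma tree_bseries_pos:
  assumes "0 < n"
  shows "tree_bseries f a n y = (\<Sum>\<tau> | nverts \<tau> = n. (a \<tau> / symmetry \<tau>) *\<^sub>R elem_diff_tree f \<tau> y)"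
proof -
  have "{t. tree_order t = n} = Some ` {\<tau>. nverts \<tau> = n}"
  proof (rule Set.set_eqI)
    fix t show "t \<in> {t. tree_order t = n} \<longleftrightarrow> t \<in> Some ` {\<tau>. nverts \<tau> = n}"
      using assms by (cases t) auto
  qed
  then show ?thesis by (simp add: tree_bseries_def bseries_def sum.reindex tree_char_single)
qed

lemma tree_bseries_sum: "(\<Sum>k\<le>n. h ^ k *\<^sub>R tree_bseries f a k y) = y + trunc_series f a n h y"
proof -
  let ?t = "\<lambda>\<tau>. (a \<tau> / symmetry \<tau> * h ^ nverts \<tau>) *\<^sub>R elem_diff_tree f \<tau> y"
  have "(\<Sum>k\<le>n. h ^ k *\<^sub>R tree_bseries f a k y) = y + (\<Sum>k\<in>{1..n}. h ^ k *\<^sub>R tree_bseries f a k y)"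
    by (simp add: atMost_atLeast0 sum.atLeast_Suc_atMost tree_bseries_0)
  also have "(\<Sum>k\<in>{1..n}. h ^ k *\<^sub>R tree_bseries f a k y) = (\<Sum>k\<in>{1..n}. \<Sum>\<tau> | \<tau> \<in> trees_upto n \<and> nverts \<tau> = k. ?t \<tau>)"
  proof (rule sum.cong[OF refl])
    fix k assume "k \<in> {1..n}"
    then have "0 < k" "{\<tau>. \<tau> \<in> trees_upto n \<and> nverts \<tau> = k} = {\<tau>. nverts \<tau> = k}" by (auto simp: trees_upto_def)
    then show "h ^ k *\<^sub>R tree_bseries f a k y = (\<Sum>\<tau> | \<tau> \<in> trees_upto n \<and> nverts \<tau> = k. ?t \<tau>)"
      by (simp add: tree_bseries_pos scaleR_sum_right mult.commute)
  qed
  also have "\<dots> = trunc_series f a n h y"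
    unfolding trunc_series_def using nverts_pos
    by (intro sum.group finite_trees_upto) (auto simp: trees_upto_def Suc_le_eq)
  finally show ?thesis .
qed

lemma smooth_monomial: "smooth (\<lambda>h::real. c * h ^ k)" for c :: real
  using smooth_scaleR[OF smooth_const[of c] smooth_power[OF smooth_linear[OF bounded_linear_ident]], of k] by simp

lemma smooth_fst_power: "smooth (\<lambda>p::real \<times> 'a::euclidean_space. fst p ^ k)"
  by (rule smooth_power[OF smooth_linear[OF bounded_linear_fst]])

text \<open>A tree is \<open>B\<^sub>+\<close> of a unique forest, so functions on trees are functions on forests.\<close>

definition lift_forest :: "(forest \<Rightarrow> real) \<Rightarrow> rtree \<Rightarrow> real" where
  "lift_forest \<beta> \<tau> = (case \<tau> of Node \<omega> \<Rightarrow> \<beta> \<omega>)"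

lemma lift_forest_Node [simp]: "lift_forest \<beta> (Node \<omega>) = \<beta> \<omega>"
  by (simp add: lift_forest_def)

lemma trunc_series_cong: "(\<And>\<tau>. \<tau> \<in> trees_upto n \<Longrightarrow> a \<tau> = b \<tau>) \<Longrightarrow> trunc_series f a n h y = trunc_series f b n h y"
  unfolding trunc_series_def by (rule sum.cong) auto

lemma trunc_series_add: "trunc_series f (\<lambda>\<tau>. a \<tau> + b \<tau>) n h y = trunc_series f a n h y + trunc_series f b n h y"
  by (simp add: trunc_series_def add_divide_distrib distrib_right scaleR_add_left sum.distrib)

lemma trunc_series_scale: "trunc_series f (\<lambda>\<tau>. r * a \<tau>) n h y = r *\<^sub>R trunc_series f a n h y"
  by (simp add: trunc_series_def scaleR_sum_right mult.assoc)

text \<open>For \<open>b = lift_forest \<beta>\<close> this is the part of \<open>a \<cdot> b\<close> that depends on \<open>b\<close>; it is linear in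
  \<open>\<beta>\<close>.\<close>

definition coact_value :: "(rtree \<Rightarrow> real) \<Rightarrow> (forest \<Rightarrow> real) \<Rightarrow> rtree \<Rightarrow> real" where
  "coact_value a \<beta> = lift_forest (\<lambda>M. lin_ext (\<lambda>r. r) \<beta> (forest_prod (coact_tree a) M))"

lemma tree_conv_lift_forest: "tree_conv a (lift_forest \<beta>) \<tau> = a \<tau> + coact_value a \<beta> \<tau>"
  by (cases \<tau>) (simp add: tree_conv_Node tree_char_graft coact_value_def)

text \<open>If \<open>\<beta>\<close> is multiplicative, it commutes with the product over the branches in the recursion of
  \<open>coact_tree\<close>.\<close>

lemma coact_value_forest_prod:
  "coact_value a (forest_prod x) = lift_forest (forest_prod (tree_conv a x))"
proof -
  have "tree_char x (forest_prod (coact_tree a) M) = forest_prod (tree_conv a x) M" for M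
    unfolding tree_conv_def[abs_def] by (rule forest_prod_hom) (auto simp: tree_char_one tree_char_mult)
  then show ?thesis unfolding coact_value_def tree_char_def by simp
qed

lemma keys_forest_coact:
  assumes "\<omega> \<in> keys (forest_prod (coact_tree a) M)"
  shows "forest_order \<omega> \<le> forest_order M"
proof -
  obtain r where r: "forest_prod (coact_tree a) M = basis M + r" "\<forall>\<omega>\<in>keys r. forest_order \<omega> < forest_order M"
    using has_leading_forest_coact[of M a] unfolding has_leading_forest_def by blast
  have "keys (basis M + r) \<subseteq> {M} \<union> keys r" using keys_add[of "basis M" r] by simp
  then show ?thesis using assms r by (auto simp: less_imp_le)
qed

context
  fixes f :: "'a::euclidean_space \<Rightarrow> 'a"
  assumes f: "smooth f"
begin

lemma smooth_trunc_series_joint: "smooth (\<lambda>p. trunc_series f a n (fst p) (snd p))"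
proof -
  have "smooth (\<lambda>p::real \<times> 'a. elem_diff_tree f \<tau> (snd p))" for \<tau>
    by (rule smooth_compose[OF smooth_elem_diff_tree[OF f] smooth_linear[OF bounded_linear_snd]])
  moreover have "smooth (\<lambda>p::real \<times> 'a. c * fst p ^ k)" for c k
    using smooth_scaleR[OF smooth_const[of c] smooth_fst_power, of k] by simp
  ultimately show ?thesis unfolding trunc_series_def by (intro smooth_sum smooth_scaleR)
qed

lemma smooth_trunc_series_along:
  fixes Y :: "real \<Rightarrow> 'a"
  assumes "smooth Y"
  shows "smooth (\<lambda>h. trunc_series f a n h (Y h))"
  unfolding trunc_series_def
  by (intro smooth_sum smooth_scaleR smooth_monomial)
     (rule smooth_compose[OF smooth_elem_diff_tree[OF f] assms])

lemma smooth_trunc_series_time: "smooth (\<lambda>h. trunc_series f a n h y)"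
  by (rule smooth_trunc_series_along[OF smooth_const])

lemma trunc_series_trunc:
  assumes "m \<le> n"
  shows "vanish (Suc m) (\<lambda>h. trunc_series f a n h y - trunc_series f a m h y)"
proof -
  let ?t = "\<lambda>h \<tau>. (a \<tau> / symmetry \<tau> * h ^ nverts \<tau>) *\<^sub>R elem_diff_tree f \<tau> y"
  have diff: "trunc_series f a n h y - trunc_series f a m h y = (\<Sum>\<tau>\<in>trees_upto n - trees_upto m. ?t h \<tau>)" for h
    unfolding trunc_series_def using assms
    by (intro sum_diff[symmetric] finite_trees_upto) (auto simp: trees_upto_def)
  have "vanish (Suc m) (\<lambda>h. ?t h \<tau>)" if "\<tau> \<in> trees_upto n - trees_upto m" for \<tau>
  proof -
    have "vanish (nverts \<tau> + 0) (\<lambda>h. h ^ nverts \<tau> *\<^sub>R ((a \<tau> / symmetry \<tau>) *\<^sub>R elem_diff_tree f \<tau> y))"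
      by (rule vanish_power_scaleR[OF vanish_const])
    from vanish_mono[OF this, of "Suc m"] show ?thesis using that by (simp add: trees_upto_def mult.commute)
  qed
  then show ?thesis unfolding diff by (rule vanish_sum)
qed

text \<open>The vector field evaluated at a B-series is, after multiplication by \<open>h\<close>, again a B-series: in
  Taylor's formula in the directions of the elementary differentials the multisets of trees are
  the forests \<open>\<omega>\<close>, the derivative is the elementary differential of \<open>Node \<omega>\<close>, and the factorials
  complete the symmetry coefficients of the branches to that of \<open>Node \<omega>\<close>.\<close>

lemma vector_field_of_bseries:
  "vanish (Suc (Suc n)) (\<lambda>h. h *\<^sub>R f (y + trunc_series f x n h y) - trunc_series f (lift_forest (forest_prod x)) (Suc n) h y)"
proof -
  let ?c = "\<lambda>\<tau>. x \<tau> / symmetry \<tau>" and ?w = "\<lambda>\<tau>. elem_diff_tree f \<tau> y"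
  let ?S = "\<lambda>h. \<Sum>\<omega>\<in>forests_upto n. (h ^ forest_order \<omega> * mset_coeff ?c (trees_upto n) \<omega>) *\<^sub>R mset_deriv f (image_mset ?w \<omega>) y"
  have "vanish (Suc n) (\<lambda>h. f (y + trunc_series f x n h y) - ?S h)"
    unfolding trunc_series_def forests_upto_eq forest_order_def
    by (rule multi_taylor[OF finite_trees_upto nverts_pos f])
  from vanish_power_scaleR[OF this, of 1]
  have "vanish (Suc (Suc n)) (\<lambda>h. h *\<^sub>R f (y + trunc_series f x n h y) - h *\<^sub>R ?S h)"
    by (simp add: scaleR_diff_right)
  moreover have "h *\<^sub>R ?S h = trunc_series f (lift_forest (forest_prod x)) (Suc n) h y" for h
  proof -
    have coeff: "mset_coeff ?c (trees_upto n) \<omega> = forest_prod x \<omega> / symmetry (Node \<omega>)" if "\<omega> \<in> forests_upto n" for \<omega>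
    proof -
      have "set_mset \<omega> \<subseteq> trees_upto n" using that by (auto simp: forests_upto_eq bounded_msets_def)
      then have "mset_coeff ?c (trees_upto n) \<omega> = (\<Prod>\<tau>\<in>set_mset \<omega>. ?c \<tau> ^ count \<omega> \<tau> / fact (count \<omega> \<tau>))"
        unfolding mset_coeff_def
        by (intro prod.mono_neutral_right finite_trees_upto) (auto simp: not_in_iff)
      also have "\<dots> = (\<Prod>\<tau>\<in>set_mset \<omega>. x \<tau> ^ count \<omega> \<tau>) / real (\<Prod>\<tau>\<in>set_mset \<omega>. fact (count \<omega> \<tau>) * symmetry \<tau> ^ count \<omega> \<tau>)"
        unfolding of_nat_prod prod_dividef[symmetric]
        by (intro prod.cong refl) (simp add: power_divide)
      finally show ?thesis by (simp add: image_prod_mset_multiplicity)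
    qed
    have "trunc_series f (lift_forest (forest_prod x)) (Suc n) h y = (\<Sum>\<omega>\<in>forests_upto n.
        (forest_prod x \<omega> / symmetry (Node \<omega>) * h ^ Suc (forest_order \<omega>)) *\<^sub>R elem_diff_tree f (Node \<omega>) y)"
      unfolding trunc_series_def trees_upto_Suc
      by (subst sum.reindex) (auto simp: inj_on_def nverts_Node simp del: nverts.simps symmetry.simps elem_diff_tree.simps)
    also have "\<dots> = h *\<^sub>R ?S h"
      unfolding scaleR_sum_right
      by (intro sum.cong refl) (simp add: coeff elem_diff_tree_Node del: elem_diff_tree.simps symmetry.simps)
    finally show ?thesis ..
  qed
  ultimately show ?thesis by simp
qed

lemma vector_field_of_bseries_along:
  assumes "vanish 0 Y"
  shows "vanish (Suc (Suc n)) (\<lambda>h. h *\<^sub>R f (Y h + trunc_series f x n h (Y h)) - trunc_series f (lift_forest (forest_prod x)) (Suc n) h (Y h))"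
proof -
  (* The error for a fixed base point, as a smooth function of the step size and that point. *)
  define R where "R p = fst p *\<^sub>R f (snd p + trunc_series f x n (fst p) (snd p)) - trunc_series f (lift_forest (forest_prod x)) (Suc n) (fst p) (snd p)" for p :: "real \<times> 'a"
  have "smooth (\<lambda>p. f (snd p + trunc_series f x n (fst p) (snd p)))"
    by (rule smooth_compose[OF f smooth_add[OF smooth_linear[OF bounded_linear_snd] smooth_trunc_series_joint]])
  then have "smooth R" unfolding R_def
    by (rule smooth_diff[OF smooth_scaleR[OF smooth_linear[OF bounded_linear_fst]] smooth_trunc_series_joint])
  moreover have "vanish (Suc (Suc n)) (\<lambda>h. R (h, y))" for y
    unfolding R_def fst_conv snd_conv by (rule vector_field_of_bseries)
  ultimately have "vanish (Suc (Suc n)) (\<lambda>h. R (h, Y h))" using assms by (rule vanish_uniform)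
  then show ?thesis unfolding R_def fst_conv snd_conv .
qed

section \<open>Composition of B-series\<close>

text \<open>The composition law up to \<open>O(h\<^bsup>n+1\<^esup>)\<close>, by induction on \<open>n\<close>.  Let \<open>Y = B(a, y)\<close> and suppose
  first that \<open>b (Node \<omega>) = \<Prod> x \<tau>\<close> is multiplicative in the branches \<open>\<tau>\<close> of \<open>\<omega>\<close>.  Then
  \<open>B(b, Y) = Y + h f(B(x, Y))\<close>, and by the induction hypothesis this is
  \<open>Y + h f(B(a \<cdot> x, y))\<close> to one order more, because of the factor \<open>h\<close>.  Expanding the vector field
  again gives \<open>Y\<close> plus the series with coefficients \<open>\<Prod> (a \<cdot> x) \<tau>\<close>, which is \<open>B(a \<cdot> b, y)\<close>
  by the recursion for the product.  The error is linear in \<open>b\<close>, and on the finitely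
  many trees concerned every \<open>b\<close> is a linear combination of such functions.\<close>

lemma bseries_composition_vanish:
  assumes "n \<le> N"
  shows "vanish (Suc n) (\<lambda>h. ((y + trunc_series f a N h y) + trunc_series f b n h (y + trunc_series f a N h y)) - (y + trunc_series f (tree_conv a b) n h y))"
  using assms
proof (induction n arbitrary: b)
  case 0
  show ?case using trunc_series_trunc[of 0 N a y] by (simp add: trunc_series_def trees_upto_0)
next
  case (Suc n)
  define Y where "Y h = y + trunc_series f a N h y" for h
  have Y: "vanish 0 Y" unfolding Y_def by (intro vanish_add vanish_const vanish_smooth smooth_trunc_series_time)
  (* The error of the composition law apart from the terms that do not involve b. *)
  define E where "E \<beta> h = trunc_series f (lift_forest \<beta>) (Suc n) h (Y h) - trunc_series f (coact_value a \<beta>) (Suc n) h y" for \<beta> h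
  have lift_add: "lift_forest (\<lambda>\<omega>. u \<omega> + v \<omega>) = (\<lambda>\<tau>. lift_forest u \<tau> + lift_forest v \<tau>)"
    "lift_forest (\<lambda>\<omega>. r * u \<omega>) = (\<lambda>\<tau>. r * lift_forest u \<tau>)" for u v r
    by (auto simp: lift_forest_def fun_eq_iff split: rtree.split)
  have "lin_ext (\<lambda>r. r) (\<lambda>\<omega>. u \<omega> + v \<omega>) z = lin_ext (\<lambda>r. r) u z + lin_ext (\<lambda>r. r) v z"
    "lin_ext (\<lambda>r. r) (\<lambda>\<omega>. r * u \<omega>) z = r * lin_ext (\<lambda>r. r) u z" for u v :: "forest \<Rightarrow> real" and r z
    by (simp_all add: lin_ext_def distrib_left sum.distrib sum_distrib_left mult.left_commute)
  then have coact_add: "coact_value a (\<lambda>\<omega>. u \<omega> + v \<omega>) = (\<lambda>\<tau>. coact_value a u \<tau> + coact_value a v \<tau>)"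
    "coact_value a (\<lambda>\<omega>. r * u \<omega>) = (\<lambda>\<tau>. r * coact_value a u \<tau>)" for u v r
    by (simp_all add: coact_value_def lift_add)
  have span: "vanish (Suc (Suc n)) (E \<beta>)" if "mult_span \<beta>" for \<beta>
    using that
  proof (induction rule: mult_span.induct)
    case (generator x)
    let ?b = "tree_conv a x"
    let ?u = "\<lambda>h. Y h + trunc_series f x n h (Y h)" and ?v = "\<lambda>h. y + trunc_series f ?b n h y"
    have "vanish (Suc n) (\<lambda>h. ?u h - ?v h)"
      unfolding Y_def using Suc by simp
    moreover have v: "vanish 0 ?v" by (intro vanish_add vanish_const vanish_smooth smooth_trunc_series_time)
    moreover have "vanish 0 ?u"
      using vanish_add[OF vanish_mono[OF \<open>vanish (Suc n) (\<lambda>h. ?u h - ?v h)\<close>, of 0] v] by simp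
    ultimately have "vanish (Suc n) (\<lambda>h. f (?u h) - f (?v h))"
      by (intro vanish_smooth_compose[OF f])
    from vanish_power_scaleR[OF this, of 1]
    have "vanish (Suc (Suc n)) (\<lambda>h. h *\<^sub>R f (?u h) - h *\<^sub>R f (?v h))"
      by (simp add: scaleR_diff_right)
    from vanish_trans[OF this vector_field_of_bseries]
    have "vanish (Suc (Suc n)) (\<lambda>h. h *\<^sub>R f (?u h) - trunc_series f (lift_forest (forest_prod ?b)) (Suc n) h y)" .
    from vanish_diff[OF this vector_field_of_bseries_along[OF Y, of n x]]
    show ?case by (simp add: E_def coact_value_forest_prod)
  next
    case (add u v)
    have "E (\<lambda>\<omega>. u \<omega> + v \<omega>) = (\<lambda>h. E u h + E v h)"
      by (simp add: fun_eq_iff E_def coact_add lift_add trunc_series_add algebra_simps)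
    then show ?case using vanish_add[OF add.IH] by simp
  next
    case (scale u r)
    have "E (\<lambda>\<omega>. r * u \<omega>) = (\<lambda>h. r *\<^sub>R E u h)"
      by (simp add: fun_eq_iff E_def coact_add lift_add trunc_series_scale scaleR_diff_right)
    then show ?case using vanish_const_scaleR[OF scale.IH, of r] by simp
  qed
  define \<beta> where "\<beta> \<omega> = b (Node \<omega>)" for \<omega>
  have b: "b = lift_forest \<beta>" by (auto simp: \<beta>_def lift_forest_def split: rtree.split)
  (* Both series in the error see \<beta> only on forests with at most n vertices. *)
  obtain \<gamma> where \<gamma>: "mult_span \<gamma>" "\<forall>\<omega>\<in>forests_upto n. \<gamma> \<omega> = \<beta> \<omega>"
    using mult_span_interpolates[OF finite_forests_upto] by blast
  have "E \<gamma> h = E \<beta> h" for h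
  proof -
    have "lin_ext (\<lambda>r. r) \<gamma> (forest_prod (coact_tree a) M) = lin_ext (\<lambda>r. r) \<beta> (forest_prod (coact_tree a) M)"
      if "M \<in> forests_upto n" for M
      unfolding lin_ext_def using that \<gamma>(2) keys_forest_coact[of _ a M]
      by (intro sum.cong refl) (force simp: forests_upto_def)
    then show ?thesis
      using \<gamma>(2) unfolding E_def coact_value_def
      by (intro arg_cong2[of _ _ _ _ "(-)"] trunc_series_cong) (auto simp: trees_upto_Suc)
  qed
  then have "vanish (Suc (Suc n)) (E \<beta>)" using span[OF \<gamma>(1)] by presburger
  moreover have "vanish (Suc (Suc n)) (\<lambda>h. trunc_series f a N h y - trunc_series f a (Suc n) h y)"
    by (rule trunc_series_trunc) (use Suc.prems in simp)
  ultimately have "vanish (Suc (Suc n)) (\<lambda>h. E \<beta> h + (trunc_series f a N h y - trunc_series f a (Suc n) h y))" by (rule vanish_add)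
  moreover have "trunc_series f (tree_conv a b) (Suc n) h y = trunc_series f a (Suc n) h y + trunc_series f (coact_value a \<beta>) (Suc n) h y" for h
    unfolding b trunc_series_add[symmetric] by (rule trunc_series_cong) (rule tree_conv_lift_forest)
  ultimately show ?case by (simp add: E_def Y_def b algebra_simps)
qed

lemma tree_bseries_composition: "fs_comp (tree_bseries f b) (tree_bseries f a) = tree_bseries f (tree_conv a b)"
proof (intro ext)
  fix n y
  let ?u = "\<lambda>h. (y + trunc_series f a n h y) + trunc_series f b n h (y + trunc_series f a n h y)"
  have Y: "smooth (\<lambda>h. y + trunc_series f a n h y)" by (rule smooth_add[OF smooth_const smooth_trunc_series_time])
  from smooth_add[OF Y smooth_trunc_series_along[OF Y]] have u: "smooth ?u" .
  have "taylor_coeff n ?u = tree_bseries f (tree_conv a b) n y"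
    by (rule taylor_coeff_eqI[OF u, of n]) (use bseries_composition_vanish[of n n y a b] in \<open>simp_all only: tree_bseries_sum\<close>)
  then show "fs_comp (tree_bseries f b) (tree_bseries f a) n y = tree_bseries f (tree_conv a b) n y"
    by (simp add: fs_comp_def tree_bseries_sum)
qed

text \<open>The coefficient of \<open>h\<^sup>n\<close> in \<open>X\<^sub>h(Z\<^sub>h(y))\<close> is \<open>Z n y\<close> plus a term determined by the lower
  coefficients of \<open>Z\<close>.  Here \<open>Z\<close> is an arbitrary formal series; that makes the compositional
  inverse unique among all of them, not only among B-series.\<close>

lemma tree_bseries_right_cancel:
  assumes "fs_comp (tree_bseries f a) Z = fs_comp (tree_bseries f a) Z'"
  shows "Z = Z'"
proof -
  have "Z n y = Z' n y" for n y
  proof (induction n rule: less_induct)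
    case (less n)
    let ?Z = "\<lambda>h. \<Sum>j\<le>n. h ^ j *\<^sub>R Z j y" and ?Z' = "\<lambda>h. \<Sum>j\<le>n. h ^ j *\<^sub>R Z' j y"
    define D where "D = Z n y - Z' n y"
    have diff: "?Z h - ?Z' h = h ^ n *\<^sub>R D" for h
    proof -
      have "?Z h - ?Z' h = (\<Sum>j\<le>n. if j = n then h ^ n *\<^sub>R D else 0)"
        unfolding sum_subtractf[symmetric]
        by (intro sum.cong refl) (use less in \<open>auto simp: D_def scaleR_diff_right\<close>)
      then show ?thesis by simp
    qed
    have sm: "smooth (\<lambda>h. \<Sum>j\<le>n. h ^ j *\<^sub>R X j y)" for X :: "nat \<Rightarrow> 'a \<Rightarrow> 'a"
      by (intro smooth_sum smooth_scaleR smooth_const smooth_power[OF smooth_linear[OF bounded_linear_ident]])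
    let ?u = "\<lambda>X h. (\<Sum>j\<le>n. h ^ j *\<^sub>R X j y) + trunc_series f a n h (\<Sum>j\<le>n. h ^ j *\<^sub>R X j y)"
    have smu: "smooth (?u X)" for X :: "nat \<Rightarrow> 'a \<Rightarrow> 'a"
      by (rule smooth_add[OF sm smooth_trunc_series_along[OF sm]])
    have vd: "vanish n (\<lambda>h. ?Z h - ?Z' h)"
      unfolding diff using vanish_power_scaleR[OF vanish_const[of D], of n] by simp
    have "vanish (Suc n) (\<lambda>h. trunc_series f a n h (?Z h) - trunc_series f a n h (?Z' h))"
    proof -
      have "vanish (Suc n) (\<lambda>h. (a \<tau> / symmetry \<tau> * h ^ nverts \<tau>) *\<^sub>R elem_diff_tree f \<tau> (?Z h)
         - (a \<tau> / symmetry \<tau> * h ^ nverts \<tau>) *\<^sub>R elem_diff_tree f \<tau> (?Z' h))" for \<tau>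
      proof -
        have "vanish n (\<lambda>h. elem_diff_tree f \<tau> (?Z h) - elem_diff_tree f \<tau> (?Z' h))"
          by (rule vanish_smooth_compose[OF smooth_elem_diff_tree[OF f] vd]) (rule vanish_smooth[OF sm])+
        from vanish_const_scaleR[OF vanish_power_scaleR[OF this, of "nverts \<tau>"], of "a \<tau> / symmetry \<tau>"]
        have "vanish (nverts \<tau> + n) (\<lambda>h. (a \<tau> / symmetry \<tau> * h ^ nverts \<tau>) *\<^sub>R elem_diff_tree f \<tau> (?Z h)
         - (a \<tau> / symmetry \<tau> * h ^ nverts \<tau>) *\<^sub>R elem_diff_tree f \<tau> (?Z' h))"
          by (simp add: scaleR_diff_right)
        then show ?thesis by (rule vanish_mono) (use nverts_pos[of \<tau>] in simp)
      qed
      then show ?thesis unfolding trunc_series_def sum_subtractf[symmetric] by (rule vanish_sum)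
    qed
    then have 1: "vanish (Suc n) (\<lambda>h. ?u Z h - ?u Z' h - h ^ n *\<^sub>R D)"
      using diff by (simp add: algebra_simps)
    (* Subtracting both Taylor expansions leaves a polynomial of order O(h^(n+1)); its top
       coefficient compares the difference D with the two given coefficients, which agree. *)
    let ?t = "\<lambda>X k. taylor_coeff k (?u X)"
    have "vanish (Suc n) (\<lambda>h. (?u Z h - ?u Z' h - h ^ n *\<^sub>R D)
       - ((?u Z h - (\<Sum>k\<le>n. h ^ k *\<^sub>R ?t Z k)) - (?u Z' h - (\<Sum>k\<le>n. h ^ k *\<^sub>R ?t Z' k))))"
      by (intro vanish_diff 1 taylor_curve smu)
    moreover have "(?u Z h - ?u Z' h - h ^ n *\<^sub>R D)
       - ((?u Z h - (\<Sum>k\<le>n. h ^ k *\<^sub>R ?t Z k)) - (?u Z' h - (\<Sum>k\<le>n. h ^ k *\<^sub>R ?t Z' k)))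
       = (\<Sum>k\<le>n. h ^ k *\<^sub>R (?t Z k - ?t Z' k - (if k = n then D else 0)))" for h
    proof -
      have "(\<Sum>k\<le>n. h ^ k *\<^sub>R (if k = n then D else 0)) = h ^ n *\<^sub>R D"
        by (simp add: if_distrib[of "\<lambda>z. _ *\<^sub>R z"] cong: if_cong)
      then show ?thesis by (simp add: scaleR_diff_right sum_subtractf)
    qed
    ultimately have "vanish (Suc n) (\<lambda>h. \<Sum>k\<le>n. h ^ k *\<^sub>R (?t Z k - ?t Z' k - (if k = n then D else 0)))" by simp
    from vanish_polynomial[OF this, of n] have "?t Z n - ?t Z' n = D" by simp
    moreover have "?t Z n = ?t Z' n"
      using fun_cong[OF fun_cong[OF assms, of n], of y] by (simp add: fs_comp_def tree_bseries_sum)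
    ultimately show "Z n y = Z' n y" by (simp add: D_def)
  qed
  then show ?thesis by blast
qed

lemma tree_bseries_zero: "tree_bseries f (\<lambda>_. 0) = fs_id"
proof (intro ext)
  fix n y show "tree_bseries f (\<lambda>_. 0) n y = fs_id n y"
    by (cases "n = 0") (auto simp: tree_bseries_0 tree_bseries_pos fs_id_def)
qed

lemma fs_inverse_tree_bseries:
  assumes "tree_conv a b = (\<lambda>_. 0)" "tree_conv b a = (\<lambda>_. 0)"
  shows "fs_inverse (tree_bseries f a) = tree_bseries f b"
  unfolding fs_inverse_def
proof (rule the_equality)
  show inv: "fs_comp (tree_bseries f b) (tree_bseries f a) = fs_id \<and> fs_comp (tree_bseries f a) (tree_bseries f b) = fs_id"
    by (simp add: tree_bseries_composition assms tree_bseries_zero)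
  show "Y = tree_bseries f b" if "fs_comp Y (tree_bseries f a) = fs_id \<and> fs_comp (tree_bseries f a) Y = fs_id" for Y
    by (rule tree_bseries_right_cancel[where a = a]) (use that inv in simp)
qed

end

lemma fs_reverse_tree_bseries: "fs_reverse (tree_bseries f a) = tree_bseries f (tree_rev a)"
proof (intro ext)
  fix n y show "fs_reverse (tree_bseries f a) n y = tree_bseries f (tree_rev a) n y"
    by (cases "n = 0") (auto simp: fs_reverse_def tree_bseries_0 tree_bseries_pos tree_rev_def scaleR_sum_right intro!: sum.cong)
qed

section \<open>The decomposition of a B-series method\<close>

theorem corollary5p3:
  fixes \<psi> :: "bck \<Rightarrow> real"
  assumes "character \<psi>"
  shows "\<exists>\<psi>\<^sub>m \<psi>\<^sub>p. character \<psi>\<^sub>m \<and> character \<psi>\<^sub>p \<and>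
    \<psi> = char_comp \<psi>\<^sub>m \<psi>\<^sub>p \<and> symmetric_char \<psi>\<^sub>m \<and> antisymmetric_char \<psi>\<^sub>p \<and>
    char_comp \<psi>\<^sub>m \<psi>\<^sub>m = char_comp \<psi> (char_adjoint \<psi>) \<and>
    (\<forall>f :: real ^ 'n \<Rightarrow> real ^ 'n. smooth f \<longrightarrow>
       bseries f \<psi> = fs_comp (bseries f \<psi>\<^sub>m) (bseries f \<psi>\<^sub>p) \<and>
       bseries f \<psi>\<^sub>m = fs_adjoint (bseries f \<psi>\<^sub>m) \<and>
       bseries f \<psi>\<^sub>p = fs_reverse (bseries f \<psi>\<^sub>p) \<and>
       fs_comp (bseries f \<psi>\<^sub>m) (bseries f \<psi>\<^sub>m) =
         fs_comp (bseries f \<psi>) (fs_adjoint (bseries f \<psi>)))"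
proof -
  obtain a where a: "\<psi> = tree_char a" using assms character_iff by blast
  obtain m p where mp: "tree_conv p m = a" "tree_rev p = p" "m = tree_inv (tree_rev m)"
    "tree_conv m m = tree_conv (tree_inv (tree_rev a)) a" by (rule tree_function_decomposition)
  have "antisymmetric_char (tree_char p)"
    unfolding antisymmetric_char_def
  proof
    fix \<tau> show "(- 1) ^ tree_order \<tau> * tree_char p (basis (as_forest \<tau>)) = tree_char p (basis (as_forest \<tau>))"
      using fun_cong[OF mp(2), of "the \<tau>"] by (cases \<tau>) (auto simp: tree_char_single tree_rev_def)
  qed
  moreover have "symmetric_char (tree_char m)"
    using mp(3) by (simp add: symmetric_char_def char_adjoint_tree_char)
  moreover have "tree_char a = char_comp (tree_char m) (tree_char p)"
    "char_comp (tree_char m) (tree_char m) = char_comp (tree_char a) (char_adjoint (tree_char a))"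
    by (simp_all add: char_comp_def char_adjoint_tree_char convolution_tree_char mp(1,4))
  moreover have "tree_bseries f a = fs_comp (tree_bseries f m) (tree_bseries f p) \<and>
       tree_bseries f m = fs_adjoint (tree_bseries f m) \<and>
       tree_bseries f p = fs_reverse (tree_bseries f p) \<and>
       fs_comp (tree_bseries f m) (tree_bseries f m) = fs_comp (tree_bseries f a) (fs_adjoint (tree_bseries f a))"
    if f: "smooth f" for f :: "real ^ 'n \<Rightarrow> real ^ 'n"
  proof -
    have adjoint: "fs_adjoint (tree_bseries f b) = tree_bseries f (tree_inv (tree_rev b))" for b
      unfolding fs_adjoint_def fs_reverse_tree_bseries
      by (rule fs_inverse_tree_bseries[OF f tree_conv_tree_inv_right tree_conv_tree_inv_left])
    show ?thesis
      using mp(3) by (simp add: tree_bseries_composition[OF f] adjoint fs_reverse_tree_bseries mp(1,2,4))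
  qed
  ultimately show ?thesis
    unfolding a tree_bseries_def using character_tree_char by blast
qed

end
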